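(* Let $d,d'\ge 1$ and let $V_0,\dots,V_{d'}\in\mathcal{C}^{1,1}_{b,Lip}(\mathbb{R}^d\times\mathcal{P}_2(\mathbb{R}^d);\mathbb{R}^d)$. For $x\in\mathbb{R}^d$ let $\Phi_{0,t}(x)$, $t\ge0$, be the unique solution of the McKean-Vlasov SDE $$X_t=x+\sum_{k=0}^{d'}\int_0^tV_k(X_r,P_{X_r})\,\mathrm{d}W_r^k ,$$ and let $\partial_x\Phi_{0,t}(\omega,x)$ be its Jacobian matrix in the initial value $x$. Then there is a constant $\kappa>0$ such that the following holds. For any $x\in\mathbb{R}^d$ there exists a set $\Omega(x)\subset\Omega$ of full $P$-measure such that for any $\omega\in\Omega(x)$ there exist $r(\omega,x)\le d$ linear subspaces of $\mathbb{R}^d$, $$\{0\}=E_0\subset E_1(\omega,x)\subset\dots\subset E_{r(\omega,x)}(\omega,x)=\mathbb{R}^d,$$ and numbers $$-\infty\le\lambda_1(\omega,x)<\lambda_2(\omega,x)<\dots<\lambda_{r(\omega,x)}(\omega,x)\le\kappa$$ such that for any $1\le i\le r(\omega,x)$ and any $v\in E_i(\omega,x)\setminus E_{i-1}(\omega,x)$, $$\limsup_{t\to+\infty}\frac1t\log|\partial_x\Phi_{0,t}(\omega,x)v|=\lambda_i(\omega,x).$$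
   Context: $\mathcal{P}_2(\mathbb{R}^d)$ is the set of Borel probability measures on $\mathbb{R}^d$ with finite second moment, $W_2$ the 2-Wasserstein metric, $|\cdot|$ the Euclidean norm, $\|\cdot\|$ the 2-norm of $d\times d$ matrices. $W_t=(W^1_t,\dots,W^{d'}_t)$ is a standard $d'$-dimensional Brownian motion, realized on its canonical (Wiener) probability space $(\Omega,\mathcal{F},P)$; $\mathrm{d}W^0_r:=\mathrm{d}r$. $P_\xi$ denotes the law of a random variable $\xi$. Convention: $\log 0=-\infty$. Lions derivative: $f:\mathcal{P}_2(\mathbb{R}^d)\to\mathbb{R}$ is Lions differentiable at $P_v$ if its lift $\tilde f(w):=f(P_w)$, defined on square-integrable $\mathbb{R}^d$-valued random variables on a probability space rich enough to carry every law in $\mathcal{P}_2(\mathbb{R}^d)$, is Fréchet differentiable at $v$; the derivative is then represented as $D\tilde f(v)(h)=E[\partial_\mu f(P_v,v)\cdot h]$ with $\partial_\mu f(P_v,\cdot):\mathbb{R}^d\to\mathbb{R}^d$ (determined $P_v$-a.s.; a Lipschitz continuous version is used when it exists). For vector-valued maps it is taken componentwise, giving a matrix. $V\in\mathcal{C}^{1,1}_{b,Lip}(\mathbb{R}^d\times\mathcal{P}_2(\mathbb{R}^d);\mathbb{R}^d)$ means that $\partial_xV(x,\mu)$ and $\partial_\mu V(x,\mu,v)$ exist and there is $K>0$ such that for all $x,x',v,v'\in\mathbb{R}^d$ and $\mu,\mu'\in\mathcal{P}_2(\mathbb{R}^d)$: $\|\partial_xV(x,\mu)\|+\|\partial_\mu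 V(x,\mu,v)\|\le K$; $\|\partial_xV(x,\mu)-\partial_xV(x',\mu')\|\le K(|x-x'|+W_2(\mu,\mu'))$; $\|\partial_\mu V(x,\mu,v)-\partial_\mu V(x',\mu',v')\|\le K(|x-x'|+W_2(\mu,\mu')+|v-v'|)$. Under these assumptions the SDE has a unique solution, and there is a modification of $\Phi_{0,t}(x)$ for which $x\mapsto\Phi_{0,t}(x)$ is $P$-a.s. differentiable; its Jacobian matrix $\partial_x\Phi_{0,t}(x)$ is (continuous in $t$ and) the solution of $$\partial_x\Phi_{0,t}(x)=I+\sum_{k=0}^{d'}\int_0^t\Big(\partial_xV_k(\Phi_{0,r}(x),P_{\Phi_{0,r}(x)})\,\partial_x\Phi_{0,r}(x)+\widetilde E\big[\partial_\mu V_k(\Phi_{0,r}(x),P_{\Phi_{0,r}(x)},\widetilde\Phi_{0,r}(x))\,\partial_x\widetilde\Phi_{0,r}(x)\big]\Big)\mathrm{d}W^k_r,$$ where $(\widetilde\Phi,\partial_x\widetilde\Phi)$ is an independent copy of $(\Phi,\partial_x\Phi)$ on another probability space and $\widetilde E$ is expectation over that copy only. *)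

theory Defs
  imports "HOL-Probability.Probability"
begin

section \<open>Square-integrable random variables, the space P2 and the Wasserstein metric\<close>

definition L2_rv :: "'w measure \<Rightarrow> ('w \<Rightarrow> 'a::euclidean_space) set" where
  "L2_rv M = {X. X \<in> borel_measurable M \<and> integrable M (\<lambda>\<omega>. (norm (X \<omega>))\<^sup>2)}"

definition L2_rv_norm :: "'w measure \<Rightarrow> ('w \<Rightarrow> 'a::euclidean_space) \<Rightarrow> real" where
  "L2_rv_norm M X = sqrt (\<integral>\<omega>. (norm (X \<omega>))\<^sup>2 \<partial>M)"

definition P2 :: "('a::euclidean_space) measure set" where
  "P2 = {\<mu>. prob_space \<mu> \<and> sets \<mu> = sets borel \<and> integrable \<mu> (\<lambda>x. (norm x)\<^sup>2)}"

definition couplings :: "'a::euclidean_space measure \<Rightarrow> 'a measure \<Rightarrow> ('a \<times> 'a) measure set" where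
  "couplings \<mu> \<nu> = {\<pi>. prob_space \<pi> \<and> sets \<pi> = sets (borel \<Otimes>\<^sub>M borel) \<and>
     distr \<pi> borel fst = \<mu> \<and> distr \<pi> borel snd = \<nu>}"

definition wasserstein2 :: "'a::euclidean_space measure \<Rightarrow> 'a measure \<Rightarrow> real" where
  "wasserstein2 \<mu> \<nu> = sqrt (INF \<pi>\<in>couplings \<mu> \<nu>. \<integral>p. (norm (fst p - snd p))\<^sup>2 \<partial>\<pi>)"


section \<open>Lions derivative and the coefficient class\<close>

definition carries_P2 :: "'l measure \<Rightarrow> 'a::euclidean_space itself \<Rightarrow> bool" where
  "carries_P2 L _ \<longleftrightarrow> prob_space L \<and>
     (\<forall>\<mu>\<in>(P2 :: 'a measure set). \<exists>v\<in>borel_measurable L. distr L borel v = \<mu>)"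

text \<open>The lift of \<open>f\<close> to the square-integrable random variables on \<open>L\<close> is Frechet differentiable
  at \<open>v\<close>, with derivative the bounded linear functional \<open>h \<mapsto> E[g(v) \<bullet> h]\<close>. Frechet
  differentiability is written out since random variables on \<open>L\<close> do not form a normed-space type.\<close>

definition has_lions_derivative ::
    "'l measure \<Rightarrow> ('a::euclidean_space measure \<Rightarrow> real) \<Rightarrow> ('a \<Rightarrow> 'a) \<Rightarrow> ('l \<Rightarrow> 'a) \<Rightarrow> bool" where
  "has_lions_derivative L f g v \<longleftrightarrow>
     g \<in> borel_measurable borel \<and> (\<lambda>\<omega>. g (v \<omega>)) \<in> L2_rv L \<and>
     (\<forall>\<epsilon>>0. \<exists>\<delta>>0. \<forall>h\<in>L2_rv L. L2_rv_norm L h < \<delta> \<longrightarrow>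
        \<bar>f (distr L borel (\<lambda>\<omega>. v \<omega> + h \<omega>)) - f (distr L borel v)
          - (\<integral>\<omega>. g (v \<omega>) \<bullet> h \<omega> \<partial>L)\<bar> \<le> \<epsilon> * L2_rv_norm L h)"

text \<open>The class \<open>C\<^sup>1\<^sup>,\<^sup>1\<close> with bounded, Lipschitz derivatives: \<open>DX\<close> is the Jacobian in the space
  variable, and row \<open>i\<close> of \<open>DM x \<mu> v\<close> is the Lions derivative of component \<open>i\<close> of \<open>V x\<close> at
  \<open>\<mu>\<close>, evaluated at \<open>v\<close>. The matrix norm is the operator norm for the Euclidean norm (\<open>norm\<close> on
  \<open>real^'n^'n\<close> would be the Frobenius norm).\<close>

definition mat_norm :: "real^'n^'n \<Rightarrow> real" where
  "mat_norm A = onorm (\<lambda>h. A *v h)"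

definition C11_b_Lip ::
    "'l measure \<Rightarrow> (real^'n \<Rightarrow> (real^'n) measure \<Rightarrow> real^'n) \<Rightarrow> bool" where
  "C11_b_Lip L V \<longleftrightarrow>
     (\<exists>DX :: real^'n \<Rightarrow> (real^'n) measure \<Rightarrow> real^'n^'n.
      \<exists>DM :: real^'n \<Rightarrow> (real^'n) measure \<Rightarrow> real^'n \<Rightarrow> real^'n^'n.
      \<exists>K>0.
       (\<forall>x. \<forall>\<mu>\<in>P2. ((\<lambda>y. V y \<mu>) has_derivative (\<lambda>h. DX x \<mu> *v h)) (at x)) \<and>
       (\<forall>x. \<forall>v\<in>L2_rv L. \<forall>i.
          has_lions_derivative L (\<lambda>\<mu>. V x \<mu> $ i) (\<lambda>y. DM x (distr L borel v) y $ i) v) \<and>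
       (\<forall>x v. \<forall>\<mu>\<in>P2. mat_norm (DX x \<mu>) + mat_norm (DM x \<mu> v) \<le> K) \<and>
       (\<forall>x x'. \<forall>\<mu>\<in>P2. \<forall>\<mu>'\<in>P2.
          mat_norm (DX x \<mu> - DX x' \<mu>') \<le> K * (norm (x - x') + wasserstein2 \<mu> \<mu>')) \<and>
       (\<forall>x x' v v'. \<forall>\<mu>\<in>P2. \<forall>\<mu>'\<in>P2.
          mat_norm (DM x \<mu> v - DM x' \<mu>' v')
            \<le> K * (norm (x - x') + wasserstein2 \<mu> \<mu>' + norm (v - v'))))"


section \<open>Brownian motion on Wiener space\<close>

definition brownian_motion :: "'w measure \<Rightarrow> (real \<Rightarrow> 'w \<Rightarrow> real^'m) \<Rightarrow> bool" where
  "brownian_motion M W \<longleftrightarrow>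
     prob_space M \<and>
     (\<forall>t\<ge>0. W t \<in> borel_measurable M) \<and>
     (\<forall>\<omega>\<in>space M. W 0 \<omega> = 0 \<and> continuous_on {0..} (\<lambda>t. W t \<omega>)) \<and>
     (\<forall>n \<tau>. 0 \<le> \<tau> 0 \<and> (\<forall>j<n. \<tau> j \<le> \<tau> (Suc j)) \<longrightarrow>
        prob_space.indep_vars M (\<lambda>_::nat. borel) (\<lambda>j \<omega>. W (\<tau> (Suc j)) \<omega> - W (\<tau> j) \<omega>) {..<n}) \<and>
     (\<forall>s t. 0 \<le> s \<and> s < t \<longrightarrow>
        prob_space.indep_vars M (\<lambda>_. borel) (\<lambda>k \<omega>. (W t \<omega> - W s \<omega>) $ k) UNIV \<and>
        (\<forall>k. distributed M lborel (\<lambda>\<omega>. (W t \<omega> - W s \<omega>) $ k)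
               (\<lambda>y. ennreal (normal_density 0 (sqrt (t - s)) y))))"

text \<open>Paths live on \<open>{0..}\<close>; \<open>extensional\<close> fixes the irrelevant values at negative times.\<close>

definition path_space :: "(real \<Rightarrow> real^'m) set" where
  "path_space = {\<omega> \<in> extensional {0..}. continuous_on {0..} \<omega> \<and> \<omega> 0 = 0}"

definition wiener_space :: "(real \<Rightarrow> real^'m) measure \<Rightarrow> bool" where
  "wiener_space M \<longleftrightarrow> (\<exists>N.
     space N = path_space \<and>
     sets N = sigma_sets path_space {(\<lambda>\<omega>. \<omega> t) -` A \<inter> path_space | t A. 0 \<le> t \<and> A \<in> sets borel} \<and>
     brownian_motion N (\<lambda>t \<omega>. \<omega> t) \<and>
     M = completion N)"

text \<open>The filtration generated by the canonical process, augmented by the null sets.\<close>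

definition wiener_filtration ::
    "(real \<Rightarrow> real^'m) measure \<Rightarrow> real \<Rightarrow> (real \<Rightarrow> real^'m) measure" where
  "wiener_filtration M t = sigma (space M)
     ({(\<lambda>\<omega>. \<omega> s) -` A \<inter> space M | s A. 0 \<le> s \<and> s \<le> t \<and> A \<in> sets borel} \<union> null_sets M)"


section \<open>The Ito integral\<close>

text \<open>A simple process is given by \<open>n\<close>, times \<open>\<tau> 0 \<le> \<dots> \<le> \<tau> n\<close> and bounded random variables
  \<open>\<xi> i\<close>, measurable at time \<open>\<tau> i\<close>; it takes the value \<open>\<xi> i\<close> on the time interval
  \<open>{\<tau> i<..\<tau> (Suc i)}\<close>.\<close>

definition simple_data ::
    "(real \<Rightarrow> 'w measure) \<Rightarrow> nat \<Rightarrow> (nat \<Rightarrow> real) \<Rightarrow> (nat \<Rightarrow> 'w \<Rightarrow> real) \<Rightarrow> bool" where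
  "simple_data F n \<tau> \<xi> \<longleftrightarrow> 0 \<le> \<tau> 0 \<and>
     (\<forall>i<n. \<tau> i \<le> \<tau> (Suc i) \<and> \<xi> i \<in> borel_measurable (F (\<tau> i)) \<and> (\<exists>C. \<forall>\<omega>. \<bar>\<xi> i \<omega>\<bar> \<le> C))"

definition simple_process ::
    "nat \<Rightarrow> (nat \<Rightarrow> real) \<Rightarrow> (nat \<Rightarrow> 'w \<Rightarrow> real) \<Rightarrow> real \<Rightarrow> 'w \<Rightarrow> real" where
  "simple_process n \<tau> \<xi> t \<omega> = (\<Sum>i<n. \<xi> i \<omega> * indicator {\<tau> i<..\<tau> (Suc i)} t)"

definition simple_integral ::
    "(real \<Rightarrow> 'w \<Rightarrow> real) \<Rightarrow> nat \<Rightarrow> (nat \<Rightarrow> real) \<Rightarrow> (nat \<Rightarrow> 'w \<Rightarrow> real) \<Rightarrow> real \<Rightarrow> 'w \<Rightarrow> real" where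
  "simple_integral B n \<tau> \<xi> t \<omega> =
     (\<Sum>i<n. \<xi> i \<omega> * (B (min t (\<tau> (Suc i))) \<omega> - B (min t (\<tau> i)) \<omega>))"

definition progressively_measurable ::
    "(real \<Rightarrow> 'w measure) \<Rightarrow> (real \<Rightarrow> 'w \<Rightarrow> real) \<Rightarrow> bool" where
  "progressively_measurable F H \<longleftrightarrow>
     (\<forall>T\<ge>0. (\<lambda>(t, \<omega>). H t \<omega>) \<in> borel_measurable (restrict_space borel {0..T} \<Otimes>\<^sub>M F T))"

definition L2_process_norm2 :: "'w measure \<Rightarrow> real \<Rightarrow> (real \<Rightarrow> 'w \<Rightarrow> real) \<Rightarrow> ennreal" where
  "L2_process_norm2 M T H =
     (\<integral>\<^sup>+\<omega>. (\<integral>\<^sup>+t. ennreal ((H t \<omega>)\<^sup>2) * indicator {0..T} t \<partial>lborel) \<partial>M)"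

text \<open>\<open>I\<close> is (a continuous version of) the Ito integral process of the progressively measurable,
  locally square-integrable integrand \<open>H\<close> against the real Brownian motion \<open>B\<close>: the
  \<open>L\<^sup>2\<close>-limit of the integrals of simple processes converging to \<open>H\<close>.\<close>

definition is_ito_integral ::
    "'w measure \<Rightarrow> (real \<Rightarrow> 'w measure) \<Rightarrow> (real \<Rightarrow> 'w \<Rightarrow> real) \<Rightarrow>
     (real \<Rightarrow> 'w \<Rightarrow> real) \<Rightarrow> (real \<Rightarrow> 'w \<Rightarrow> real) \<Rightarrow> bool" where
  "is_ito_integral M F B H I \<longleftrightarrow>
     progressively_measurable F H \<and>
     (\<forall>T\<ge>0. L2_process_norm2 M T H < \<infinity>) \<and>
     (\<forall>t\<ge>0. I t \<in> borel_measurable (F t)) \<and>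
     (\<forall>\<omega>\<in>space M. continuous_on {0..} (\<lambda>t. I t \<omega>)) \<and>
     (\<exists>n \<tau> \<xi>.
        (\<forall>j::nat. simple_data F (n j) (\<tau> j) (\<xi> j)) \<and>
        (\<forall>T\<ge>0. (\<lambda>j. L2_process_norm2 M T
            (\<lambda>t \<omega>. H t \<omega> - simple_process (n j) (\<tau> j) (\<xi> j) t \<omega>)) \<longlonglongrightarrow> 0) \<and>
        (\<forall>t\<ge>0. (\<lambda>j. \<integral>\<^sup>+\<omega>. ennreal ((I t \<omega> - simple_integral B (n j) (\<tau> j) (\<xi> j) t \<omega>)\<^sup>2) \<partial>M)
            \<longlonglongrightarrow> 0))"


section \<open>The McKean-Vlasov equation\<close>

text \<open>\<open>X\<close> is a solution started at \<open>x\<close>, on Wiener space \<open>M\<close> with the canonical Brownian motion: a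
  continuous adapted process with square-integrable running suprema satisfying the integral
  equation almost surely. \<open>V0\<close> is the drift and \<open>V k\<close> the coefficient of the \<open>k\<close>-th component of
  the Brownian motion; \<open>I k\<close> is the stochastic integral against that component, taken
  componentwise in \<open>real^'n\<close>.\<close>

definition mckean_vlasov_solution ::
    "(real \<Rightarrow> real^'m) measure \<Rightarrow>
     (real^'n \<Rightarrow> (real^'n) measure \<Rightarrow> real^'n) \<Rightarrow>
     ('m \<Rightarrow> real^'n \<Rightarrow> (real^'n) measure \<Rightarrow> real^'n) \<Rightarrow>
     real^'n \<Rightarrow> (real \<Rightarrow> (real \<Rightarrow> real^'m) \<Rightarrow> real^'n) \<Rightarrow> bool" where
  "mckean_vlasov_solution M V0 V x X \<longleftrightarrow>
     (\<forall>t\<ge>0. X t \<in> borel_measurable (wiener_filtration M t)) \<and>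
     (\<forall>\<omega>\<in>space M. continuous_on {0..} (\<lambda>t. X t \<omega>)) \<and>
     (\<forall>T\<ge>0. (\<integral>\<^sup>+\<omega>. (SUP t\<in>{0..T}. ennreal ((norm (X t \<omega>))\<^sup>2)) \<partial>M) < \<infinity>) \<and>
     (\<exists>I :: 'm \<Rightarrow> real \<Rightarrow> (real \<Rightarrow> real^'m) \<Rightarrow> real^'n.
        (\<forall>k i. is_ito_integral M (wiener_filtration M) (\<lambda>t \<omega>. \<omega> t $ k)
           (\<lambda>t \<omega>. V k (X t \<omega>) (distr M borel (X t)) $ i) (\<lambda>t \<omega>. I k t \<omega> $ i)) \<and>
        (AE \<omega> in M. \<forall>t\<ge>0.
           X t \<omega> = x + (LINT r:{0..t}|lborel. V0 (X r \<omega>) (distr M borel (X r)))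
                     + (\<Sum>k\<in>UNIV. I k t \<omega>)))"


section \<open>Extended logarithm\<close>

definition log_ext :: "real \<Rightarrow> ereal" where
  "log_ext y = (if y = 0 then -\<infinity> else ereal (ln y))"

end

theory Submission
  imports Defs
begin

text \<open>For a path along which the matrices \<open>J\<^sub>t\<close> grow at most exponentially, the sublevel sets of
  \<open>v \<mapsto> limsup (1/t) log |J\<^sub>t v|\<close> are subspaces, which gives the filtration. The exponential bound
  does not use the equation for the Jacobian: with \<open>D\<^sub>t = \<Phi>\<^sub>t(y) - \<Phi>\<^sub>t(x)\<close>, the Lipschitz
  property of the coefficients and the Ito isometry show that \<open>E|D\<^sub>t|\<^sup>2\<close> grows at most by a fixed
  factor over time steps of a fixed small length \<open>h\<close>, and Kolmogorov's maximal inequality turns this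
  into a tail bound for the supremum over a step, of order \<open>|y - x|\<^sup>2\<close>. Applied to
  \<open>y = x + v/j\<close> this bounds the supremum of \<open>|J\<^sub>t v|\<close> over the step, and the Borel-Cantelli
  lemma concludes.\<close>

section \<open>Lyapunov exponents and filtrations\<close>

text \<open>The derivative in the law is defined on \<open>L\<close>, the solutions live on Wiener
  space \<open>M\<close>, and \<open>L\<close> is only known to carry single laws. Comparing the
  laws of two solutions needs a copy of the pair on \<open>L\<close>; it is obtained by rounding
  both variables to countably many values and coding the rounded pair as one natural number. The Ito
  integral is given only as an L^2 limit, so its isometry and martingale property are proved for
  simple integrals and carried to the limit. Second moments suffice because no supremum over
  starting points is taken: a large value of |J_t v| forces a large difference quotient for all
  large j, an event no likelier than the one for a single j, and the factors 1/j^2 in the moment and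
  in the squared threshold cancel. At step n the moment is of order (2p)^n; the threshold (2p)^n for
  the Jacobian, once squared, leaves summable probabilities of order (2p)^(-n). Hence the bound
  ln(2p)/h, where \<open>p\<close> depends on the dimensions and \<open>h\<close> also on the
  Lipschitz constant, but neither on the starting point.\<close>

lemma scaled_log_ext_less_iff:
  assumes "t > 0" "y \<ge> 0"
  shows "ereal (1 / t) * log_ext y < ereal c \<longleftrightarrow> y < exp (c * t)"
proof (cases "y = 0")
  case True
  with assms show ?thesis by (simp add: log_ext_def)
next
  case False
  with assms have y: "y > 0" by simp
  have "ereal (1 / t) * log_ext y < ereal c \<longleftrightarrow> ln y / t < c"
    using y by (simp add: log_ext_def)
  also have "\<dots> \<longleftrightarrow> ln y < c * t" using assms by (simp add: divide_less_eq)
  also have "\<dots> \<longleftrightarrow> y < exp (c * t)" using y by (metis exp_less_cancel_iff exp_ln)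
  finally show ?thesis .
qed

text \<open>Real numbers are dense above \<open>C\<close>, so real rates \<open>c\<close> suffice,
  and \<open>t > 0\<close> holds eventually. The right-hand side contains no logarithm, so the value
  -\<infinity> at 0 needs no separate treatment in estimates of sums and multiples.\<close>

lemma Limsup_scaled_log_le_iff:
  assumes "\<And>t. f t \<ge> 0"
  shows "Limsup at_top (\<lambda>t. ereal (1 / t) * log_ext (f t)) \<le> C \<longleftrightarrow>
    (\<forall>c. C < ereal c \<longrightarrow> (\<forall>\<^sub>F t in at_top. f t < exp (c * t)))"
proof -
  have ev: "(\<forall>\<^sub>F t in at_top. ereal (1 / t) * log_ext (f t) < ereal c) \<longleftrightarrow>
      (\<forall>\<^sub>F t in at_top. f t < exp (c * t))" for c
    by (rule eventually_cong[OF eventually_gt_at_top[of "0::real"]])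
       (use assms scaled_log_ext_less_iff in blast)
  have "Limsup at_top (\<lambda>t. ereal (1 / t) * log_ext (f t)) \<le> C \<longleftrightarrow>
    (\<forall>c. C < ereal c \<longrightarrow> (\<forall>\<^sub>F t in at_top. ereal (1 / t) * log_ext (f t) < ereal c))"
  proof
    assume "Limsup at_top (\<lambda>t. ereal (1 / t) * log_ext (f t)) \<le> C"
    then show "\<forall>c. C < ereal c \<longrightarrow> (\<forall>\<^sub>F t in at_top. ereal (1 / t) * log_ext (f t) < ereal c)"
      unfolding Limsup_le_iff by simp
  next
    assume *: "\<forall>c. C < ereal c \<longrightarrow> (\<forall>\<^sub>F t in at_top. ereal (1 / t) * log_ext (f t) < ereal c)"
    show "Limsup at_top (\<lambda>t. ereal (1 / t) * log_ext (f t)) \<le> C"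
      unfolding Limsup_le_iff
    proof (intro allI impI)
      fix y assume "C < y"
      from ereal_dense2[OF this] obtain c where c: "C < ereal c" "ereal c < y" by metis
      have "\<forall>\<^sub>F t in at_top. ereal (1 / t) * log_ext (f t) < ereal c"
        using *[rule_format, OF c(1)] .
      then show "\<forall>\<^sub>F t in at_top. ereal (1 / t) * log_ext (f t) < y"
        by eventually_elim (use c in auto)
    qed
  qed
  then show ?thesis unfolding ev .
qed

lemma eventually_const_mult_exp_less:
  fixes a c d :: real
  assumes "c < d"
  shows "\<forall>\<^sub>F t in at_top. a * exp (c * t) < exp (d * t)"
proof -
  have "\<forall>\<^sub>F t in at_top. exp ((d - c) * t) > a"
    using eventually_gt_at_top[of "ln (max 1 a) / (d - c)"]
  proof eventually_elim
    case (elim t)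
    \<comment> \<open>The maximum with 1 keeps the logarithm meaningful when \<open>a\<close> is not
      positive.\<close>
    then have "ln (max 1 a) < (d - c) * t" using assms by (simp add: pos_divide_less_eq mult.commute)
    then have "exp (ln (max 1 a)) < exp ((d - c) * t)" by (simp only: exp_less_cancel_iff)
    moreover have "exp (ln (max 1 a)) = max 1 a" by (rule exp_ln) simp
    ultimately show ?case by simp
  qed
  then show ?thesis
  proof eventually_elim
    case (elim t)
    have "exp (d * t) = exp ((d - c) * t) * exp (c * t)"
      by (simp add: algebra_simps flip: exp_add)
    then show ?case using elim by simp
  qed
qed

text \<open>A sum costs the factor 2 and a multiple the factor \<open>\<bar>k\<bar>\<close>; either
  constant is absorbed by the gap between two rates \<open>b < c\<close> above \<open>C\<close>.
  Since \<open>C\<close> is an extended real, the vectors of exponent -\<infinity> are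
  included.\<close>

lemma lyapunov_subspace:
  fixes A :: "real \<Rightarrow> real^'n^'n" and C :: ereal
  shows "subspace {v. Limsup at_top (\<lambda>t. ereal (1 / t) * log_ext (norm (A t *v v))) \<le> C}"
proof (rule subspaceI; unfold mem_Collect_eq)
  show "Limsup at_top (\<lambda>t. ereal (1 / t) * log_ext (norm (A t *v 0))) \<le> C"
    by (subst Limsup_scaled_log_le_iff) auto
next
  fix u v
  assume u: "Limsup at_top (\<lambda>t. ereal (1 / t) * log_ext (norm (A t *v u))) \<le> C"
    and v: "Limsup at_top (\<lambda>t. ereal (1 / t) * log_ext (norm (A t *v v))) \<le> C"
  show "Limsup at_top (\<lambda>t. ereal (1 / t) * log_ext (norm (A t *v (u + v)))) \<le> C"
  proof (subst Limsup_scaled_log_le_iff, simp, intro allI impI)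
    fix c assume "C < ereal c"
    from ereal_dense2[OF this] obtain b where b: "C < ereal b" "b < c" by auto
    have "\<forall>\<^sub>F t in at_top. norm (A t *v u) < exp (b * t)"
      and "\<forall>\<^sub>F t in at_top. norm (A t *v v) < exp (b * t)"
      using u v b by (auto simp: Limsup_scaled_log_le_iff)
    with eventually_const_mult_exp_less[OF b(2), of 2]
    show "\<forall>\<^sub>F t in at_top. norm (A t *v (u + v)) < exp (c * t)"
    proof eventually_elim
      case (elim t)
      have "norm (A t *v (u + v)) \<le> norm (A t *v u) + norm (A t *v v)"
        by (simp add: matrix_vector_right_distrib norm_triangle_ineq)
      then show ?case using elim by simp
    qed
  qed
next
  fix k v
  assume v: "Limsup at_top (\<lambda>t. ereal (1 / t) * log_ext (norm (A t *v v))) \<le> C"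
  show "Limsup at_top (\<lambda>t. ereal (1 / t) * log_ext (norm (A t *v (k *\<^sub>R v)))) \<le> C"
  proof (subst Limsup_scaled_log_le_iff, simp, intro allI impI)
    fix c assume "C < ereal c"
    from ereal_dense2[OF this] obtain b where b: "C < ereal b" "b < c" by auto
    have "\<forall>\<^sub>F t in at_top. norm (A t *v v) < exp (b * t)"
      using v b by (auto simp: Limsup_scaled_log_le_iff)
    with eventually_const_mult_exp_less[OF b(2), of "\<bar>k\<bar>"]
    show "\<forall>\<^sub>F t in at_top. norm (A t *v (k *\<^sub>R v)) < exp (c * t)"
    proof eventually_elim
      case (elim t)
      have "norm (A t *v (k *\<^sub>R v)) = \<bar>k\<bar> * norm (A t *v v)"
        by (simp add: matrix_vector_mult_scaleR)
      also have "\<dots> \<le> \<bar>k\<bar> * exp (b * t)" using elim by (intro mult_left_mono) auto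
      finally show ?case using elim by simp
    qed
  qed
qed

text \<open>Off the origin a value is determined by the dimension of its sublevel set, so that at most
  \<open>DIM('a)\<close> values occur.\<close>

lemma sublevel_filtration:
  fixes chi :: "'a::euclidean_space \<Rightarrow> 'b::linorder"
  assumes sub: "\<And>a. subspace {v. chi v \<le> a}"
  obtains r E lam where
    "1 \<le> r" "r \<le> DIM('a)" "\<And>i::nat. subspace (E i)" "E 0 = {0}" "\<And>i. i < r \<Longrightarrow> E i \<subset> E (Suc i)"
    "E r = UNIV" "\<And>i. 1 \<le> i \<Longrightarrow> i < r \<Longrightarrow> lam i < lam (Suc i)"
    "\<And>i v. 1 \<le> i \<Longrightarrow> i \<le> r \<Longrightarrow> v \<in> E i - E (i - 1) \<Longrightarrow> chi v = lam i"
proof -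
  define S where "S a = {v. chi v \<le> a}" for a
  define \<Lambda> where "\<Lambda> = chi ` (UNIV - {0})"
  have S0: "0 \<in> S a" for a using subspace_0[OF sub] by (simp add: S_def)
  have dim_mono: "dim (S a) < dim (S b)" if "a \<in> \<Lambda>" "b \<in> \<Lambda>" "a < b" for a b
  proof -
    from that(2) obtain w where w: "w \<noteq> 0" "b = chi w" by (auto simp: \<Lambda>_def)
    have "S a \<subseteq> S b" using that by (auto simp: S_def)
    moreover have "w \<in> S b" "w \<notin> S a" using w that(3) by (auto simp: S_def)
    ultimately have "S a \<noteq> S b" "S a \<subseteq> S b" by auto
    then show ?thesis
      using subspace_dim_equal[of "S a" "S b"] sub unfolding S_def by (metis not_le)
  qed
  have dim_pos: "1 \<le> dim (S a)" if "a \<in> \<Lambda>" for a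
  proof -
    from that obtain w where w: "w \<noteq> 0" "a = chi w" by (auto simp: \<Lambda>_def)
    then have "\<not> S a \<subseteq> {0}" by (auto simp: S_def)
    then have "dim (S a) \<noteq> 0" by (simp only: dim_eq_0 not_False_eq_True)
    then show ?thesis by linarith
  qed
  have inj: "inj_on (\<lambda>a. dim (S a)) \<Lambda>"
  proof (rule inj_onI)
    fix a b assume ab: "a \<in> \<Lambda>" "b \<in> \<Lambda>" and eq: "dim (S a) = dim (S b)"
    have "\<not> a < b" "\<not> b < a" using dim_mono[OF ab] dim_mono[OF ab(2) ab(1)] unfolding eq by blast+
    then show "a = b" by simp
  qed
  have im: "(\<lambda>a. dim (S a)) ` \<Lambda> \<subseteq> {1..DIM('a)}"
    using dim_pos dim_subset_UNIV by (auto simp del: One_nat_def)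
  have fin: "finite \<Lambda>" using finite_imageD[OF finite_subset[OF im] inj] by simp
  have card: "card \<Lambda> \<le> DIM('a)"
    using card_inj_on_le[OF inj im] by simp
  define xs where "xs = sorted_list_of_set \<Lambda>"
  have xs: "set xs = \<Lambda>" "length xs = card \<Lambda>" "sorted_wrt (<) xs"
    using fin by (auto simp: xs_def)
  define r where "r = card \<Lambda>"
  \<comment> \<open>The values are numbered from 1 while list positions start at 0; index 0 is
    reserved for the trivial subspace.\<close>
  define lam where "lam i = xs ! (i - 1)" for i
  define E where "E i = (if i = 0 then {0} else S (lam i))" for i
  have lam_in: "lam i \<in> \<Lambda>" if "1 \<le> i" "i \<le> r" for i
    using that xs(2) nth_mem[of "i - 1" xs] unfolding xs(1) by (simp add: lam_def r_def)
  have lam_less: "lam i < lam j" if "1 \<le> i" "i < j" "j \<le> r" for i j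
    using that xs(2) sorted_wrt_nth_less[OF xs(3), of "i - 1" "j - 1"] by (simp add: lam_def r_def)
  have lam_ex: "\<exists>i. 1 \<le> i \<and> i \<le> r \<and> a = lam i" if "a \<in> \<Lambda>" for a
  proof -
    from that xs(1) obtain j where "j < length xs" "xs ! j = a" by (metis in_set_conv_nth)
    then show ?thesis using xs(2) by (intro exI[of _ "Suc j"]) (auto simp: lam_def r_def)
  qed
  \<comment> \<open>Some nonzero vector exists, so there is at least one value and the filtration
    has at least one step.\<close>
  obtain b :: 'a where "b \<in> Basis" using nonempty_Basis by blast
  then have "b \<noteq> 0" by auto
  then have "chi b \<in> \<Lambda>" by (auto simp: \<Lambda>_def)
  then have r1: "1 \<le> r" using fin by (auto simp: r_def Suc_le_eq card_gt_0_iff)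
  show ?thesis
  proof (rule that[of r E lam])
    show "1 \<le> r" "r \<le> DIM('a)" using r1 card by (auto simp: r_def)
    show "subspace (E i)" for i using sub by (simp add: E_def S_def subspace_single_0)
    show "E 0 = {0}" by (simp add: E_def)
    show "E i \<subset> E (Suc i)" if "i < r" for i
    proof -
      have "lam (Suc i) \<in> \<Lambda>" using lam_in[of "Suc i"] that by simp
      then obtain w where w: "w \<noteq> 0" "lam (Suc i) = chi w" by (auto simp: \<Lambda>_def)
      then have "w \<in> E (Suc i)" by (simp add: E_def S_def)
      moreover have "w \<notin> E i"
        using w lam_less[of i "Suc i"] that by (auto simp: E_def S_def)
      moreover have "E i \<subseteq> E (Suc i)"
      proof (cases "i = 0")
        case False
        then have "lam i \<le> lam (Suc i)" using lam_less[of i "Suc i"] that by simp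
        then show ?thesis using False by (auto simp: E_def S_def)
      qed (use S0 in \<open>auto simp: E_def\<close>)
      ultimately show ?thesis by blast
    qed
    show "E r = UNIV"
    proof -
      have "v \<in> S (lam r)" for v
      proof (cases "v = 0")
        case False
        then obtain i where "1 \<le> i" "i \<le> r" "chi v = lam i"
          using lam_ex[of "chi v"] by (auto simp: \<Lambda>_def)
        then show ?thesis using lam_less[of i r] by (cases "i = r") (auto simp: S_def)
      qed (use S0 in simp)
      then show ?thesis using r1 by (auto simp: E_def)
    qed
    show "lam i < lam (Suc i)" if "1 \<le> i" "i < r" for i using lam_less that by auto
    show "chi v = lam i" if i: "1 \<le> i" "i \<le> r" "v \<in> E i - E (i - 1)" for i v
    proof -
      have v: "v \<in> S (lam i)" using i by (auto simp: E_def)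
      have "v \<noteq> 0" using i S0 by (auto simp: E_def split: if_splits)
      then obtain j where j: "1 \<le> j" "j \<le> r" "chi v = lam j"
        using lam_ex[of "chi v"] by (auto simp: \<Lambda>_def)
      \<comment> \<open>The value of the nonzero vector \<open>v\<close> is some
        \<open>lam j\<close>. If j were larger than i, \<open>v\<close> would not lie in
        \<open>E i\<close>; if smaller, it would already lie in \<open>E (i - 1)\<close>.\<close>
      have "\<not> i < j" using lam_less[of i j] i j v by (auto simp: S_def)
      moreover have "\<not> j < i"
      proof
        assume ji: "j < i"
        have "lam j \<le> lam (i - 1)"
        proof (cases "j = i - 1")
          case False
          then have "j < i - 1" "i - 1 \<le> r" using ji i by linarith+
          then show ?thesis using lam_less[of j "i - 1"] j by simp
        qed simp
        then have "v \<in> E (i - 1)" using j ji by (auto simp: E_def S_def)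
        then show False using i by simp
      qed
      ultimately show ?thesis using j by simp
    qed
  qed
qed

section \<open>The Ito integral\<close>

text \<open>Truncating the length at 0 covers empty intervals, so that the overlap of two time
  intervals can be integrated without a case distinction.\<close>

lemma has_bochner_integral_indicator_Ioc:
  fixes p q :: real
  shows "has_bochner_integral lborel (\<lambda>r. indicator {p<..q} r :: real) (max 0 (q - p))"
proof (cases "p \<le> q")
  case True
  then show ?thesis
    using has_bochner_integral_real_indicator[of "{p<..q}" lborel] by simp
qed (simp add: has_bochner_integral_zero)

text \<open>Separates the stochastic calculus from Wiener space: a scalar process whose increments
  after time s are centred, of variance t - s, and independent of every real variable measurable at
  s. Each component of the canonical process will be an instance.\<close>

locale brownian_filtration = prob_space M
  for M :: "'w measure" and F :: "real \<Rightarrow> 'w measure" and B :: "real \<Rightarrow> 'w \<Rightarrow> real" +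
  assumes space_F: "\<And>t. 0 \<le> t \<Longrightarrow> space (F t) = space M"
    and sets_F: "\<And>t. 0 \<le> t \<Longrightarrow> sets (F t) \<subseteq> sets M"
    and F_mono: "\<And>s t. 0 \<le> s \<Longrightarrow> s \<le> t \<Longrightarrow> sets (F s) \<subseteq> sets (F t)"
    and B_meas: "\<And>t. 0 \<le> t \<Longrightarrow> B t \<in> borel_measurable (F t)"
    and incr_indep: "\<And>s t X. 0 \<le> s \<Longrightarrow> s < t \<Longrightarrow> X \<in> borel_measurable (F s) \<Longrightarrow>
      indep_var borel X borel (\<lambda>\<omega>. B t \<omega> - B s \<omega>)"
    and incr_integrable: "\<And>s t. 0 \<le> s \<Longrightarrow> s < t \<Longrightarrow> integrable M (\<lambda>\<omega>. (B t \<omega> - B s \<omega>)\<^sup>2)"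
    and incr_mean: "\<And>s t. 0 \<le> s \<Longrightarrow> s < t \<Longrightarrow> (\<integral>\<omega>. B t \<omega> - B s \<omega> \<partial>M) = 0"
    and incr_variance: "\<And>s t. 0 \<le> s \<Longrightarrow> s < t \<Longrightarrow> (\<integral>\<omega>. (B t \<omega> - B s \<omega>)\<^sup>2 \<partial>M) = t - s"
begin

section \<open>Square-integrable variables and Brownian increments\<close>

lemma measurable_F_M: "0 \<le> s \<Longrightarrow> f \<in> measurable (F s) N \<Longrightarrow> f \<in> measurable M N"
  using space_F[of s] sets_F[of s] by (auto simp: measurable_def)

lemma measurable_F_mono: "0 \<le> s \<Longrightarrow> s \<le> t \<Longrightarrow> f \<in> measurable (F s) N \<Longrightarrow> f \<in> measurable (F t) N"
  using space_F[of s] space_F[of t] F_mono[of s t] by (auto simp: measurable_def)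

lemma integrable_of_square:
  fixes X :: "'w \<Rightarrow> real"
  assumes "X \<in> borel_measurable M" "integrable M (\<lambda>\<omega>. (X \<omega>)\<^sup>2)"
  shows "integrable M X"
  by (rule square_integrable_imp_integrable[OF assms])

lemma integrable_mult_of_squares:
  fixes X Y :: "'w \<Rightarrow> real"
  assumes [measurable]: "X \<in> borel_measurable M" "Y \<in> borel_measurable M"
    and "integrable M (\<lambda>\<omega>. (X \<omega>)\<^sup>2)" "integrable M (\<lambda>\<omega>. (Y \<omega>)\<^sup>2)"
  shows "integrable M (\<lambda>\<omega>. X \<omega> * Y \<omega>)"
proof (rule Bochner_Integration.integrable_bound[where f = "\<lambda>\<omega>. (X \<omega>)\<^sup>2 + (Y \<omega>)\<^sup>2"])
  show "AE \<omega> in M. norm (X \<omega> * Y \<omega>) \<le> norm ((X \<omega>)\<^sup>2 + (Y \<omega>)\<^sup>2)"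
  proof (rule AE_I2)
    fix \<omega>
    have "2 * \<bar>X \<omega>\<bar> * \<bar>Y \<omega>\<bar> \<le> \<bar>X \<omega>\<bar>\<^sup>2 + \<bar>Y \<omega>\<bar>\<^sup>2" by (rule sum_squares_bound)
    then have "\<bar>X \<omega>\<bar> * \<bar>Y \<omega>\<bar> \<le> (X \<omega>)\<^sup>2 + (Y \<omega>)\<^sup>2"
      using mult_nonneg_nonneg[of "\<bar>X \<omega>\<bar>" "\<bar>Y \<omega>\<bar>"] unfolding power2_abs by linarith
    then show "norm (X \<omega> * Y \<omega>) \<le> norm ((X \<omega>)\<^sup>2 + (Y \<omega>)\<^sup>2)" by (simp add: abs_mult)
  qed
qed (use assms in auto)

lemma integrable_square_sum:
  fixes X :: "'i \<Rightarrow> 'w \<Rightarrow> real"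
  assumes "\<And>i. i \<in> I \<Longrightarrow> X i \<in> borel_measurable M" "\<And>i. i \<in> I \<Longrightarrow> integrable M (\<lambda>\<omega>. (X i \<omega>)\<^sup>2)"
  shows "integrable M (\<lambda>\<omega>. (\<Sum>i\<in>I. X i \<omega>)\<^sup>2)"
  unfolding power2_eq_square sum_product
  by (intro Bochner_Integration.integrable_sum integrable_mult_of_squares assms)

lemma integrable_square_add:
  fixes X Y :: "'w \<Rightarrow> real"
  assumes "X \<in> borel_measurable M" "Y \<in> borel_measurable M"
    and "integrable M (\<lambda>\<omega>. (X \<omega>)\<^sup>2)" "integrable M (\<lambda>\<omega>. (Y \<omega>)\<^sup>2)"
  shows "integrable M (\<lambda>\<omega>. (X \<omega> + Y \<omega>)\<^sup>2)"
  using integrable_mult_of_squares[OF assms] assms(3,4)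
  by (simp add: power2_sum mult.assoc)

lemma integrable_square_diff:
  fixes X Y :: "'w \<Rightarrow> real"
  assumes "X \<in> borel_measurable M" "Y \<in> borel_measurable M"
    and "integrable M (\<lambda>\<omega>. (X \<omega>)\<^sup>2)" "integrable M (\<lambda>\<omega>. (Y \<omega>)\<^sup>2)"
  shows "integrable M (\<lambda>\<omega>. (X \<omega> - Y \<omega>)\<^sup>2)"
  using integrable_mult_of_squares[OF assms] assms(3,4)
  by (simp add: power2_diff mult.assoc)

lemma incr_measurable: "0 \<le> s \<Longrightarrow> s \<le> t \<Longrightarrow> (\<lambda>\<omega>. B t \<omega> - B s \<omega>) \<in> borel_measurable (F t)"
  using B_meas[of t] measurable_F_mono[OF _ _ B_meas[of s], of t] by auto

lemma incr_square_integrable: "0 \<le> s \<Longrightarrow> s \<le> t \<Longrightarrow> integrable M (\<lambda>\<omega>. (B t \<omega> - B s \<omega>)\<^sup>2)"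
  using incr_integrable[of s t] by (cases "s = t") auto

lemma incr_integrable1: "0 \<le> s \<Longrightarrow> s \<le> t \<Longrightarrow> integrable M (\<lambda>\<omega>. B t \<omega> - B s \<omega>)"
  by (rule integrable_of_square[OF measurable_F_M[OF _ incr_measurable]])
     (auto intro: incr_square_integrable)

text \<open>Independence factorises the expectation and the increment has mean zero. The trivial
  case \<open>s = t\<close> is treated apart because the locale speaks of
  \<open>s < t\<close>.\<close>

lemma mult_incr:
  assumes X: "X \<in> borel_measurable (F s)" "integrable M X" and st: "0 \<le> s" "s \<le> t"
  shows "integrable M (\<lambda>\<omega>. X \<omega> * (B t \<omega> - B s \<omega>))"
    and "(\<integral>\<omega>. X \<omega> * (B t \<omega> - B s \<omega>) \<partial>M) = 0"
proof -
  have "integrable M (\<lambda>\<omega>. X \<omega> * (B t \<omega> - B s \<omega>)) \<and> (\<integral>\<omega>. X \<omega> * (B t \<omega> - B s \<omega>) \<partial>M) = 0"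
  proof (cases "s = t")
    case False
    then have st: "0 \<le> s" "s < t" using st by auto
    note ind = incr_indep[OF st X(1)]
    show ?thesis
      using indep_var_integrable[OF ind X(2) incr_integrable1]
        indep_var_lebesgue_integral[OF ind X(2) incr_integrable1] st incr_mean[OF st] by simp
  qed simp
  then show "integrable M (\<lambda>\<omega>. X \<omega> * (B t \<omega> - B s \<omega>))"
    and "(\<integral>\<omega>. X \<omega> * (B t \<omega> - B s \<omega>) \<partial>M) = 0" by auto
qed

lemma mult_incr_square:
  assumes X: "X \<in> borel_measurable (F s)" "integrable M X" and st: "0 \<le> s" "s \<le> t"
  shows "integrable M (\<lambda>\<omega>. X \<omega> * (B t \<omega> - B s \<omega>)\<^sup>2)"
    and "(\<integral>\<omega>. X \<omega> * (B t \<omega> - B s \<omega>)\<^sup>2 \<partial>M) = (\<integral>\<omega>. X \<omega> \<partial>M) * (t - s)"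
proof -
  have "integrable M (\<lambda>\<omega>. X \<omega> * (B t \<omega> - B s \<omega>)\<^sup>2) \<and>
      (\<integral>\<omega>. X \<omega> * (B t \<omega> - B s \<omega>)\<^sup>2 \<partial>M) = (\<integral>\<omega>. X \<omega> \<partial>M) * (t - s)"
  proof (cases "s = t")
    case False
    then have st: "0 \<le> s" "s < t" using st by auto
    have ind: "indep_var borel X borel (\<lambda>\<omega>. (B t \<omega> - B s \<omega>)\<^sup>2)"
      using indep_var_compose[OF incr_indep[OF st X(1)], of id borel "\<lambda>x. x\<^sup>2" borel]
      by (simp add: comp_def)
    show ?thesis
      using indep_var_integrable[OF ind X(2) incr_integrable]
        indep_var_lebesgue_integral[OF ind X(2) incr_integrable] st incr_variance[OF st] by simp
  qed simp
  then show "integrable M (\<lambda>\<omega>. X \<omega> * (B t \<omega> - B s \<omega>)\<^sup>2)"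
    and "(\<integral>\<omega>. X \<omega> * (B t \<omega> - B s \<omega>)\<^sup>2 \<partial>M) = (\<integral>\<omega>. X \<omega> \<partial>M) * (t - s)" by auto
qed

lemma mult_incr_square_integrable:
  assumes X: "X \<in> borel_measurable (F s)" "integrable M (\<lambda>\<omega>. (X \<omega>)\<^sup>2)" and st: "0 \<le> s" "s \<le> t"
  shows "integrable M (\<lambda>\<omega>. (X \<omega> * (B t \<omega> - B s \<omega>))\<^sup>2)"
  using mult_incr_square(1)[of "\<lambda>\<omega>. (X \<omega>)\<^sup>2" s t] assms by (simp add: power_mult_distrib)

section \<open>The isometry for elementary sums\<close>

lemma bounded_integrable:
  fixes X :: "'w \<Rightarrow> real"
  assumes "X \<in> borel_measurable M" "\<And>\<omega>. \<bar>X \<omega>\<bar> \<le> C"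
  shows "integrable M X"
  by (rule integrable_const_bound[where B = C]) (use assms in auto)

lemma bounded_mult_integrable:
  fixes X Y :: "'w \<Rightarrow> real"
  assumes [measurable]: "X \<in> borel_measurable M" and C: "\<And>\<omega>. \<bar>X \<omega>\<bar> \<le> C" and Y: "integrable M Y"
  shows "integrable M (\<lambda>\<omega>. X \<omega> * Y \<omega>)"
proof (rule Bochner_Integration.integrable_bound[where f = "\<lambda>\<omega>. C * Y \<omega>"])
  have [measurable]: "Y \<in> borel_measurable M" using Y by simp
  show "(\<lambda>\<omega>. X \<omega> * Y \<omega>) \<in> borel_measurable M" by simp
  show "AE \<omega> in M. norm (X \<omega> * Y \<omega>) \<le> norm (C * Y \<omega>)"
  proof (rule AE_I2)
    fix \<omega>
    have "\<bar>X \<omega>\<bar> * \<bar>Y \<omega>\<bar> \<le> \<bar>C\<bar> * \<bar>Y \<omega>\<bar>" using C[of \<omega>] by (intro mult_right_mono) auto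
    then show "norm (X \<omega> * Y \<omega>) \<le> norm (C * Y \<omega>)" by (simp add: abs_mult)
  qed
qed (use Y in simp)

text \<open>The first increment is cut at \<open>c'\<close>. Its part before \<open>c'\<close>
  belongs to the past of the second increment and contributes nothing; after \<open>c'\<close> only
  the square of the common increment survives, with expectation equal to the length of the
  overlap.\<close>

lemma elementary_covariance_aux:
  assumes X: "X \<in> borel_measurable (F c)" "\<And>\<omega>. \<bar>X \<omega>\<bar> \<le> C" and Y: "Y \<in> borel_measurable (F c')" "\<And>\<omega>. \<bar>Y \<omega>\<bar> \<le> C'"
    and c: "0 \<le> c" "c \<le> e" "c' \<le> e'" "c \<le> c'"
  shows "(\<integral>\<omega>. (X \<omega> * (B e \<omega> - B c \<omega>)) * (Y \<omega> * (B e' \<omega> - B c' \<omega>)) \<partial>M) =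
    (\<integral>\<omega>. X \<omega> * Y \<omega> \<partial>M) * max 0 (min e e' - max c c')"
proof -
  have Xc': "X \<in> borel_measurable (F c')" using measurable_F_mono[OF c(1,4) X(1)] .
  have "0 \<le> c'" using c by simp
  have XY: "(\<lambda>\<omega>. X \<omega> * Y \<omega>) \<in> borel_measurable (F c')" using Xc' Y(1) by simp
  have XYM: "(\<lambda>\<omega>. X \<omega> * Y \<omega>) \<in> borel_measurable M" using measurable_F_M[OF \<open>0 \<le> c'\<close> XY] .
  have XYb: "\<bar>X \<omega> * Y \<omega>\<bar> \<le> C * C'" for \<omega>
    unfolding abs_mult using X(2)[of \<omega>] Y(2)[of \<omega>] by (intro mult_mono) auto
  have XYi: "integrable M (\<lambda>\<omega>. X \<omega> * Y \<omega>)" by (rule bounded_integrable[OF XYM XYb])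
  \<comment> \<open>Everything in front of the increment after \<open>c'\<close> is measurable at
    \<open>c'\<close>, so \<open>mult_incr\<close> applies.\<close>
  have past: "integrable M (\<lambda>\<omega>. (X \<omega> * Y \<omega> * (B p \<omega> - B c \<omega>)) * (B q \<omega> - B c' \<omega>))"
      "(\<integral>\<omega>. (X \<omega> * Y \<omega> * (B p \<omega> - B c \<omega>)) * (B q \<omega> - B c' \<omega>) \<partial>M) = 0"
    if "c \<le> p" "p \<le> c'" "c' \<le> q" for p q
  proof -
    have "(\<lambda>\<omega>. B p \<omega> - B c \<omega>) \<in> borel_measurable (F c')"
      using incr_measurable[of c p] measurable_F_mono[of p c'] that c by auto
    then have m: "(\<lambda>\<omega>. X \<omega> * Y \<omega> * (B p \<omega> - B c \<omega>)) \<in> borel_measurable (F c')" using XY by simp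
    have i: "integrable M (\<lambda>\<omega>. X \<omega> * Y \<omega> * (B p \<omega> - B c \<omega>))"
      by (rule bounded_mult_integrable[OF XYM XYb]) (use that c in \<open>auto intro: incr_integrable1\<close>)
    show "integrable M (\<lambda>\<omega>. (X \<omega> * Y \<omega> * (B p \<omega> - B c \<omega>)) * (B q \<omega> - B c' \<omega>))"
      "(\<integral>\<omega>. (X \<omega> * Y \<omega> * (B p \<omega> - B c \<omega>)) * (B q \<omega> - B c' \<omega>) \<partial>M) = 0"
      using mult_incr[OF m i \<open>0 \<le> c'\<close> that(3)] by auto
  qed
  show ?thesis
  proof (cases "e \<le> c'")
    case True
    have "(\<integral>\<omega>. (X \<omega> * (B e \<omega> - B c \<omega>)) * (Y \<omega> * (B e' \<omega> - B c' \<omega>)) \<partial>M) = 0"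
      using past(2)[OF c(2) True c(3)] by (simp add: ac_simps)
    moreover have "max 0 (min e e' - max c c') = 0" using True c by auto
    ultimately show ?thesis by simp
  next
    case False
    define p where "p = min e e'"
    define q where "q = max e e'"
    have pq: "c' \<le> p" "p \<le> q" using False c by (auto simp: p_def q_def)
    \<comment> \<open>The longer increment is split at the earlier end point \<open>p\<close>: a
      square up to \<open>p\<close>, plus a cross term with the later increment from
      \<open>p\<close> to \<open>q\<close>, which has mean zero.\<close>
    have prod: "(B e \<omega> - B c' \<omega>) * (B e' \<omega> - B c' \<omega>) =
        (B p \<omega> - B c' \<omega>)\<^sup>2 + (B p \<omega> - B c' \<omega>) * (B q \<omega> - B p \<omega>)" for \<omega>
      by (cases "e \<le> e'") (auto simp: p_def q_def min_def max_def power2_eq_square algebra_simps)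
    have eq: "(X \<omega> * (B e \<omega> - B c \<omega>)) * (Y \<omega> * (B e' \<omega> - B c' \<omega>)) =
       (X \<omega> * Y \<omega> * (B c' \<omega> - B c \<omega>)) * (B e' \<omega> - B c' \<omega>) +
       (X \<omega> * Y \<omega> * (B p \<omega> - B c' \<omega>)\<^sup>2 + (X \<omega> * Y \<omega> * (B p \<omega> - B c' \<omega>)) * (B q \<omega> - B p \<omega>))" for \<omega>
    proof -
      have "(X \<omega> * (B e \<omega> - B c \<omega>)) * (Y \<omega> * (B e' \<omega> - B c' \<omega>)) =
        (X \<omega> * Y \<omega> * (B c' \<omega> - B c \<omega>)) * (B e' \<omega> - B c' \<omega>) +
        X \<omega> * Y \<omega> * ((B e \<omega> - B c' \<omega>) * (B e' \<omega> - B c' \<omega>))" by (simp add: algebra_simps)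
      then show ?thesis unfolding prod by (simp add: algebra_simps)
    qed
    have "0 \<le> p" using pq \<open>0 \<le> c'\<close> by simp
    have m: "(\<lambda>\<omega>. X \<omega> * Y \<omega> * (B p \<omega> - B c' \<omega>)) \<in> borel_measurable (F p)"
      using incr_measurable[OF \<open>0 \<le> c'\<close> pq(1)] measurable_F_mono[OF \<open>0 \<le> c'\<close> pq(1) XY] by simp
    have i: "integrable M (\<lambda>\<omega>. X \<omega> * Y \<omega> * (B p \<omega> - B c' \<omega>))"
      by (rule bounded_mult_integrable[OF XYM XYb incr_integrable1[OF \<open>0 \<le> c'\<close> pq(1)]])
    note last = mult_incr[OF m i \<open>0 \<le> p\<close> pq(2)]
    note sq = mult_incr_square[OF XY XYi \<open>0 \<le> c'\<close> pq(1)]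
    have "(\<integral>\<omega>. (X \<omega> * (B e \<omega> - B c \<omega>)) * (Y \<omega> * (B e' \<omega> - B c' \<omega>)) \<partial>M) =
      (\<integral>\<omega>. X \<omega> * Y \<omega> \<partial>M) * (p - c')"
      unfolding eq using past[OF c(4) order_refl c(3)] last sq by simp
    moreover have "max 0 (min e e' - max c c') = p - c'" using False c by (auto simp: p_def)
    ultimately show ?thesis by simp
  qed
qed

lemma elementary_covariance:
  assumes X: "X \<in> borel_measurable (F c)" "\<And>\<omega>. \<bar>X \<omega>\<bar> \<le> C" and Y: "Y \<in> borel_measurable (F c')" "\<And>\<omega>. \<bar>Y \<omega>\<bar> \<le> C'"
    and c: "0 \<le> c" "c \<le> e" "0 \<le> c'" "c' \<le> e'"
  shows "(\<integral>\<omega>. (X \<omega> * (B e \<omega> - B c \<omega>)) * (Y \<omega> * (B e' \<omega> - B c' \<omega>)) \<partial>M) =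
    (\<integral>\<omega>. X \<omega> * Y \<omega> \<partial>M) * max 0 (min e e' - max c c')"
proof (cases "c \<le> c'")
  case True
  show ?thesis by (rule elementary_covariance_aux[OF X Y c(1,2,4) True])
next
  case False
  then show ?thesis
    using elementary_covariance_aux[OF Y X c(3,4,2)] by (simp add: ac_simps min.commute max.commute)
qed

text \<open>Expanding the squares, both sides become the double sum of E[X_i X_j] times the overlap
  of the intervals i and j. The intervals may overlap arbitrarily, so that differences of simple
  processes on different grids need no common refinement.\<close>

lemma elementary_isometry:
  fixes X :: "'i \<Rightarrow> 'w \<Rightarrow> real"
  assumes fin: "finite I"
    and X: "\<And>i. i \<in> I \<Longrightarrow> X i \<in> borel_measurable (F (c i))" "\<And>i \<omega>. i \<in> I \<Longrightarrow> \<bar>X i \<omega>\<bar> \<le> C i"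
    and c: "\<And>i. i \<in> I \<Longrightarrow> 0 \<le> c i" "\<And>i. i \<in> I \<Longrightarrow> c i \<le> e i"
  shows "integrable M (\<lambda>\<omega>. (\<Sum>i\<in>I. X i \<omega> * (B (e i) \<omega> - B (c i) \<omega>))\<^sup>2)"
    and "(\<integral>\<^sup>+\<omega>. ennreal ((\<Sum>i\<in>I. X i \<omega> * (B (e i) \<omega> - B (c i) \<omega>))\<^sup>2) \<partial>M) =
      (\<integral>\<^sup>+\<omega>. (\<integral>\<^sup>+r. ennreal ((\<Sum>i\<in>I. X i \<omega> * indicator {c i<..e i} r)\<^sup>2) \<partial>lborel) \<partial>M)"
proof -
  have XM: "X i \<in> borel_measurable M" if "i \<in> I" for i
    using measurable_F_M[OF c(1) X(1)] that by auto
  have Xi: "integrable M (\<lambda>\<omega>. (X i \<omega>)\<^sup>2)" if "i \<in> I" for i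
  proof (rule bounded_integrable)
    show "(\<lambda>\<omega>. (X i \<omega>)\<^sup>2) \<in> borel_measurable M" using XM[OF that] by simp
    show "\<bar>(X i \<omega>)\<^sup>2\<bar> \<le> (C i)\<^sup>2" for \<omega>
      using power_mono[OF X(2)[OF that] abs_ge_zero, of \<omega> 2] by simp
  qed
  define ov where "ov i j = max 0 (min (e i) (e j) - max (c i) (c j))" for i j
  have meas: "(\<lambda>\<omega>. X i \<omega> * (B (e i) \<omega> - B (c i) \<omega>)) \<in> borel_measurable M" if "i \<in> I" for i
    using XM[OF that] measurable_F_M[OF _ incr_measurable[of "c i" "e i"]] c[OF that] by auto
  have sqi: "integrable M (\<lambda>\<omega>. (X i \<omega> * (B (e i) \<omega> - B (c i) \<omega>))\<^sup>2)" if "i \<in> I" for i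
    by (rule mult_incr_square_integrable[OF X(1) Xi]) (use that c in auto)
  show int: "integrable M (\<lambda>\<omega>. (\<Sum>i\<in>I. X i \<omega> * (B (e i) \<omega> - B (c i) \<omega>))\<^sup>2)"
    by (rule integrable_square_sum[OF meas sqi])
  have pi: "integrable M (\<lambda>\<omega>. X i \<omega> * X j \<omega>)" if "i \<in> I" "j \<in> I" for i j
    using integrable_mult_of_squares[OF XM XM Xi Xi] that by simp
  have "(\<integral>\<omega>. (\<Sum>i\<in>I. X i \<omega> * (B (e i) \<omega> - B (c i) \<omega>))\<^sup>2 \<partial>M) =
    (\<Sum>i\<in>I. \<Sum>j\<in>I. (\<integral>\<omega>. (X i \<omega> * (B (e i) \<omega> - B (c i) \<omega>)) * (X j \<omega> * (B (e j) \<omega> - B (c j) \<omega>)) \<partial>M))"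
    unfolding power2_eq_square sum_product
    by (subst Bochner_Integration.integral_sum,
        (intro Bochner_Integration.integrable_sum integrable_mult_of_squares meas sqi, assumption+),
        intro sum.cong refl Bochner_Integration.integral_sum integrable_mult_of_squares meas sqi)
  also have "\<dots> = (\<Sum>i\<in>I. \<Sum>j\<in>I. (\<integral>\<omega>. X i \<omega> * X j \<omega> \<partial>M) * ov i j)"
    unfolding ov_def
    by (intro sum.cong refl, rule elementary_covariance) (rule X c | assumption)+
  also have "\<dots> = (\<integral>\<omega>. (\<Sum>i\<in>I. \<Sum>j\<in>I. X i \<omega> * X j \<omega> * ov i j) \<partial>M)"
  proof -
    have p: "integrable M (\<lambda>\<omega>. X i \<omega> * X j \<omega> * ov i j)" if "i \<in> I" "j \<in> I" for i j
      using pi[OF that] by (rule integrable_mult_left)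
    have "(\<Sum>i\<in>I. \<Sum>j\<in>I. (\<integral>\<omega>. X i \<omega> * X j \<omega> \<partial>M) * ov i j) =
        (\<Sum>i\<in>I. \<Sum>j\<in>I. (\<integral>\<omega>. X i \<omega> * X j \<omega> * ov i j \<partial>M))"
      by simp
    also have "\<dots> = (\<Sum>i\<in>I. (\<integral>\<omega>. (\<Sum>j\<in>I. X i \<omega> * X j \<omega> * ov i j) \<partial>M))"
      by (intro sum.cong refl Bochner_Integration.integral_sum[symmetric] p)
    also have "\<dots> = (\<integral>\<omega>. (\<Sum>i\<in>I. \<Sum>j\<in>I. X i \<omega> * X j \<omega> * ov i j) \<partial>M)"
      by (intro Bochner_Integration.integral_sum[symmetric] Bochner_Integration.integrable_sum p)
    finally show ?thesis .
  qed
  finally have E: "(\<integral>\<omega>. (\<Sum>i\<in>I. X i \<omega> * (B (e i) \<omega> - B (c i) \<omega>))\<^sup>2 \<partial>M) =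
    (\<integral>\<omega>. (\<Sum>i\<in>I. \<Sum>j\<in>I. X i \<omega> * X j \<omega> * ov i j) \<partial>M)" .
  have int2: "integrable M (\<lambda>\<omega>. (\<Sum>i\<in>I. \<Sum>j\<in>I. X i \<omega> * X j \<omega> * ov i j))"
    using pi by (intro Bochner_Integration.integrable_sum integrable_mult_left) auto
  have inner: "(\<integral>\<^sup>+r. ennreal ((\<Sum>i\<in>I. X i \<omega> * indicator {c i<..e i} r)\<^sup>2) \<partial>lborel) =
      ennreal (\<Sum>i\<in>I. \<Sum>j\<in>I. X i \<omega> * X j \<omega> * ov i j)" (is ?A)
    and inner_nonneg: "0 \<le> (\<Sum>i\<in>I. \<Sum>j\<in>I. X i \<omega> * X j \<omega> * ov i j)" (is ?B) for \<omega>
  proof -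
    have sq: "(\<Sum>i\<in>I. X i \<omega> * indicator {c i<..e i} r)\<^sup>2 =
      (\<Sum>i\<in>I. \<Sum>j\<in>I. X i \<omega> * X j \<omega> * indicator {max (c i) (c j)<..min (e i) (e j)} r)" for r :: real
      unfolding power2_eq_square sum_product
      by (intro sum.cong refl) (auto simp: indicator_def)
    have hi: "has_bochner_integral lborel (\<lambda>r. indicator {max (c i) (c j)<..min (e i) (e j)} r :: real) (ov i j)" for i j
      unfolding ov_def by (rule has_bochner_integral_indicator_Ioc)
    have h: "has_bochner_integral lborel (\<lambda>r. (\<Sum>i\<in>I. X i \<omega> * indicator {c i<..e i} r)\<^sup>2)
      (\<Sum>i\<in>I. \<Sum>j\<in>I. X i \<omega> * X j \<omega> * ov i j)"
      unfolding sq by (intro has_bochner_integral_sum has_bochner_integral_mult_right hi)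
    show ?A
      using h by (subst nn_integral_eq_integral) (auto simp: has_bochner_integral_iff)
    show ?B
      using h Bochner_Integration.integral_nonneg[of lborel "\<lambda>r. (\<Sum>i\<in>I. X i \<omega> * indicator {c i<..e i} r)\<^sup>2"]
      by (simp add: has_bochner_integral_iff)
  qed
  show "(\<integral>\<^sup>+\<omega>. ennreal ((\<Sum>i\<in>I. X i \<omega> * (B (e i) \<omega> - B (c i) \<omega>))\<^sup>2) \<partial>M) =
      (\<integral>\<^sup>+\<omega>. (\<integral>\<^sup>+r. ennreal ((\<Sum>i\<in>I. X i \<omega> * indicator {c i<..e i} r)\<^sup>2) \<partial>lborel) \<partial>M)"
    unfolding inner using int int2 E inner_nonneg by (subst (1 2) nn_integral_eq_integral) auto
qed

text \<open>Each interval is clipped to the time from s to t. The left end point becomes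
  \<open>max s (\<tau> i)\<close>, at which both \<open>\<xi> i\<close> and anything known at s are
  measurable; the outer maximum makes a missed interval empty instead of reversed.\<close>

lemma simple_integral_increment:
  assumes d: "simple_data F n \<tau> \<xi>" and st: "0 \<le> s" "s \<le> t"
  shows "simple_integral B n \<tau> \<xi> t \<omega> - simple_integral B n \<tau> \<xi> s \<omega> =
    (\<Sum>i<n. \<xi> i \<omega> * (B (max (max s (\<tau> i)) (min t (\<tau> (Suc i)))) \<omega> - B (max s (\<tau> i)) \<omega>))"
  unfolding simple_integral_def sum_subtractf[symmetric]
proof (rule sum.cong[OF refl])
  fix i assume "i \<in> {..<n}"
  then have le: "\<tau> i \<le> \<tau> (Suc i)" using d by (auto simp: simple_data_def)
  consider "t \<le> \<tau> i" | "s \<le> \<tau> i" "\<tau> i < t" | "\<tau> i < s" "s \<le> \<tau> (Suc i)" | "\<tau> (Suc i) < s"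
    by linarith
  then show "\<xi> i \<omega> * (B (min t (\<tau> (Suc i))) \<omega> - B (min t (\<tau> i)) \<omega>) -
      \<xi> i \<omega> * (B (min s (\<tau> (Suc i))) \<omega> - B (min s (\<tau> i)) \<omega>) =
      \<xi> i \<omega> * (B (max (max s (\<tau> i)) (min t (\<tau> (Suc i)))) \<omega> - B (max s (\<tau> i)) \<omega>)"
    by cases (use le st in \<open>auto simp: min_def max_def algebra_simps\<close>)
qed

text \<open>The clipped intervals are those of \<open>simple_integral_increment\<close>, so that
  \<open>elementary_isometry\<close> can match integrand and integral term by term.\<close>

lemma simple_process_restrict:
  assumes d: "simple_data F n \<tau> \<xi>" and st: "0 \<le> s" "s \<le> t"
  shows "simple_process n \<tau> \<xi> r \<omega> * indicator {s<..t} r =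
    (\<Sum>i<n. \<xi> i \<omega> * indicator {max s (\<tau> i)<..max (max s (\<tau> i)) (min t (\<tau> (Suc i)))} r)"
  unfolding simple_process_def sum_distrib_right
  by (intro sum.cong refl) (use st in \<open>auto simp: indicator_def\<close>)

lemma simple_data_time_nonneg:
  assumes d: "simple_data F n \<tau> \<xi>" and "i \<le> n"
  shows "0 \<le> \<tau> i"
  using assms(2)
proof (induction i)
  case 0
  then show ?case using d by (auto simp: simple_data_def)
next
  case (Suc i)
  then have "\<tau> i \<le> \<tau> (Suc i)" using d by (auto simp: simple_data_def)
  then show ?case using Suc by simp
qed

lemma simple_data_coeff:
  assumes d: "simple_data F n \<tau> \<xi>" and "i < n" "0 \<le> s"
  shows "\<xi> i \<in> borel_measurable (F (max s (\<tau> i)))" "\<exists>C. \<forall>\<omega>. \<bar>\<xi> i \<omega>\<bar> \<le> C"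
proof -
  have "0 \<le> \<tau> i" using simple_data_time_nonneg[OF d, of i] assms by simp
  then show "\<xi> i \<in> borel_measurable (F (max s (\<tau> i)))" "\<exists>C. \<forall>\<omega>. \<bar>\<xi> i \<omega>\<bar> \<le> C"
    using d assms measurable_F_mono[of "\<tau> i" "max s (\<tau> i)"] by (auto simp: simple_data_def)
qed

lemma simple_integral_measurable:
  assumes d: "simple_data F n \<tau> \<xi>" and t: "0 \<le> t"
  shows "simple_integral B n \<tau> \<xi> t \<in> borel_measurable M"
  unfolding simple_integral_def[abs_def]
proof (intro borel_measurable_sum borel_measurable_times borel_measurable_diff)
  fix i assume "i \<in> {..<n}"
  then have i: "i < n" by simp
  show "\<xi> i \<in> borel_measurable M"
    using measurable_F_M[OF _ simple_data_coeff(1)[OF d i order_refl]] by simp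
  show "B (min t (\<tau> (Suc i))) \<in> borel_measurable M"
    using measurable_F_M[OF _ B_meas] simple_data_time_nonneg[OF d, of "Suc i"] i t by simp
  show "B (min t (\<tau> i)) \<in> borel_measurable M"
    using measurable_F_M[OF _ B_meas] simple_data_time_nonneg[OF d, of i] i t by simp
qed

lemma simple_integral_zero: "simple_data F n \<tau> \<xi> \<Longrightarrow> simple_integral B n \<tau> \<xi> 0 \<omega> = 0"
  using simple_data_time_nonneg[of n \<tau> \<xi>] by (simp add: simple_integral_def)

text \<open>After clipping at s every summand is a product of \<open>Z\<close> and a bounded
  coefficient, both known at the left end point, with a later increment; each therefore has mean
  zero.\<close>

lemma simple_increment_orthogonal:
  assumes d: "simple_data F n \<tau> \<xi>" and st: "0 \<le> s" "s \<le> t"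
    and Z: "Z \<in> borel_measurable (F s)" "integrable M (\<lambda>\<omega>. (Z \<omega>)\<^sup>2)"
  shows "(\<integral>\<omega>. Z \<omega> * (simple_integral B n \<tau> \<xi> t \<omega> - simple_integral B n \<tau> \<xi> s \<omega>) \<partial>M) = 0"
proof -
  have ZM: "Z \<in> borel_measurable M" using measurable_F_M[OF st(1) Z(1)] .
  have Zi: "integrable M Z" by (rule integrable_of_square[OF ZM Z(2)])
  have incr: "integrable M (\<lambda>\<omega>. Z \<omega> * (\<xi> i \<omega> * (B (max (max s (\<tau> i)) (min t (\<tau> (Suc i)))) \<omega> - B (max s (\<tau> i)) \<omega>))) \<and>
     (\<integral>\<omega>. Z \<omega> * (\<xi> i \<omega> * (B (max (max s (\<tau> i)) (min t (\<tau> (Suc i)))) \<omega> - B (max s (\<tau> i)) \<omega>)) \<partial>M) = 0"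
    if i: "i < n" for i
  proof -
    obtain C where C: "\<And>\<omega>. \<bar>\<xi> i \<omega>\<bar> \<le> C" using simple_data_coeff(2)[OF d i st(1)] by blast
    have c: "0 \<le> max s (\<tau> i)" using st by simp
    note x = simple_data_coeff(1)[OF d i st(1)]
    have m: "(\<lambda>\<omega>. \<xi> i \<omega> * Z \<omega>) \<in> borel_measurable (F (max s (\<tau> i)))"
      using x measurable_F_mono[OF st(1) _ Z(1), of "max s (\<tau> i)"] by simp
    have "integrable M (\<lambda>\<omega>. \<xi> i \<omega> * Z \<omega>)"
      by (rule bounded_mult_integrable[OF measurable_F_M[OF c x] C Zi])
    from mult_incr[OF m this c, of "max (max s (\<tau> i)) (min t (\<tau> (Suc i)))"]
    show ?thesis by (simp add: ac_simps)
  qed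
  show ?thesis
    unfolding simple_integral_increment[OF d st] sum_distrib_left
    by (subst Bochner_Integration.integral_sum) (use incr in auto)
qed

text \<open>The two simple processes form one elementary sum over the disjoint union of their index
  sets, the second with reversed sign, so \<open>elementary_isometry\<close> applies directly. The
  second claim is its integrability part for the increment from time 0.\<close>

lemma simple_increment_isometry:
  assumes d: "simple_data F n \<tau> \<xi>" "simple_data F n' \<tau>' \<xi>'" and st: "0 \<le> s" "s \<le> t"
  shows "(\<integral>\<^sup>+\<omega>. ennreal ((simple_integral B n \<tau> \<xi> t \<omega> - simple_integral B n \<tau> \<xi> s \<omega> -
        (simple_integral B n' \<tau>' \<xi>' t \<omega> - simple_integral B n' \<tau>' \<xi>' s \<omega>))\<^sup>2) \<partial>M) =
    (\<integral>\<^sup>+\<omega>. (\<integral>\<^sup>+r. ennreal ((simple_process n \<tau> \<xi> r \<omega> - simple_process n' \<tau>' \<xi>' r \<omega>)\<^sup>2) * indicator {s<..t} r \<partial>lborel) \<partial>M)"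
    (is "?L = ?R")
    and "integrable M (\<lambda>\<omega>. (simple_integral B n \<tau> \<xi> t \<omega>)\<^sup>2)"
proof -
  define I where "I = {..<n} <+> {..<n'}"
  define X where "X = case_sum \<xi> (\<lambda>i \<omega>. - \<xi>' i \<omega>)"
  define c where "c = case_sum (\<lambda>i. max s (\<tau> i)) (\<lambda>i. max s (\<tau>' i))"
  define e where "e = case_sum (\<lambda>i. max (max s (\<tau> i)) (min t (\<tau> (Suc i))))
    (\<lambda>i. max (max s (\<tau>' i)) (min t (\<tau>' (Suc i))))"
  have 1: "X i \<in> borel_measurable (F (c i))" "\<exists>C. \<forall>\<omega>. \<bar>X i \<omega>\<bar> \<le> C" if "i \<in> I" for i
    using that simple_data_coeff[OF d(1) _ st(1)] simple_data_coeff[OF d(2) _ st(1)]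
    by (auto simp: I_def X_def c_def)
  then obtain C where C: "\<And>i \<omega>. i \<in> I \<Longrightarrow> \<bar>X i \<omega>\<bar> \<le> C i" by metis
  have sumI: "(\<Sum>i\<in>I. g i) = (\<Sum>i<n. g (Inl i)) + (\<Sum>i<n'. g (Inr i))" for g :: "nat + nat \<Rightarrow> real"
    unfolding I_def by (simp add: sum.Plus)
  have "?L = (\<integral>\<^sup>+\<omega>. ennreal ((\<Sum>i\<in>I. X i \<omega> * (B (e i) \<omega> - B (c i) \<omega>))\<^sup>2) \<partial>M)"
    unfolding simple_integral_increment[OF d(1) st] simple_integral_increment[OF d(2) st] sumI
    by (simp add: X_def c_def e_def sum_negf)
  also have "\<dots> = (\<integral>\<^sup>+\<omega>. (\<integral>\<^sup>+r. ennreal ((\<Sum>i\<in>I. X i \<omega> * indicator {c i<..e i} r)\<^sup>2) \<partial>lborel) \<partial>M)"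
    by (rule elementary_isometry(2)[where C = C])
       (use 1 C st in \<open>auto simp: I_def c_def e_def\<close>)
  also have "\<dots> = ?R"
  proof (intro nn_integral_cong)
    fix \<omega> r
    have "(\<Sum>i\<in>I. X i \<omega> * indicator {c i<..e i} r) =
      simple_process n \<tau> \<xi> r \<omega> * indicator {s<..t} r - simple_process n' \<tau>' \<xi>' r \<omega> * indicator {s<..t} r"
      unfolding simple_process_restrict[OF d(1) st] simple_process_restrict[OF d(2) st] sumI
      by (simp add: X_def c_def e_def sum_negf)
    then show "ennreal ((\<Sum>i\<in>I. X i \<omega> * indicator {c i<..e i} r)\<^sup>2) =
      ennreal ((simple_process n \<tau> \<xi> r \<omega> - simple_process n' \<tau>' \<xi>' r \<omega>)\<^sup>2) * indicator {s<..t} r"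
      by (auto simp: indicator_def)
  qed
  finally show "?L = ?R" .
next
  define e where "e i = max (max 0 (\<tau> i)) (min t (\<tau> (Suc i)))" for i
  have "0 \<le> t" using st by simp
  have 1: "\<xi> i \<in> borel_measurable (F (max 0 (\<tau> i)))" "\<exists>C. \<forall>\<omega>. \<bar>\<xi> i \<omega>\<bar> \<le> C" if "i < n" for i
    using simple_data_coeff[OF d(1) that, of 0] by auto
  then obtain C where C: "\<And>i \<omega>. i < n \<Longrightarrow> \<bar>\<xi> i \<omega>\<bar> \<le> C i" by metis
  have "integrable M (\<lambda>\<omega>. (\<Sum>i<n. \<xi> i \<omega> * (B (e i) \<omega> - B (max 0 (\<tau> i)) \<omega>))\<^sup>2)"
    by (rule elementary_isometry(1)[where C = C]) (use 1 C in \<open>auto simp: e_def\<close>)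
  then show "integrable M (\<lambda>\<omega>. (simple_integral B n \<tau> \<xi> t \<omega>)\<^sup>2)"
    unfolding e_def simple_integral_increment[OF d(1) order_refl \<open>0 \<le> t\<close>, symmetric]
    using simple_integral_zero[OF d(1)] by simp
qed

section \<open>Limits in mean square\<close>

lemma square_integrable_of_nn_distance:
  fixes X Y :: "'w \<Rightarrow> real"
  assumes [measurable]: "X \<in> borel_measurable M" "Y \<in> borel_measurable M"
    and Y: "integrable M (\<lambda>\<omega>. (Y \<omega>)\<^sup>2)" and d: "(\<integral>\<^sup>+\<omega>. ennreal ((X \<omega> - Y \<omega>)\<^sup>2) \<partial>M) < \<infinity>"
  shows "integrable M (\<lambda>\<omega>. (X \<omega>)\<^sup>2)"
proof -
  have "integrable M (\<lambda>\<omega>. (X \<omega> - Y \<omega>)\<^sup>2)"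
    using d by (intro integrableI_nonneg) auto
  from integrable_square_add[OF _ _ this Y] show ?thesis by simp
qed

text \<open>Orthogonality lets \<open>X\<close> be replaced by \<open>X - Y j\<close>. The weighted
  inequality ab <= \<epsilon> a^2 + b^2/\<epsilon> then bounds the expectation by \<epsilon> E[Z^2]
  plus the mean square error over \<epsilon>; first j tends to infinity, then \<epsilon> to
  0.\<close>

lemma L2_limit_orthogonal:
  fixes X :: "'w \<Rightarrow> real" and Y :: "nat \<Rightarrow> 'w \<Rightarrow> real"
  assumes [measurable]: "X \<in> borel_measurable M" "\<And>j. Y j \<in> borel_measurable M" "Z \<in> borel_measurable M"
    and X: "integrable M (\<lambda>\<omega>. (X \<omega>)\<^sup>2)" and Y: "\<And>j. integrable M (\<lambda>\<omega>. (Y j \<omega>)\<^sup>2)"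
    and Z: "integrable M (\<lambda>\<omega>. (Z \<omega>)\<^sup>2)"
    and lim: "(\<lambda>j. \<integral>\<^sup>+\<omega>. ennreal ((X \<omega> - Y j \<omega>)\<^sup>2) \<partial>M) \<longlonglongrightarrow> 0"
    and orth: "\<And>j. (\<integral>\<omega>. Z \<omega> * Y j \<omega> \<partial>M) = 0"
  shows "(\<integral>\<omega>. Z \<omega> * X \<omega> \<partial>M) = 0"
proof -
  define D where "D j = (\<integral>\<omega>. (X \<omega> - Y j \<omega>)\<^sup>2 \<partial>M)" for j
  have di: "integrable M (\<lambda>\<omega>. (X \<omega> - Y j \<omega>)\<^sup>2)" for j
    by (rule integrable_square_diff) (use X Y in auto)
  have D0: "0 \<le> D j" for j by (simp add: D_def)
  have eq: "(\<integral>\<^sup>+\<omega>. ennreal ((X \<omega> - Y j \<omega>)\<^sup>2) \<partial>M) = ennreal (D j)" for j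
    unfolding D_def by (rule nn_integral_eq_integral) (use di in auto)
  have "(\<lambda>j. ennreal (D j)) \<longlonglongrightarrow> ennreal 0" using lim unfolding eq by simp
  then have D: "D \<longlonglongrightarrow> 0" by (subst (asm) tendsto_ennreal_iff) (use D0 in auto)
  have bound: "\<bar>\<integral>\<omega>. Z \<omega> * X \<omega> \<partial>M\<bar> \<le> \<epsilon> * (\<integral>\<omega>. (Z \<omega>)\<^sup>2 \<partial>M) + (1 / \<epsilon>) * D j" if "\<epsilon> > 0" for \<epsilon> j
  proof -
    have i1: "integrable M (\<lambda>\<omega>. Z \<omega> * X \<omega>)" "integrable M (\<lambda>\<omega>. Z \<omega> * Y j \<omega>)"
      by (rule integrable_mult_of_squares; use X Y Z in auto)+
    have "(\<integral>\<omega>. Z \<omega> * X \<omega> \<partial>M) = (\<integral>\<omega>. Z \<omega> * (X \<omega> - Y j \<omega>) \<partial>M)"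
      using i1 orth[of j] by (simp add: right_diff_distrib)
    also have "\<bar>\<dots>\<bar> \<le> (\<integral>\<omega>. \<bar>Z \<omega> * (X \<omega> - Y j \<omega>)\<bar> \<partial>M)" by (rule integral_abs_bound)
    also have "\<dots> \<le> (\<integral>\<omega>. \<epsilon> * (Z \<omega>)\<^sup>2 + (1 / \<epsilon>) * (X \<omega> - Y j \<omega>)\<^sup>2 \<partial>M)"
    proof (rule integral_mono)
      show "integrable M (\<lambda>\<omega>. \<bar>Z \<omega> * (X \<omega> - Y j \<omega>)\<bar>)"
        using i1 by (simp add: right_diff_distrib)
      show "integrable M (\<lambda>\<omega>. \<epsilon> * (Z \<omega>)\<^sup>2 + (1 / \<epsilon>) * (X \<omega> - Y j \<omega>)\<^sup>2)"
        using Z di by (intro Bochner_Integration.integrable_add integrable_mult_right)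
      fix \<omega>
      define a b where "a = \<bar>Z \<omega>\<bar>" and "b = \<bar>X \<omega> - Y j \<omega>\<bar>"
      have "0 \<le> (\<epsilon> * a - b)\<^sup>2 / \<epsilon>" using that by simp
      also have "(\<epsilon> * a - b)\<^sup>2 / \<epsilon> = \<epsilon> * a\<^sup>2 + (1 / \<epsilon>) * b\<^sup>2 - 2 * (a * b)"
        using that by (simp add: power2_diff field_simps power2_eq_square)
      finally have "a * b \<le> \<epsilon> * a\<^sup>2 + (1 / \<epsilon>) * b\<^sup>2"
        using mult_nonneg_nonneg[of a b] unfolding a_def b_def by (smt (verit) abs_ge_zero)
      then show "\<bar>Z \<omega> * (X \<omega> - Y j \<omega>)\<bar> \<le> \<epsilon> * (Z \<omega>)\<^sup>2 + (1 / \<epsilon>) * (X \<omega> - Y j \<omega>)\<^sup>2"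
        by (simp add: a_def b_def abs_mult)
    qed
    also have "\<dots> = \<epsilon> * (\<integral>\<omega>. (Z \<omega>)\<^sup>2 \<partial>M) + (1 / \<epsilon>) * D j"
      using Z di by (simp add: D_def)
    finally show ?thesis .
  qed
  have "\<bar>\<integral>\<omega>. Z \<omega> * X \<omega> \<partial>M\<bar> \<le> \<epsilon> * (\<integral>\<omega>. (Z \<omega>)\<^sup>2 \<partial>M)" if "\<epsilon> > 0" for \<epsilon>
  proof -
    have "(\<lambda>j. \<epsilon> * (\<integral>\<omega>. (Z \<omega>)\<^sup>2 \<partial>M) + (1 / \<epsilon>) * D j) \<longlonglongrightarrow> \<epsilon> * (\<integral>\<omega>. (Z \<omega>)\<^sup>2 \<partial>M) + (1 / \<epsilon>) * 0"
      by (intro tendsto_intros D)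
    then show ?thesis using bound[OF that] by (intro LIMSEQ_le_const[of _ _ "\<bar>\<integral>\<omega>. Z \<omega> * X \<omega> \<partial>M\<bar>"]) auto
  qed
  note eps = this
  have "((\<lambda>\<epsilon>. \<epsilon> * (\<integral>\<omega>. (Z \<omega>)\<^sup>2 \<partial>M)) \<longlongrightarrow> 0 * (\<integral>\<omega>. (Z \<omega>)\<^sup>2 \<partial>M)) (at_right 0)"
    by (intro tendsto_intros)
  then have "\<bar>\<integral>\<omega>. Z \<omega> * X \<omega> \<partial>M\<bar> \<le> 0 * (\<integral>\<omega>. (Z \<omega>)\<^sup>2 \<partial>M)"
    by (rule tendsto_lowerbound) (use eps in \<open>auto simp: eventually_at_right_less intro!: eventually_at_rightI[of 0 1]\<close>)
  then show ?thesis by simp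
qed

end

text \<open>Extended nonnegative integrals are used so that no error term has to be known to be
  finite beforehand. Iterating this bound produces the numerical factors in
  \<open>ito_increment_bound\<close>.\<close>

lemma nn_integral_square_diff_le:
  fixes f g :: "'a \<Rightarrow> real"
  assumes [measurable]: "f \<in> borel_measurable N" "g \<in> borel_measurable N"
  shows "(\<integral>\<^sup>+x. ennreal ((f x - g x)\<^sup>2) \<partial>N) \<le>
    2 * (\<integral>\<^sup>+x. ennreal ((f x)\<^sup>2) \<partial>N) + 2 * (\<integral>\<^sup>+x. ennreal ((g x)\<^sup>2) \<partial>N)"
proof -
  have "(\<integral>\<^sup>+x. ennreal ((f x - g x)\<^sup>2) \<partial>N) \<le> (\<integral>\<^sup>+x. 2 * ennreal ((f x)\<^sup>2) + 2 * ennreal ((g x)\<^sup>2) \<partial>N)"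
  proof (rule nn_integral_mono)
    fix x
    have "0 \<le> (f x + g x)\<^sup>2" by simp
    then have "(f x - g x)\<^sup>2 \<le> 2 * (f x)\<^sup>2 + 2 * (g x)\<^sup>2"
      by (simp add: power2_sum power2_diff)
    then have "ennreal ((f x - g x)\<^sup>2) \<le> ennreal (2 * (f x)\<^sup>2 + 2 * (g x)\<^sup>2)" by (rule ennreal_leI)
    also have "\<dots> = 2 * ennreal ((f x)\<^sup>2) + 2 * ennreal ((g x)\<^sup>2)"
      by (simp add: ennreal_plus ennreal_mult)
    finally show "ennreal ((f x - g x)\<^sup>2) \<le> 2 * ennreal ((f x)\<^sup>2) + 2 * ennreal ((g x)\<^sup>2)" .
  qed
  also have "\<dots> = 2 * (\<integral>\<^sup>+x. ennreal ((f x)\<^sup>2) \<partial>N) + 2 * (\<integral>\<^sup>+x. ennreal ((g x)\<^sup>2) \<partial>N)"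
    by (subst nn_integral_add) (auto simp: nn_integral_cmult)
  finally show ?thesis .
qed

section \<open>The Ito integral as a limit of simple integrals, and the maximal inequality\<close>

context brownian_filtration
begin

lemma ito_measurable: "is_ito_integral M F B H I \<Longrightarrow> 0 \<le> t \<Longrightarrow> I t \<in> borel_measurable M"
  unfolding is_ito_integral_def by (blast intro: measurable_F_M)

lemma ito_square_integrable:
  assumes I: "is_ito_integral M F B H I" and t: "0 \<le> t"
  shows "integrable M (\<lambda>\<omega>. (I t \<omega>)\<^sup>2)"
proof -
  from I obtain n \<tau> \<xi> where d: "\<And>j::nat. simple_data F (n j) (\<tau> j) (\<xi> j)"
    and lim: "\<And>t. 0 \<le> t \<Longrightarrow> (\<lambda>j. \<integral>\<^sup>+\<omega>. ennreal ((I t \<omega> - simple_integral B (n j) (\<tau> j) (\<xi> j) t \<omega>)\<^sup>2) \<partial>M)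
            \<longlonglongrightarrow> 0"
    unfolding is_ito_integral_def by blast
  have "\<forall>\<^sub>F j in sequentially. (\<integral>\<^sup>+\<omega>. ennreal ((I t \<omega> - simple_integral B (n j) (\<tau> j) (\<xi> j) t \<omega>)\<^sup>2) \<partial>M) < 1"
    by (rule order_tendstoD(2)[OF lim[OF t]]) simp
  then obtain j where j: "(\<integral>\<^sup>+\<omega>. ennreal ((I t \<omega> - simple_integral B (n j) (\<tau> j) (\<xi> j) t \<omega>)\<^sup>2) \<partial>M) < 1"
    by (auto simp: eventually_sequentially)
  show ?thesis
    by (rule square_integrable_of_nn_distance[OF ito_measurable[OF I t] simple_integral_measurable[OF d[of j] t]
         simple_increment_isometry(2)[OF d[of j] d[of j] order_refl t]])
       (use j in \<open>auto intro: less_trans\<close>)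
qed

text \<open>Progressive measurability speaks only of times up to \<open>T\<close> and of the smaller
  sigma-algebra at \<open>T\<close>. Clamping the time to that interval gives a map defined on the
  whole product, and the indicator removes the clamped values.\<close>

lemma progressive_measurable:
  assumes H: "progressively_measurable F H" and T: "0 \<le> T"
  shows "(\<lambda>(\<omega>, r). H r \<omega> * indicator {0..T} r) \<in> borel_measurable (M \<Otimes>\<^sub>M lborel)"
proof -
  have id: "(\<lambda>\<omega>. \<omega>) \<in> measurable M (F T)"
    using space_F[OF T] sets_F[OF T] sets.sets_into_space by (auto simp: measurable_def)
  have cl: "(\<lambda>p. max 0 (min T (snd p))) \<in> measurable (M \<Otimes>\<^sub>M lborel) (restrict_space borel {0..T})"
    by (rule measurable_restrict_space2) (use T in auto)
  have "(\<lambda>p. (max 0 (min T (snd p)), fst p)) \<in> measurable (M \<Otimes>\<^sub>M lborel) (restrict_space borel {0..T} \<Otimes>\<^sub>M F T)"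
    by (rule measurable_Pair[OF cl measurable_compose[OF measurable_fst id]])
  moreover have "(\<lambda>(t, \<omega>). H t \<omega>) \<in> borel_measurable (restrict_space borel {0..T} \<Otimes>\<^sub>M F T)"
    using H T by (auto simp: progressively_measurable_def)
  ultimately have [measurable]: "(\<lambda>p. H (max 0 (min T (snd p))) (fst p)) \<in> borel_measurable (M \<Otimes>\<^sub>M lborel)"
    using measurable_compose by fastforce
  have "(\<lambda>(\<omega>, r). H r \<omega> * indicator {0..T} r) =
     (\<lambda>p. H (max 0 (min T (snd p))) (fst p) * indicator {0..T} (snd p))"
    by (auto simp: fun_eq_iff indicator_def max_def min_def)
  then show ?thesis by simp
qed

lemma simple_process_measurable:
  assumes d: "simple_data F n \<tau> \<xi>"
  shows "(\<lambda>(\<omega>, r). simple_process n \<tau> \<xi> r \<omega>) \<in> borel_measurable (M \<Otimes>\<^sub>M lborel)"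
proof -
  have "\<xi> i \<in> borel_measurable M" if "i < n" for i
    using measurable_F_M[OF _ simple_data_coeff(1)[OF d that order_refl]] by simp
  then show ?thesis
    unfolding simple_process_def case_prod_beta
    by (intro borel_measurable_sum borel_measurable_times measurable_compose[OF measurable_fst])
       auto
qed

text \<open>The martingale property in weak form. It holds for each approximating simple integral,
  and mean square convergence at the two times s and t carries it to the limit.\<close>

lemma ito_orthogonal:
  assumes I: "is_ito_integral M F B H I" and st: "0 \<le> s" "s \<le> t"
    and Z: "Z \<in> borel_measurable (F s)" "integrable M (\<lambda>\<omega>. (Z \<omega>)\<^sup>2)"
  shows "(\<integral>\<omega>. Z \<omega> * (I t \<omega> - I s \<omega>) \<partial>M) = 0"
proof -
  from I obtain n \<tau> \<xi> where d: "\<And>j::nat. simple_data F (n j) (\<tau> j) (\<xi> j)"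
    and lim: "\<And>t. 0 \<le> t \<Longrightarrow> (\<lambda>j. \<integral>\<^sup>+\<omega>. ennreal ((I t \<omega> - simple_integral B (n j) (\<tau> j) (\<xi> j) t \<omega>)\<^sup>2) \<partial>M)
            \<longlonglongrightarrow> 0"
    unfolding is_ito_integral_def by blast
  have t: "0 \<le> t" using st by simp
  define S where "S j = simple_integral B (n j) (\<tau> j) (\<xi> j)" for j
  have [measurable]: "I s \<in> borel_measurable M" "I t \<in> borel_measurable M"
    using ito_measurable[OF I] st t by auto
  have [measurable]: "S j s \<in> borel_measurable M" "S j t \<in> borel_measurable M" for j
    unfolding S_def using simple_integral_measurable[OF d] st t by auto
  have sq: "integrable M (\<lambda>\<omega>. (S j s \<omega>)\<^sup>2)" "integrable M (\<lambda>\<omega>. (S j t \<omega>)\<^sup>2)" for j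
    unfolding S_def using simple_increment_isometry(2)[OF d d order_refl] st t by auto
  show ?thesis
  proof (rule L2_limit_orthogonal[where Y = "\<lambda>j \<omega>. S j t \<omega> - S j s \<omega>"])
    show "(\<lambda>j. \<integral>\<^sup>+\<omega>. ennreal ((I t \<omega> - I s \<omega> - (S j t \<omega> - S j s \<omega>))\<^sup>2) \<partial>M) \<longlonglongrightarrow> 0"
    proof (rule tendsto_sandwich[OF always_eventually always_eventually tendsto_const])
      show "\<forall>j. (\<integral>\<^sup>+\<omega>. ennreal ((I t \<omega> - I s \<omega> - (S j t \<omega> - S j s \<omega>))\<^sup>2) \<partial>M) \<le>
        2 * (\<integral>\<^sup>+\<omega>. ennreal ((I t \<omega> - S j t \<omega>)\<^sup>2) \<partial>M) + 2 * (\<integral>\<^sup>+\<omega>. ennreal ((I s \<omega> - S j s \<omega>)\<^sup>2) \<partial>M)"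
      proof
        fix j
        have "I t \<omega> - I s \<omega> - (S j t \<omega> - S j s \<omega>) = (I t \<omega> - S j t \<omega>) - (I s \<omega> - S j s \<omega>)" for \<omega> by simp
        then show "(\<integral>\<^sup>+\<omega>. ennreal ((I t \<omega> - I s \<omega> - (S j t \<omega> - S j s \<omega>))\<^sup>2) \<partial>M) \<le>
          2 * (\<integral>\<^sup>+\<omega>. ennreal ((I t \<omega> - S j t \<omega>)\<^sup>2) \<partial>M) + 2 * (\<integral>\<^sup>+\<omega>. ennreal ((I s \<omega> - S j s \<omega>)\<^sup>2) \<partial>M)"
          by (simp only:) (intro nn_integral_square_diff_le; measurable)
      qed
      have "(\<lambda>j. 2 * (\<integral>\<^sup>+\<omega>. ennreal ((I t \<omega> - S j t \<omega>)\<^sup>2) \<partial>M) + 2 * (\<integral>\<^sup>+\<omega>. ennreal ((I s \<omega> - S j s \<omega>)\<^sup>2) \<partial>M))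
        \<longlonglongrightarrow> 2 * 0 + 2 * 0"
        unfolding S_def by (intro tendsto_add ennreal_tendsto_cmult lim st t) auto
      then show "(\<lambda>j. 2 * (\<integral>\<^sup>+\<omega>. ennreal ((I t \<omega> - S j t \<omega>)\<^sup>2) \<partial>M) + 2 * (\<integral>\<^sup>+\<omega>. ennreal ((I s \<omega> - S j s \<omega>)\<^sup>2) \<partial>M))
        \<longlonglongrightarrow> 0" by simp
    qed simp
    show "Z \<in> borel_measurable M" using measurable_F_M[OF st(1) Z(1)] .
    show "(\<integral>\<omega>. Z \<omega> * (S j t \<omega> - S j s \<omega>) \<partial>M) = 0" for j
      unfolding S_def by (rule simple_increment_orthogonal[OF d st Z])
  qed (use ito_square_integrable[OF I] st t sq Z in \<open>auto intro!: integrable_square_diff\<close>)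
qed

text \<open>The exact isometry is applied to the approximating simple processes, and all
  approximation errors vanish in the limit. Separating these errors twice by (a - b)^2 <= 2a^2 +
  2b^2 costs the factor 4, which avoids any computation of limits of norms.\<close>

lemma ito_increment_bound:
  assumes I: "is_ito_integral M F B H I" "is_ito_integral M F B H' I'" and st: "0 \<le> s" "s \<le> t"
  shows "(\<integral>\<^sup>+\<omega>. ennreal ((I t \<omega> - I s \<omega> - (I' t \<omega> - I' s \<omega>))\<^sup>2) \<partial>M) \<le>
    4 * (\<integral>\<^sup>+\<omega>. (\<integral>\<^sup>+r. ennreal ((H r \<omega> - H' r \<omega>)\<^sup>2) * indicator {s..t} r \<partial>lborel) \<partial>M)" (is "?L \<le> _")
proof -
  have t: "0 \<le> t" using st by simp
  from I(1) obtain n \<tau> \<xi> where d: "\<And>j::nat. simple_data F (n j) (\<tau> j) (\<xi> j)"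
    and lim: "\<And>t. 0 \<le> t \<Longrightarrow> (\<lambda>j. \<integral>\<^sup>+\<omega>. ennreal ((I t \<omega> - simple_integral B (n j) (\<tau> j) (\<xi> j) t \<omega>)\<^sup>2) \<partial>M)
            \<longlonglongrightarrow> 0"
    and limp: "\<And>T. 0 \<le> T \<Longrightarrow> (\<lambda>j. L2_process_norm2 M T
            (\<lambda>t \<omega>. H t \<omega> - simple_process (n j) (\<tau> j) (\<xi> j) t \<omega>)) \<longlonglongrightarrow> 0"
    and prog: "progressively_measurable F H"
    unfolding is_ito_integral_def by blast
  from I(2) obtain n' \<tau>' \<xi>' where d': "\<And>j::nat. simple_data F (n' j) (\<tau>' j) (\<xi>' j)"
    and lim': "\<And>t. 0 \<le> t \<Longrightarrow> (\<lambda>j. \<integral>\<^sup>+\<omega>. ennreal ((I' t \<omega> - simple_integral B (n' j) (\<tau>' j) (\<xi>' j) t \<omega>)\<^sup>2) \<partial>M)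
            \<longlonglongrightarrow> 0"
    and limp': "\<And>T. 0 \<le> T \<Longrightarrow> (\<lambda>j. L2_process_norm2 M T
            (\<lambda>t \<omega>. H' t \<omega> - simple_process (n' j) (\<tau>' j) (\<xi>' j) t \<omega>)) \<longlonglongrightarrow> 0"
    and prog': "progressively_measurable F H'"
    unfolding is_ito_integral_def by blast
  define S where "S j = simple_integral B (n j) (\<tau> j) (\<xi> j)" for j
  define S' where "S' j = simple_integral B (n' j) (\<tau>' j) (\<xi>' j)" for j
  define P where "P j = simple_process (n j) (\<tau> j) (\<xi> j)" for j
  define P' where "P' j = simple_process (n' j) (\<tau>' j) (\<xi>' j)" for j
  have [measurable]: "I s \<in> borel_measurable M" "I t \<in> borel_measurable M"
      "I' s \<in> borel_measurable M" "I' t \<in> borel_measurable M"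
    using ito_measurable[OF I(1)] ito_measurable[OF I(2)] st t by auto
  have [measurable]: "S j s \<in> borel_measurable M" "S j t \<in> borel_measurable M"
    "S' j s \<in> borel_measurable M" "S' j t \<in> borel_measurable M" for j
    unfolding S_def S'_def using simple_integral_measurable[OF d] simple_integral_measurable[OF d'] st t by auto
  define err where "err j = (\<integral>\<^sup>+\<omega>. ennreal ((I t \<omega> - S j t \<omega>)\<^sup>2) \<partial>M) + (\<integral>\<^sup>+\<omega>. ennreal ((I s \<omega> - S j s \<omega>)\<^sup>2) \<partial>M)
    + (\<integral>\<^sup>+\<omega>. ennreal ((I' t \<omega> - S' j t \<omega>)\<^sup>2) \<partial>M) + (\<integral>\<^sup>+\<omega>. ennreal ((I' s \<omega> - S' j s \<omega>)\<^sup>2) \<partial>M)" for j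
  have err: "err \<longlonglongrightarrow> 0"
    unfolding err_def[abs_def] S_def S'_def
    using tendsto_add[OF tendsto_add[OF tendsto_add[OF lim[OF t] lim[OF st(1)]] lim'[OF t]] lim'[OF st(1)]] by simp
  define perr where "perr j = L2_process_norm2 M t (\<lambda>t \<omega>. H t \<omega> - P j t \<omega>) + L2_process_norm2 M t (\<lambda>t \<omega>. H' t \<omega> - P' j t \<omega>)" for j
  have perr: "perr \<longlonglongrightarrow> 0"
    unfolding perr_def[abs_def] P_def P'_def using tendsto_add[OF limp[OF t] limp'[OF t]] by simp
  define G where "G = (\<integral>\<^sup>+\<omega>. (\<integral>\<^sup>+r. ennreal ((H r \<omega> - H' r \<omega>)\<^sup>2) * indicator {s..t} r \<partial>lborel) \<partial>M)"
  let ?N = "M \<Otimes>\<^sub>M lborel :: ('w \<times> real) measure"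
  \<comment> \<open>Joint measurability of the integrands is available only up to a finite time,
    hence the cutoff at t. The simple processes are measurable for all times and receive the cutoff
    separately.\<close>
  define h where "h = (\<lambda>(\<omega>, r). H r \<omega> * indicator {0..t} r)"
  define h' where "h' = (\<lambda>(\<omega>, r). H' r \<omega> * indicator {0..t} r)"
  define p where "p j = (\<lambda>(\<omega>, r). P j r \<omega>)" for j
  define p' where "p' j = (\<lambda>(\<omega>, r). P' j r \<omega>)" for j
  have [measurable]: "h \<in> borel_measurable ?N" "h' \<in> borel_measurable ?N"
    unfolding h_def h'_def by (rule progressive_measurable[OF prog t] progressive_measurable[OF prog' t])+
  have [measurable]: "p j \<in> borel_measurable ?N" "p' j \<in> borel_measurable ?N" for j
    unfolding p_def p'_def P_def P'_def by (rule simple_process_measurable[OF d] simple_process_measurable[OF d'])+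
  let ?wt = "\<lambda>q::'w \<times> real. indicator {0..t} (snd q) :: real"
  let ?ws = "\<lambda>q::'w \<times> real. indicator {s<..t} (snd q) :: real"
  have iter: "(\<integral>\<^sup>+q. f q \<partial>?N) = (\<integral>\<^sup>+\<omega>. (\<integral>\<^sup>+r. f (\<omega>, r) \<partial>lborel) \<partial>M)" if "f \<in> borel_measurable ?N" for f
    using lborel.nn_integral_fst[OF that] by simp
  have pe: "L2_process_norm2 M t (\<lambda>t \<omega>. H t \<omega> - P j t \<omega>) = (\<integral>\<^sup>+q. ennreal ((h q - p j q * ?wt q)\<^sup>2) \<partial>?N)" for j
    unfolding L2_process_norm2_def
    by (subst iter, measurable) (auto simp: h_def p_def indicator_def intro!: nn_integral_cong)
  have pe': "L2_process_norm2 M t (\<lambda>t \<omega>. H' t \<omega> - P' j t \<omega>) = (\<integral>\<^sup>+q. ennreal ((h' q - p' j q * ?wt q)\<^sup>2) \<partial>?N)" for j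
    unfolding L2_process_norm2_def
    by (subst iter, measurable) (auto simp: h'_def p'_def indicator_def intro!: nn_integral_cong)
  have step: "?L \<le> 4 * G + (8 * perr j + 8 * err j)" for j
  proof -
    \<comment> \<open>\<open>?D\<close> is the increment for the simple processes, and
      \<open>?R\<close> gathers the errors of both integrals at the two times, signed so that the
      wanted increment is \<open>?D - ?R\<close>.\<close>
    let ?D = "\<lambda>\<omega>. S j t \<omega> - S j s \<omega> - (S' j t \<omega> - S' j s \<omega>)"
    let ?R = "\<lambda>\<omega>. (I' t \<omega> - S' j t \<omega> - (I' s \<omega> - S' j s \<omega>)) - (I t \<omega> - S j t \<omega> - (I s \<omega> - S j s \<omega>))"
    have "?L = (\<integral>\<^sup>+\<omega>. ennreal ((?D \<omega> - ?R \<omega>)\<^sup>2) \<partial>M)" by (simp add: algebra_simps)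
    also have "\<dots> \<le> 2 * (\<integral>\<^sup>+\<omega>. ennreal ((?D \<omega>)\<^sup>2) \<partial>M) + 2 * (\<integral>\<^sup>+\<omega>. ennreal ((?R \<omega>)\<^sup>2) \<partial>M)"
      by (rule nn_integral_square_diff_le; measurable)
    finally have L: "?L \<le> 2 * (\<integral>\<^sup>+\<omega>. ennreal ((?D \<omega>)\<^sup>2) \<partial>M) + 2 * (\<integral>\<^sup>+\<omega>. ennreal ((?R \<omega>)\<^sup>2) \<partial>M)" .
    have R: "(\<integral>\<^sup>+\<omega>. ennreal ((?R \<omega>)\<^sup>2) \<partial>M) \<le> 4 * err j"
    proof -
      have "(\<integral>\<^sup>+\<omega>. ennreal ((?R \<omega>)\<^sup>2) \<partial>M) \<le>
         2 * (\<integral>\<^sup>+\<omega>. ennreal ((I' t \<omega> - S' j t \<omega> - (I' s \<omega> - S' j s \<omega>))\<^sup>2) \<partial>M) +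
         2 * (\<integral>\<^sup>+\<omega>. ennreal ((I t \<omega> - S j t \<omega> - (I s \<omega> - S j s \<omega>))\<^sup>2) \<partial>M)"
        by (rule nn_integral_square_diff_le; measurable)
      also have "\<dots> \<le> 2 * (2 * (\<integral>\<^sup>+\<omega>. ennreal ((I' t \<omega> - S' j t \<omega>)\<^sup>2) \<partial>M) + 2 * (\<integral>\<^sup>+\<omega>. ennreal ((I' s \<omega> - S' j s \<omega>)\<^sup>2) \<partial>M))
         + 2 * (2 * (\<integral>\<^sup>+\<omega>. ennreal ((I t \<omega> - S j t \<omega>)\<^sup>2) \<partial>M) + 2 * (\<integral>\<^sup>+\<omega>. ennreal ((I s \<omega> - S j s \<omega>)\<^sup>2) \<partial>M))"
        by (intro add_mono mult_left_mono nn_integral_square_diff_le) auto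
      also have "\<dots> = 4 * err j" by (simp add: err_def distrib_left mult.assoc[symmetric] add.commute add.left_commute add.assoc)
      finally show ?thesis .
    qed
    have D: "(\<integral>\<^sup>+\<omega>. ennreal ((?D \<omega>)\<^sup>2) \<partial>M) \<le> 2 * G + 4 * perr j"
    proof -
      \<comment> \<open>Between s and t the difference of the simple processes is the difference of
        the integrands minus the difference of the two approximation errors; elsewhere all terms
        vanish.\<close>
      let ?f = "\<lambda>q. (h q - h' q) * ?ws q"
      let ?g = "\<lambda>q. ((h q - p j q * ?wt q) - (h' q - p' j q * ?wt q)) * ?ws q"
      have "(\<integral>\<^sup>+\<omega>. ennreal ((?D \<omega>)\<^sup>2) \<partial>M) =
        (\<integral>\<^sup>+\<omega>. (\<integral>\<^sup>+r. ennreal ((P j r \<omega> - P' j r \<omega>)\<^sup>2) * indicator {s<..t} r \<partial>lborel) \<partial>M)"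
        unfolding S_def S'_def P_def P'_def by (rule simple_increment_isometry(1)[OF d d' st])
      also have "\<dots> = (\<integral>\<^sup>+q. ennreal ((?f q - ?g q)\<^sup>2) \<partial>?N)"
        by (subst iter, measurable)
           (use st in \<open>auto simp: h_def h'_def p_def p'_def indicator_def intro!: nn_integral_cong\<close>)
      also have "\<dots> \<le> 2 * (\<integral>\<^sup>+q. ennreal ((?f q)\<^sup>2) \<partial>?N) + 2 * (\<integral>\<^sup>+q. ennreal ((?g q)\<^sup>2) \<partial>?N)"
        by (rule nn_integral_square_diff_le; measurable)
      finally have DD: "(\<integral>\<^sup>+\<omega>. ennreal ((?D \<omega>)\<^sup>2) \<partial>M) \<le>
        2 * (\<integral>\<^sup>+q. ennreal ((?f q)\<^sup>2) \<partial>?N) + 2 * (\<integral>\<^sup>+q. ennreal ((?g q)\<^sup>2) \<partial>?N)" .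
      have f: "(\<integral>\<^sup>+q. ennreal ((?f q)\<^sup>2) \<partial>?N) \<le> G"
        unfolding G_def
        by (subst iter, measurable, intro nn_integral_mono)
           (use st in \<open>auto simp: h_def h'_def indicator_def\<close>)
      have "(\<integral>\<^sup>+q. ennreal ((?g q)\<^sup>2) \<partial>?N) \<le> (\<integral>\<^sup>+q. ennreal (((h q - p j q * ?wt q) - (h' q - p' j q * ?wt q))\<^sup>2) \<partial>?N)"
        by (intro nn_integral_mono) (auto simp: indicator_def)
      also have "\<dots> \<le> 2 * (\<integral>\<^sup>+q. ennreal ((h q - p j q * ?wt q)\<^sup>2) \<partial>?N) + 2 * (\<integral>\<^sup>+q. ennreal ((h' q - p' j q * ?wt q)\<^sup>2) \<partial>?N)"
        by (rule nn_integral_square_diff_le; measurable)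
      also have "\<dots> = 2 * perr j" unfolding pe[symmetric] pe'[symmetric] perr_def by (simp add: distrib_left)
      finally have g: "(\<integral>\<^sup>+q. ennreal ((?g q)\<^sup>2) \<partial>?N) \<le> 2 * perr j" .
      have "2 * (\<integral>\<^sup>+q. ennreal ((?f q)\<^sup>2) \<partial>?N) + 2 * (\<integral>\<^sup>+q. ennreal ((?g q)\<^sup>2) \<partial>?N) \<le> 2 * G + 2 * (2 * perr j)"
        by (intro add_mono mult_left_mono f g) auto
      with DD show ?thesis by (simp add: mult.assoc[symmetric])
    qed
    have "2 * (\<integral>\<^sup>+\<omega>. ennreal ((?D \<omega>)\<^sup>2) \<partial>M) + 2 * (\<integral>\<^sup>+\<omega>. ennreal ((?R \<omega>)\<^sup>2) \<partial>M) \<le>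
        2 * (2 * G + 4 * perr j) + 2 * (4 * err j)"
      by (intro add_mono mult_left_mono D R) auto
    also have "\<dots> = 4 * G + (8 * perr j + 8 * err j)"
      by (simp add: distrib_left mult.assoc[symmetric] add.assoc)
    finally show ?thesis using L by simp
  qed
  have "(\<lambda>j. 4 * G + (8 * perr j + 8 * err j)) \<longlonglongrightarrow> 4 * G + (8 * 0 + 8 * 0)"
    by (intro tendsto_add tendsto_const ennreal_tendsto_cmult err perr) auto
  then have "?L \<le> 4 * G + (8 * 0 + 8 * 0)"
    by (rule LIMSEQ_le_const) (use step in auto)
  then show ?thesis by (simp add: G_def)
qed

text \<open>Kolmogorov's first-passage argument, by induction over increasing times. A new largest
  time \<open>b\<close> adds the event \<open>D\<close> that the level is exceeded at
  \<open>b\<close> but not before; on it the second moment can only grow from \<open>b\<close> to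
  \<open>e\<close>. Keeping the indicator on the right makes the bounds additive over these disjoint
  events.\<close>

lemma maximal_inequality_finite:
  assumes Y: "\<And>u. s \<le> u \<Longrightarrow> Y u \<in> borel_measurable (F u)" "\<And>u. s \<le> u \<Longrightarrow> integrable M (\<lambda>\<omega>. (Y u \<omega>)\<^sup>2)"
    and orth: "\<And>u v Z. s \<le> u \<Longrightarrow> u \<le> v \<Longrightarrow> Z \<in> borel_measurable (F u) \<Longrightarrow> integrable M (\<lambda>\<omega>. (Z \<omega>)\<^sup>2) \<Longrightarrow>
      (\<integral>\<omega>. Z \<omega> * (Y v \<omega> - Y u \<omega>) \<partial>M) = 0"
    and s: "0 \<le> s" and T: "finite T" "T \<subseteq> {s..e}" and c: "(0::real) < c"
  shows "c\<^sup>2 * prob {\<omega>\<in>space M. \<exists>u\<in>T. \<bar>Y u \<omega>\<bar> > c} \<le>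
    (\<integral>\<omega>. (Y e \<omega>)\<^sup>2 * indicator {\<omega>\<in>space M. \<exists>u\<in>T. \<bar>Y u \<omega>\<bar> > c} \<omega> \<partial>M)"
  using T
proof (induction T rule: finite_linorder_max_induct)
  case (insert b T)
  define A where "A = {\<omega>\<in>space M. \<exists>u\<in>T. \<bar>Y u \<omega>\<bar> > c}"
  define D where "D = {\<omega>\<in>space M. \<bar>Y b \<omega>\<bar> > c} - A"
  have b: "s \<le> b" "b \<le> e" using insert by auto
  then have b0: "0 \<le> b" and e: "s \<le> e" using s by auto
  have Yb: "Y u \<in> borel_measurable (F b)" if "u \<in> insert b T" for u
    using measurable_F_mono[OF _ _ Y(1), of u b] insert that s by force
  have [measurable]: "A \<in> sets (F b)"
  proof -
    have "A = (\<Union>u\<in>T. {\<omega>\<in>space (F b). \<bar>Y u \<omega>\<bar> > c})" by (auto simp: A_def space_F[OF b0])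
    also have "\<dots> \<in> sets (F b)" using Yb insert(1) by (intro sets.finite_UN) auto
    finally show ?thesis .
  qed
  have [measurable]: "Y b \<in> borel_measurable (F b)" using Yb by simp
  have DF[measurable]: "D \<in> sets (F b)" unfolding D_def space_F[OF b0, symmetric] by measurable
  have AM: "A \<in> sets M" and DM: "D \<in> sets M" using sets_F[OF b0] DF \<open>A \<in> sets (F b)\<close> by auto
  have [measurable]: "Y e \<in> borel_measurable M" "Y b \<in> borel_measurable M"
    using measurable_F_M[OF _ Y(1)] b s by auto
  have sub: "{\<omega>\<in>space M. \<exists>u\<in>insert b T. \<bar>Y u \<omega>\<bar> > c} = A \<union> D" "A \<inter> D = {}"
    by (auto simp: A_def D_def)
  \<comment> \<open>The test variable for orthogonality: it is known at time \<open>b\<close>,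
    because the event \<open>D\<close> is.\<close>
  let ?Z = "\<lambda>\<omega>. indicator D \<omega> * Y b \<omega>"
  have sqi: "integrable M (\<lambda>\<omega>. (Y u \<omega>)\<^sup>2 * indicator S \<omega>)" if "s \<le> u" "S \<in> sets M" for u S
    using integrable_real_mult_indicator[OF that(2) Y(2)[OF that(1)]] by simp
  have Z: "?Z \<in> borel_measurable (F b)" by simp
  have Z2: "integrable M (\<lambda>\<omega>. (?Z \<omega>)\<^sup>2)"
  proof -
    have "(\<lambda>\<omega>. (?Z \<omega>)\<^sup>2) = (\<lambda>\<omega>. (Y b \<omega>)\<^sup>2 * indicator D \<omega>)" by (auto simp: fun_eq_iff indicator_def)
    then show ?thesis using sqi[OF b(1) DM] by simp
  qed
  have Zi: "integrable M (\<lambda>\<omega>. ?Z \<omega> * Y e \<omega>)"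
    by (rule integrable_mult_of_squares) (use DM Y(2) e Z2 in auto)
  have low: "c\<^sup>2 * prob D \<le> (\<integral>\<omega>. (Y b \<omega>)\<^sup>2 * indicator D \<omega> \<partial>M)"
  proof -
    have "c\<^sup>2 * prob D = (\<integral>\<omega>. c\<^sup>2 * indicator D \<omega> \<partial>M)" using DM by simp
    also have "\<dots> \<le> (\<integral>\<omega>. (Y b \<omega>)\<^sup>2 * indicator D \<omega> \<partial>M)"
    proof (rule integral_mono)
      show "integrable M (\<lambda>\<omega>. c\<^sup>2 * indicator D \<omega>)"
        using DM by (intro integrable_mult_right integrable_real_indicator) (auto simp: emeasure_eq_measure)
      show "integrable M (\<lambda>\<omega>. (Y b \<omega>)\<^sup>2 * indicator D \<omega>)" by (rule sqi[OF b(1) DM])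
      fix \<omega>
      have "c\<^sup>2 \<le> (Y b \<omega>)\<^sup>2" if "\<omega> \<in> D"
        using that c by (auto simp: D_def abs_le_square_iff[symmetric])
      then show "c\<^sup>2 * indicator D \<omega> \<le> (Y b \<omega>)\<^sup>2 * indicator D \<omega>" by (auto simp: indicator_def)
    qed
    finally show ?thesis .
  qed
  have up: "(\<integral>\<omega>. (Y b \<omega>)\<^sup>2 * indicator D \<omega> \<partial>M) \<le> (\<integral>\<omega>. (Y e \<omega>)\<^sup>2 * indicator D \<omega> \<partial>M)"
  proof -
    have "(\<integral>\<omega>. ?Z \<omega> * (Y e \<omega> - Y b \<omega>) \<partial>M) = 0" by (rule orth[OF b Z Z2])
    moreover have "integrable M (\<lambda>\<omega>. ?Z \<omega> * (Y e \<omega> - Y b \<omega>))"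
      by (rule integrable_mult_of_squares) (use DM Z2 Y(2) b e in \<open>auto intro: integrable_square_diff\<close>)
    ultimately have "(\<integral>\<omega>. (Y b \<omega>)\<^sup>2 * indicator D \<omega> \<partial>M) =
        (\<integral>\<omega>. (Y b \<omega>)\<^sup>2 * indicator D \<omega> + 2 * (?Z \<omega> * (Y e \<omega> - Y b \<omega>)) \<partial>M)"
      using sqi[OF b(1) DM] by simp
    also have "\<dots> \<le> (\<integral>\<omega>. (Y e \<omega>)\<^sup>2 * indicator D \<omega> \<partial>M)"
    proof (rule integral_mono)
      show "integrable M (\<lambda>\<omega>. (Y b \<omega>)\<^sup>2 * indicator D \<omega> + 2 * (?Z \<omega> * (Y e \<omega> - Y b \<omega>)))"
        using sqi[OF b(1) DM] \<open>integrable M (\<lambda>\<omega>. ?Z \<omega> * (Y e \<omega> - Y b \<omega>))\<close>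
        by (intro Bochner_Integration.integrable_add integrable_mult_right)
      show "integrable M (\<lambda>\<omega>. (Y e \<omega>)\<^sup>2 * indicator D \<omega>)" by (rule sqi[OF e DM])
      fix \<omega>
      \<comment> \<open>Expanding \<open>Y e = Y b + (Y e - Y b)\<close>, the cross term has mean
        zero on \<open>D\<close> and the squared increment is dropped.\<close>
      have "0 \<le> (Y e \<omega> - Y b \<omega>)\<^sup>2" by simp
      then show "(Y b \<omega>)\<^sup>2 * indicator D \<omega> + 2 * (?Z \<omega> * (Y e \<omega> - Y b \<omega>)) \<le> (Y e \<omega>)\<^sup>2 * indicator D \<omega>"
        by (auto simp: indicator_def power2_eq_square algebra_simps)
    qed
    finally show ?thesis .
  qed
  have "c\<^sup>2 * prob (A \<union> D) = c\<^sup>2 * prob A + c\<^sup>2 * prob D"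
    using finite_measure_Union[OF AM DM sub(2)] by (simp add: distrib_left)
  also have "\<dots> \<le> (\<integral>\<omega>. (Y e \<omega>)\<^sup>2 * indicator A \<omega> \<partial>M) + (\<integral>\<omega>. (Y e \<omega>)\<^sup>2 * indicator D \<omega> \<partial>M)"
    using insert.IH insert.prems low up by (auto simp: A_def[symmetric])
  also have "\<dots> = (\<integral>\<omega>. (Y e \<omega>)\<^sup>2 * indicator (A \<union> D) \<omega> \<partial>M)"
    by (subst Bochner_Integration.integral_add[OF sqi[OF e AM] sqi[OF e DM], symmetric])
       (use sub(2) in \<open>auto intro!: Bochner_Integration.integral_cong simp: indicator_def\<close>)
  finally show ?case unfolding sub .
qed simp

text \<open>The events for finite subsets increase to the event for \<open>T\<close>, and the bound
  of the finite case does not depend on the subset. Countably many times keep the event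
  measurable.\<close>

lemma maximal_inequality:
  assumes Y: "\<And>u. s \<le> u \<Longrightarrow> Y u \<in> borel_measurable (F u)" "\<And>u. s \<le> u \<Longrightarrow> integrable M (\<lambda>\<omega>. (Y u \<omega>)\<^sup>2)"
    and orth: "\<And>u v Z. s \<le> u \<Longrightarrow> u \<le> v \<Longrightarrow> Z \<in> borel_measurable (F u) \<Longrightarrow> integrable M (\<lambda>\<omega>. (Z \<omega>)\<^sup>2) \<Longrightarrow>
      (\<integral>\<omega>. Z \<omega> * (Y v \<omega> - Y u \<omega>) \<partial>M) = 0"
    and s: "0 \<le> s" "s \<le> e" and T: "countable T" "T \<subseteq> {s..e}" and c: "(0::real) < c"
  shows "{\<omega>\<in>space M. \<exists>u\<in>T. \<bar>Y u \<omega>\<bar> > c} \<in> sets M"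
    and "c\<^sup>2 * prob {\<omega>\<in>space M. \<exists>u\<in>T. \<bar>Y u \<omega>\<bar> > c} \<le> (\<integral>\<omega>. (Y e \<omega>)\<^sup>2 \<partial>M)"
proof -
  have [measurable]: "Y u \<in> borel_measurable M" if "u \<in> T" for u
    using measurable_F_M[OF _ Y(1), of u] s T that by fastforce
  define E where "E U = {\<omega>\<in>space M. \<exists>u\<in>U. \<bar>Y u \<omega>\<bar> > c}" for U
  have E: "E U \<in> sets M" if "U \<subseteq> T" for U
  proof -
    have "countable U" using T(1) that countable_subset by blast
    have "E U = (\<Union>u\<in>U. {\<omega>\<in>space M. \<bar>Y u \<omega>\<bar> > c})" by (auto simp: E_def)
    also have "\<dots> \<in> sets M" using \<open>countable U\<close> that by (intro sets.countable_UN') auto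
    finally show ?thesis .
  qed
  then show "{\<omega>\<in>space M. \<exists>u\<in>T. \<bar>Y u \<omega>\<bar> > c} \<in> sets M" by (auto simp: E_def)
  have fin: "c\<^sup>2 * prob (E U) \<le> (\<integral>\<omega>. (Y e \<omega>)\<^sup>2 \<partial>M)" if "finite U" "U \<subseteq> T" for U
  proof -
    have "c\<^sup>2 * prob (E U) \<le> (\<integral>\<omega>. (Y e \<omega>)\<^sup>2 * indicator (E U) \<omega> \<partial>M)"
      unfolding E_def
      by (rule maximal_inequality_finite[OF Y orth s(1) that(1) _ c]) (use that T in auto)
    also have "\<dots> \<le> (\<integral>\<omega>. (Y e \<omega>)\<^sup>2 \<partial>M)"
      by (rule integral_mono)
         (use integrable_real_mult_indicator[OF E[OF that(2)] Y(2)[OF s(2)]] Y(2)[OF s(2)] in \<open>auto simp: indicator_def\<close>)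
    finally show ?thesis .
  qed
  show "c\<^sup>2 * prob {\<omega>\<in>space M. \<exists>u\<in>T. \<bar>Y u \<omega>\<bar> > c} \<le> (\<integral>\<omega>. (Y e \<omega>)\<^sup>2 \<partial>M)"
  proof (cases "T = {}")
    case True
    then show ?thesis by simp
  next
    case False
    define U where "U n = from_nat_into T ` {..n}" for n
    have U: "finite (U n)" "U n \<subseteq> T" for n using from_nat_into[OF False] by (auto simp: U_def)
    have "incseq (\<lambda>n. E (U n))"
      by (intro monoI) (auto simp: E_def U_def intro: order_trans)
    then have "(\<lambda>n. prob (E (U n))) \<longlonglongrightarrow> prob (\<Union>n. E (U n))"
      using E U(2) by (intro finite_Lim_measure_incseq) auto
    moreover have "(\<Union>n. E (U n)) = E T"
    proof
      show "E T \<subseteq> (\<Union>n. E (U n))"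
      proof
        fix \<omega> assume "\<omega> \<in> E T"
        then obtain u where u: "u \<in> T" "\<omega> \<in> space M" "\<bar>Y u \<omega>\<bar> > c" by (auto simp: E_def)
        then obtain n where "u = from_nat_into T n" using from_nat_into_surj[OF T(1) u(1)] by auto
        then have "\<omega> \<in> E (U n)" using u by (auto simp: E_def U_def)
        then show "\<omega> \<in> (\<Union>n. E (U n))" by blast
      qed
    qed (use U(2) in \<open>fastforce simp: E_def\<close>)
    ultimately have "(\<lambda>n. c\<^sup>2 * prob (E (U n))) \<longlonglongrightarrow> c\<^sup>2 * prob (E T)" by (intro tendsto_intros) simp
    then show ?thesis unfolding E_def[symmetric]
      by (rule LIMSEQ_le_const2) (use fin[OF U] in auto)
  qed
qed

end

section \<open>Lipschitz dependence on the law\<close>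

lemma L2_rvD:
  assumes "X \<in> L2_rv M"
  shows "X \<in> borel_measurable M" "integrable M (\<lambda>\<omega>. (norm (X \<omega>))\<^sup>2)"
  using assms by (auto simp: L2_rv_def)

lemma norm_add_square_le: "(norm (a + b))\<^sup>2 \<le> 2 * (norm a)\<^sup>2 + 2 * (norm b)\<^sup>2"
  for a b :: "'a::real_normed_vector"
proof -
  have "(norm (a + b))\<^sup>2 \<le> (norm a + norm b)\<^sup>2" by (intro power_mono norm_triangle_ineq) simp
  also have "\<dots> \<le> 2 * (norm a)\<^sup>2 + 2 * (norm b)\<^sup>2"
    using zero_le_power2[of "norm a - norm b"] by (simp add: power2_sum power2_diff)
  finally show ?thesis .
qed

lemma L2_rv_add:
  assumes "X \<in> L2_rv M" "Y \<in> L2_rv M"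
  shows "(\<lambda>\<omega>. X \<omega> + Y \<omega>) \<in> L2_rv M"
proof -
  note [measurable] = L2_rvD(1)[OF assms(1)] L2_rvD(1)[OF assms(2)]
  have "integrable M (\<lambda>\<omega>. (norm (X \<omega> + Y \<omega>))\<^sup>2)"
    by (rule Bochner_Integration.integrable_bound[where f = "\<lambda>\<omega>. 2 * (norm (X \<omega>))\<^sup>2 + 2 * (norm (Y \<omega>))\<^sup>2"])
       (use L2_rvD(2)[OF assms(1)] L2_rvD(2)[OF assms(2)] norm_add_square_le in auto)
  then show ?thesis by (simp add: L2_rv_def)
qed

lemma L2_rv_scaleR: "X \<in> L2_rv M \<Longrightarrow> (\<lambda>\<omega>. c *\<^sub>R X \<omega>) \<in> L2_rv M"
  by (auto simp: L2_rv_def power_mult_distrib)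

lemma L2_rv_diff:
  assumes "X \<in> L2_rv M" "Y \<in> L2_rv M"
  shows "(\<lambda>\<omega>. X \<omega> - Y \<omega>) \<in> L2_rv M"
  using L2_rv_add[OF assms(1) L2_rv_scaleR[OF assms(2), of "-1"]] by simp

lemma L2_rv_norm_scaleR: "L2_rv_norm M (\<lambda>\<omega>. c *\<^sub>R X \<omega>) = \<bar>c\<bar> * L2_rv_norm M X"
  by (simp add: L2_rv_norm_def power_mult_distrib real_sqrt_mult)

lemma L2_rv_norm_nonneg: "0 \<le> L2_rv_norm M X"
  by (simp add: L2_rv_norm_def)

lemma L2_rv_norm_square: "(L2_rv_norm M X)\<^sup>2 = (\<integral>\<omega>. (norm (X \<omega>))\<^sup>2 \<partial>M)"
  by (simp add: L2_rv_norm_def)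

lemma (in prob_space) L2_rv_bounded_perturbation:
  assumes "X \<in> L2_rv M" "Y \<in> borel_measurable M" "\<And>\<omega>. norm (Y \<omega> - X \<omega>) \<le> \<epsilon>"
  shows "Y \<in> L2_rv M" "L2_rv_norm M (\<lambda>\<omega>. X \<omega> - Y \<omega>) \<le> \<epsilon>"
proof -
  note [measurable] = L2_rvD(1)[OF assms(1)] assms(2)
  have e: "0 \<le> \<epsilon>" using assms(3) norm_ge_zero order_trans by blast
  have i: "integrable M (\<lambda>\<omega>. (norm (Y \<omega> - X \<omega>))\<^sup>2)"
    by (rule integrable_const_bound[where B = "\<epsilon>\<^sup>2"]) (use power_mono[OF assms(3) norm_ge_zero, of _ 2] in auto)
  then have "(\<lambda>\<omega>. Y \<omega> - X \<omega>) \<in> L2_rv M" by (simp add: L2_rv_def)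
  from L2_rv_add[OF this assms(1)] show "Y \<in> L2_rv M" by simp
  have "(\<integral>\<omega>. (norm (Y \<omega> - X \<omega>))\<^sup>2 \<partial>M) \<le> (\<integral>\<omega>. \<epsilon>\<^sup>2 \<partial>M)"
    by (rule integral_mono[OF i]) (use power_mono[OF assms(3) norm_ge_zero, of _ 2] in auto)
  then have "L2_rv_norm M (\<lambda>\<omega>. X \<omega> - Y \<omega>) \<le> sqrt (\<epsilon>\<^sup>2)"
    unfolding L2_rv_norm_def by (intro real_sqrt_le_mono) (simp add: prob_space norm_minus_commute)
  then show "L2_rv_norm M (\<lambda>\<omega>. X \<omega> - Y \<omega>) \<le> \<epsilon>" using e by simp
qed

text \<open>The variance of \<open>norm (X \<omega>)\<close> is nonnegative.\<close>

lemma (in prob_space) L1_le_L2_rv_norm: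
  assumes "X \<in> L2_rv M"
  shows "integrable M (\<lambda>\<omega>. norm (X \<omega>))" "(\<integral>\<omega>. norm (X \<omega>) \<partial>M) \<le> L2_rv_norm M X"
proof -
  note [measurable] = L2_rvD(1)[OF assms]
  note sq = L2_rvD(2)[OF assms]
  show i: "integrable M (\<lambda>\<omega>. norm (X \<omega>))"
    by (rule square_integrable_imp_integrable) (use sq in auto)
  have "0 \<le> variance (\<lambda>\<omega>. norm (X \<omega>))" by (rule variance_positive)
  then have "(\<integral>\<omega>. norm (X \<omega>) \<partial>M)\<^sup>2 \<le> (\<integral>\<omega>. (norm (X \<omega>))\<^sup>2 \<partial>M)"
    using variance_eq[OF i sq] by simp
  then show "(\<integral>\<omega>. norm (X \<omega>) \<partial>M) \<le> L2_rv_norm M X"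
    unfolding L2_rv_norm_def by (rule real_le_rsqrt)
qed

lemma (in prob_space) distr_in_P2:
  assumes "X \<in> L2_rv M"
  shows "distr M borel X \<in> P2"
proof -
  note [measurable] = L2_rvD(1)[OF assms]
  show ?thesis
    using L2_rvD(2)[OF assms] by (auto simp: P2_def prob_space_distr integrable_distr_eq)
qed

lemma L2_rv_of_distr_in_P2:
  assumes [measurable]: "v \<in> borel_measurable L" and "distr L borel v \<in> P2"
  shows "v \<in> L2_rv L"
  using assms(2) by (simp add: P2_def L2_rv_def integrable_distr_eq)

lemma mat_norm_nonneg: "0 \<le> mat_norm A"
  unfolding mat_norm_def by (rule onorm_pos_le) simp

text \<open>Applied to its own i-th row, the matrix produces the squared length of that row as i-th
  component. This converts the operator norm bound into bounds for the Lions derivatives of the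
  components.\<close>

lemma norm_row_le_mat_norm: "norm (A $ i) \<le> mat_norm A"
  for A :: "real^'n^'n"
proof -
  have "(norm (A $ i))\<^sup>2 = (A *v (A $ i)) $ i"
    by (simp add: matrix_vector_mul_component power2_norm_eq_inner)
  also have "\<dots> \<le> norm (A *v (A $ i))"
    using component_le_norm_cart[of "A *v (A $ i)" i] by simp
  also have "\<dots> \<le> mat_norm A * norm (A $ i)"
    unfolding mat_norm_def by (rule onorm) simp
  finally have "norm (A $ i) * norm (A $ i) \<le> mat_norm A * norm (A $ i)"
    by (simp add: power2_eq_square)
  then show ?thesis
    using mat_norm_nonneg[of A] by (cases "norm (A $ i) = 0") (auto simp: mult_le_cancel_right)
qed

text \<open>Along the segment from \<open>v\<close> to \<open>w\<close> the lift is a real function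
  of the parameter s, with derivative the expectation of g(u_s) against the direction h. This is at
  most K E|h|, hence at most K times the L^2 norm of h, and the mean value inequality
  concludes.\<close>

lemma lions_lipschitz_on_carrier:
  fixes v w :: "'l \<Rightarrow> 'a::euclidean_space"
  assumes L: "prob_space L" and v: "v \<in> L2_rv L" and w: "w \<in> L2_rv L"
    and der: "\<And>u. u \<in> L2_rv L \<Longrightarrow> has_lions_derivative L f (g u) u"
    and bound: "\<And>u y. u \<in> L2_rv L \<Longrightarrow> norm (g u y) \<le> K"
  shows "\<bar>f (distr L borel w) - f (distr L borel v)\<bar> \<le> K * L2_rv_norm L (\<lambda>\<omega>. w \<omega> - v \<omega>)"
proof -
  interpret L: prob_space L by (rule L)
  define h where "h \<omega> = w \<omega> - v \<omega>" for \<omega>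
  have h: "h \<in> L2_rv L" unfolding h_def[abs_def] by (rule L2_rv_diff[OF w v])
  define u where "u s \<omega> = v \<omega> + s *\<^sub>R h \<omega>" for s \<omega>
  have u: "u s \<in> L2_rv L" for s
    unfolding u_def[abs_def] by (rule L2_rv_add[OF v L2_rv_scaleR[OF h]])
  define \<phi> where "\<phi> s = f (distr L borel (u s))" for s
  define c where "c s = (\<integral>\<omega>. g (u s) (u s \<omega>) \<bullet> h \<omega> \<partial>L)" for s
  define H where "H = L2_rv_norm L h"
  have H: "0 \<le> H" by (simp add: H_def L2_rv_norm_nonneg)
  have K: "0 \<le> K" using bound[OF v] norm_ge_zero order_trans by blast
  have c: "\<bar>c s\<bar> \<le> K * H" for s
  proof -
    have "\<bar>c s\<bar> \<le> (\<integral>\<omega>. \<bar>g (u s) (u s \<omega>) \<bullet> h \<omega>\<bar> \<partial>L)" unfolding c_def by (rule integral_abs_bound)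
    also have "\<dots> \<le> (\<integral>\<omega>. K * norm (h \<omega>) \<partial>L)"
    proof (rule Bochner_Integration.integral_mono')
      show "integrable L (\<lambda>\<omega>. K * norm (h \<omega>))" using L.L1_le_L2_rv_norm(1)[OF h] by simp
      show "\<bar>g (u s) (u s \<omega>) \<bullet> h \<omega>\<bar> \<le> K * norm (h \<omega>)" for \<omega>
        using Cauchy_Schwarz_ineq2[of "g (u s) (u s \<omega>)" "h \<omega>"] bound[OF u, of s "u s \<omega>"]
        by (meson mult_right_mono norm_ge_zero order_trans)
    qed (use K in auto)
    also have "\<dots> \<le> K * H" using L.L1_le_L2_rv_norm(2)[OF h] K by (simp add: H_def mult_left_mono)
    finally show ?thesis .
  qed
  have "(\<phi> has_derivative (\<lambda>r. r * c s)) (at s within {0..1})" for s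
    unfolding has_derivative_within_alt
  proof (intro conjI allI impI)
    show "bounded_linear (\<lambda>r. r * c s)" by (rule bounded_linear_mult_left)
    fix e :: real assume e: "0 < e"
    \<comment> \<open>Adding 1 avoids a division by zero when the direction vanishes almost
      surely.\<close>
    define \<epsilon> where "\<epsilon> = e / (H + 1)"
    have \<epsilon>: "\<epsilon> > 0" "\<epsilon> * H \<le> e" using e H by (auto simp: \<epsilon>_def field_simps)
    from der[OF u, of s] \<epsilon>(1) obtain \<delta> where \<delta>: "\<delta> > 0"
      and D: "\<And>k. k \<in> L2_rv L \<Longrightarrow> L2_rv_norm L k < \<delta> \<Longrightarrow>
        \<bar>f (distr L borel (\<lambda>\<omega>. u s \<omega> + k \<omega>)) - f (distr L borel (u s)) - (\<integral>\<omega>. g (u s) (u s \<omega>) \<bullet> k \<omega> \<partial>L)\<bar> \<le> \<epsilon> * L2_rv_norm L k"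
      unfolding has_lions_derivative_def by blast
    show "\<exists>d>0. \<forall>y\<in>{0..1}. norm (y - s) < d \<longrightarrow> norm (\<phi> y - \<phi> s - (y - s) * c s) \<le> e * norm (y - s)"
    proof (intro exI[of _ "\<delta> / (H + 1)"] conjI ballI impI)
      show "0 < \<delta> / (H + 1)" using \<delta> H by simp
      fix y :: real assume "norm (y - s) < \<delta> / (H + 1)"
      then have y: "\<bar>y - s\<bar> * (H + 1) < \<delta>" using H by (simp add: field_simps)
      define k where "k \<omega> = (y - s) *\<^sub>R h \<omega>" for \<omega>
      have k: "k \<in> L2_rv L" unfolding k_def[abs_def] by (rule L2_rv_scaleR[OF h])
      have kn: "L2_rv_norm L k = \<bar>y - s\<bar> * H" by (simp add: k_def[abs_def] L2_rv_norm_scaleR H_def)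
      also have "\<dots> \<le> \<bar>y - s\<bar> * (H + 1)" by (simp add: distrib_left)
      finally have "L2_rv_norm L k < \<delta>" using y by simp
      from D[OF k this] have "\<bar>f (distr L borel (\<lambda>\<omega>. u s \<omega> + k \<omega>)) - \<phi> s - (y - s) * c s\<bar> \<le> \<epsilon> * (\<bar>y - s\<bar> * H)"
        unfolding kn \<phi>_def c_def by (simp add: k_def)
      moreover have "(\<lambda>\<omega>. u s \<omega> + k \<omega>) = u y" by (auto simp: fun_eq_iff u_def k_def algebra_simps)
      ultimately have "\<bar>\<phi> y - \<phi> s - (y - s) * c s\<bar> \<le> (\<epsilon> * H) * \<bar>y - s\<bar>"
        by (simp add: \<phi>_def ac_simps)
      also have "\<dots> \<le> e * \<bar>y - s\<bar>" using \<epsilon>(2) by (rule mult_right_mono) simp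
      finally show "norm (\<phi> y - \<phi> s - (y - s) * c s) \<le> e * norm (y - s)" by simp
    qed
  qed
  then have "norm (\<phi> 1 - \<phi> 0) \<le> (K * H) * norm (1 - 0 :: real)"
  proof (rule differentiable_bound[of "{0..1::real}", rotated])
    show "onorm (\<lambda>r. r * c s) \<le> K * H" for s
      by (rule onorm_le) (use mult_right_mono[OF c abs_ge_zero] in \<open>simp add: abs_mult mult.commute\<close>)
  qed auto
  moreover have "u 1 = w" "u 0 = v" by (auto simp: fun_eq_iff u_def h_def)
  ultimately show ?thesis by (simp add: \<phi>_def H_def h_def[abs_def])
qed

text \<open>The variable \<open>1 / (1 + k)\<close> is bounded, so its law lies in \<open>P2\<close> and is carried by \<open>L\<close>;
  decoding it shows that \<open>L\<close> carries every law on the natural numbers.\<close>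

lemma carries_P2_nat:
  fixes L :: "'l measure" and M :: "'w measure" and k :: "'w \<Rightarrow> nat"
  assumes L: "carries_P2 L TYPE('a::euclidean_space)" and M: "prob_space M"
    and k[measurable]: "k \<in> measurable M (count_space UNIV)"
  obtains k' where "k' \<in> measurable L (count_space UNIV)"
    "distr L (count_space UNIV) k' = distr M (count_space UNIV) k"
proof -
  interpret M: prob_space M by (rule M)
  obtain b :: 'a where b: "b \<in> Basis" using nonempty_Basis by blast
  define Z where "Z \<omega> = (1 / (1 + real (k \<omega>))) *\<^sub>R b" for \<omega>
  define dec where "dec z = nat \<lfloor>1 / (z \<bullet> b) - 1\<rfloor>" for z :: 'a
  have dec[measurable]: "dec \<in> measurable borel (count_space UNIV)"
    unfolding dec_def[abs_def] by measurable
  have Z[measurable]: "Z \<in> borel_measurable M" unfolding Z_def[abs_def] by measurable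
  have "Z \<in> L2_rv M"
    unfolding L2_rv_def
    by (auto intro!: M.integrable_const_bound[where B = 1] AE_I2 power_le_one simp: Z_def b)
  then have "distr M borel Z \<in> P2" by (rule M.distr_in_P2)
  with L obtain v where v[measurable]: "v \<in> borel_measurable L" "distr L borel v = distr M borel Z"
    unfolding carries_P2_def by blast
  have dZ: "dec (Z \<omega>) = k \<omega>" for \<omega> using b by (simp add: dec_def Z_def)
  have "distr L (count_space UNIV) (dec \<circ> v) = distr (distr L borel v) (count_space UNIV) dec"
    by (simp add: distr_distr)
  also have "\<dots> = distr M (count_space UNIV) (dec \<circ> Z)" unfolding v by (simp add: distr_distr)
  also have "dec \<circ> Z = k" using dZ by auto
  finally show ?thesis by (intro that[of "dec \<circ> v"]) (auto simp: comp_def)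
qed

text \<open>The index is the least one of a dense sequence that comes within \<epsilon>; taking the
  least makes the choice Borel measurable.\<close>

lemma countable_discretization:
  fixes \<epsilon> :: real
  assumes "0 < \<epsilon>"
  obtains q :: "'a::{metric_space, second_countable_topology} \<Rightarrow> nat" and d :: "nat \<Rightarrow> 'a"
  where "q \<in> measurable borel (count_space UNIV)" "\<And>x. dist (d (q x)) x < \<epsilon>"
proof -
  obtain D :: "'a set" where D: "countable D" "\<And>X. open X \<Longrightarrow> X \<noteq> {} \<Longrightarrow> \<exists>d\<in>D. d \<in> X"
    using countable_dense_exists by metis
  have "D \<noteq> {}" using D(2)[of UNIV] by auto
  define d where "d = from_nat_into D"
  define q where "q x = (LEAST k. dist (d k) x < \<epsilon>)" for x
  have [measurable]: "q \<in> measurable borel (count_space UNIV)"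
    unfolding q_def[abs_def] by measurable
  have "dist (d (q x)) x < \<epsilon>" for x
  proof -
    obtain y where "y \<in> D" "y \<in> ball x \<epsilon>" using D(2)[of "ball x \<epsilon>"] assms by auto
    then have "\<exists>k. dist (d k) x < \<epsilon>"
      using from_nat_into_surj[OF D(1)] by (metis d_def dist_commute mem_ball)
    then show ?thesis unfolding q_def by (rule LeastI_ex)
  qed
  then show ?thesis by (intro that[of q d]) auto
qed

text \<open>The obstacle is that the hypothesis compares pairs on \<open>L\<close>, whereas
  \<open>L\<close> need not carry the joint law of \<open>X\<close> and \<open>Y\<close>. The
  rounded pair takes countably many values, so its joint law is carried. Each rounding error
  concerns one law only and is estimated on \<open>L\<close> from a copy of that law.\<close>

lemma law_lipschitz_transfer:
  fixes f :: "'a::euclidean_space measure \<Rightarrow> real"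
  assumes L: "carries_P2 L TYPE('a)" and M: "prob_space M" and K: "0 \<le> K"
    and lip: "\<And>v w. v \<in> L2_rv L \<Longrightarrow> w \<in> L2_rv L \<Longrightarrow>
      \<bar>f (distr L borel w) - f (distr L borel v)\<bar> \<le> K * L2_rv_norm L (\<lambda>\<omega>. w \<omega> - v \<omega>)"
    and X: "X \<in> L2_rv M" and Y: "Y \<in> L2_rv M"
  shows "\<bar>f (distr M borel X) - f (distr M borel Y)\<bar> \<le> K * L2_rv_norm M (\<lambda>\<omega>. X \<omega> - Y \<omega>)"
proof -
  interpret M: prob_space M by (rule M)
  interpret L: prob_space L using L by (simp add: carries_P2_def)
  note [measurable] = L2_rvD(1)[OF X] L2_rvD(1)[OF Y]
  define N where "N = L2_rv_norm M (\<lambda>\<omega>. X \<omega> - Y \<omega>)"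
  have N: "0 \<le> N" by (simp add: N_def L2_rv_norm_nonneg)
  \<comment> \<open>The excess consists of \<open>K * \<epsilon>\<close> for each of the two
    roundings and \<open>2 * K * \<epsilon>\<close> because the rounded variables may be farther
    apart by \<open>2 * \<epsilon>\<close>.\<close>
  have main: "\<bar>f (distr M borel X) - f (distr M borel Y)\<bar> \<le> K * N + 4 * K * \<epsilon>" if \<epsilon>: "0 < \<epsilon>" for \<epsilon>
  proof -
    obtain q :: "'a \<Rightarrow> nat" and d where q[measurable]: "q \<in> measurable borel (count_space UNIV)"
      and d: "\<And>x. dist (d (q x)) x < \<epsilon>"
      by (rule countable_discretization[OF \<epsilon>]) blast
    have d': "norm (d (q x) - x) \<le> \<epsilon>" for x using d[of x] by (simp add: dist_norm)
    \<comment> \<open>Rounding is a function of the value, so rounding a copy \<open>v\<close> of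
      \<open>W\<close> on \<open>L\<close> gives a copy of the rounded \<open>W\<close> at distance
      at most \<epsilon> from \<open>v\<close>.\<close>
    have approx: "\<bar>f (distr M borel (\<lambda>\<omega>. d (q (W \<omega>)))) - f (distr M borel W)\<bar> \<le> K * \<epsilon>"
      if W: "W \<in> L2_rv M" for W
    proof -
      note [measurable] = L2_rvD(1)[OF W]
      obtain v where v[measurable]: "v \<in> borel_measurable L" and v': "distr L borel v = distr M borel W"
        using L M.distr_in_P2[OF W] unfolding carries_P2_def by blast
      have vL: "v \<in> L2_rv L"
        by (rule L2_rv_of_distr_in_P2[OF v]) (simp add: v' M.distr_in_P2[OF W])
      have "(\<lambda>\<omega>. d (q (v \<omega>))) \<in> borel_measurable L" by measurable
      note p = L.L2_rv_bounded_perturbation[OF vL this d']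
      have "distr L borel (\<lambda>\<omega>. d (q (v \<omega>))) = distr (distr L borel v) borel (\<lambda>x. d (q x))"
        by (simp add: distr_distr comp_def)
      also have "\<dots> = distr M borel (\<lambda>\<omega>. d (q (W \<omega>)))"
        unfolding v' by (simp add: distr_distr comp_def)
      finally have "\<bar>f (distr M borel W) - f (distr M borel (\<lambda>\<omega>. d (q (W \<omega>))))\<bar> \<le> K * L2_rv_norm L (\<lambda>\<omega>. v \<omega> - d (q (v \<omega>)))"
        using lip[OF p(1) vL] v' by simp
      also have "\<dots> \<le> K * \<epsilon>" using p(2) K by (rule mult_left_mono)
      finally show ?thesis by (simp add: abs_minus_commute)
    qed
    \<comment> \<open>One natural number holds both rounded values; a copy of it on \<open>L\<close>
      therefore reproduces their joint law, and hence their mean square distance.\<close>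
    define k where "k \<omega> = prod_encode (q (X \<omega>), q (Y \<omega>))" for \<omega>
    have k: "k \<in> measurable M (count_space UNIV)" unfolding k_def[abs_def] by measurable
    then obtain k' where k': "k' \<in> measurable L (count_space UNIV)"
      "distr L (count_space UNIV) k' = distr M (count_space UNIV) k"
      using carries_P2_nat[OF L M] by metis
    note [measurable] = k k'(1)
    define F where "F j = d (fst (prod_decode j))" for j
    define G where "G j = d (snd (prod_decode j))" for j
    have Fk: "F (k \<omega>) = d (q (X \<omega>))" and Gk: "G (k \<omega>) = d (q (Y \<omega>))" for \<omega>
      by (auto simp: F_def G_def k_def)
    have law: "distr L borel (\<lambda>\<omega>. A (k' \<omega>)) = distr M borel (\<lambda>\<omega>. A (k \<omega>))" for A :: "nat \<Rightarrow> 'a"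
    proof -
      have "distr L borel (\<lambda>\<omega>. A (k' \<omega>)) = distr (distr L (count_space UNIV) k') borel A"
        by (simp add: distr_distr comp_def)
      also have "\<dots> = distr M borel (\<lambda>\<omega>. A (k \<omega>))"
        unfolding k'(2) by (simp add: distr_distr comp_def)
      finally show ?thesis .
    qed
    have XF: "(\<lambda>\<omega>. F (k \<omega>)) \<in> L2_rv M" and YG: "(\<lambda>\<omega>. G (k \<omega>)) \<in> L2_rv M"
      unfolding Fk Gk
      by (rule M.L2_rv_bounded_perturbation(1)[OF X _ d'] M.L2_rv_bounded_perturbation(1)[OF Y _ d'], measurable)+
    have XF': "(\<lambda>\<omega>. F (k' \<omega>)) \<in> L2_rv L" and YG': "(\<lambda>\<omega>. G (k' \<omega>)) \<in> L2_rv L"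
      by (rule L2_rv_of_distr_in_P2, measurable, unfold law, rule M.distr_in_P2[OF XF] M.distr_in_P2[OF YG])+
    have "(\<integral>\<omega>. (norm (F (k' \<omega>) - G (k' \<omega>)))\<^sup>2 \<partial>L) = (\<integral>x. (norm x)\<^sup>2 \<partial>distr L borel (\<lambda>\<omega>. F (k' \<omega>) - G (k' \<omega>)))"
      by (simp add: integral_distr)
    also have "\<dots> = (\<integral>\<omega>. (norm (F (k \<omega>) - G (k \<omega>)))\<^sup>2 \<partial>M)"
      unfolding law[of "\<lambda>j. F j - G j"] by (simp add: integral_distr)
    finally have n: "L2_rv_norm L (\<lambda>\<omega>. F (k' \<omega>) - G (k' \<omega>)) = L2_rv_norm M (\<lambda>\<omega>. F (k \<omega>) - G (k \<omega>))"
      by (simp add: L2_rv_norm_def)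
    have XY: "(\<lambda>\<omega>. X \<omega> - Y \<omega>) \<in> L2_rv M" by (rule L2_rv_diff[OF X Y])
    note XY1 = M.L1_le_L2_rv_norm[OF XY]
    \<comment> \<open>The square of |X - Y| + 2 \<epsilon> is integrated term by term; with the L^1
      norm bounded by the L^2 norm the result is a perfect square again.\<close>
    have "(\<integral>\<omega>. (norm (F (k \<omega>) - G (k \<omega>)))\<^sup>2 \<partial>M) \<le> (\<integral>\<omega>. (norm (X \<omega> - Y \<omega>))\<^sup>2 + (4 * \<epsilon> * norm (X \<omega> - Y \<omega>) + 4 * \<epsilon>\<^sup>2) \<partial>M)"
    proof (rule integral_mono)
      show "integrable M (\<lambda>\<omega>. (norm (F (k \<omega>) - G (k \<omega>)))\<^sup>2)"
        using L2_rv_diff[OF XF YG] by (simp add: L2_rv_def)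
      show "integrable M (\<lambda>\<omega>. (norm (X \<omega> - Y \<omega>))\<^sup>2 + (4 * \<epsilon> * norm (X \<omega> - Y \<omega>) + 4 * \<epsilon>\<^sup>2))"
        using L2_rvD(2)[OF XY] XY1(1) by simp
      fix \<omega>
      have "norm (F (k \<omega>) - G (k \<omega>)) \<le> norm (X \<omega> - Y \<omega>) + 2 * \<epsilon>"
        unfolding Fk Gk using d'[of "X \<omega>"] d'[of "Y \<omega>"]
          norm_triangle_ineq[of "X \<omega> - Y \<omega>" "(d (q (X \<omega>)) - X \<omega>) - (d (q (Y \<omega>)) - Y \<omega>)"]
          norm_triangle_ineq4[of "d (q (X \<omega>)) - X \<omega>" "d (q (Y \<omega>)) - Y \<omega>"]
        by (simp add: algebra_simps)
      then have "(norm (F (k \<omega>) - G (k \<omega>)))\<^sup>2 \<le> (norm (X \<omega> - Y \<omega>) + 2 * \<epsilon>)\<^sup>2"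
        by (intro power_mono) auto
      then show "(norm (F (k \<omega>) - G (k \<omega>)))\<^sup>2 \<le> (norm (X \<omega> - Y \<omega>))\<^sup>2 + (4 * \<epsilon> * norm (X \<omega> - Y \<omega>) + 4 * \<epsilon>\<^sup>2)"
        by (simp add: power2_sum power_mult_distrib algebra_simps)
    qed
    also have "\<dots> = N\<^sup>2 + (4 * \<epsilon> * (\<integral>\<omega>. norm (X \<omega> - Y \<omega>) \<partial>M) + 4 * \<epsilon>\<^sup>2)"
      using L2_rvD(2)[OF XY] XY1(1) by (simp add: N_def L2_rv_norm_square M.prob_space)
    also have "\<dots> \<le> N\<^sup>2 + (4 * \<epsilon> * N + 4 * \<epsilon>\<^sup>2)"
      using XY1(2) \<epsilon> by (simp add: N_def)
    also have "\<dots> = (N + 2 * \<epsilon>)\<^sup>2" by (simp add: power2_sum power_mult_distrib)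
    finally have "L2_rv_norm M (\<lambda>\<omega>. F (k \<omega>) - G (k \<omega>)) \<le> sqrt ((N + 2 * \<epsilon>)\<^sup>2)"
      unfolding L2_rv_norm_def by (rule real_sqrt_le_mono)
    then have nb: "L2_rv_norm M (\<lambda>\<omega>. F (k \<omega>) - G (k \<omega>)) \<le> N + 2 * \<epsilon>" using N \<epsilon> by simp
    have "\<bar>f (distr M borel (\<lambda>\<omega>. F (k \<omega>))) - f (distr M borel (\<lambda>\<omega>. G (k \<omega>)))\<bar> \<le> K * L2_rv_norm M (\<lambda>\<omega>. F (k \<omega>) - G (k \<omega>))"
      using lip[OF YG' XF'] unfolding law n .
    also have "\<dots> \<le> K * (N + 2 * \<epsilon>)" using nb K by (rule mult_left_mono)
    finally show ?thesis
      unfolding Fk Gk using approx[OF X] approx[OF Y] by (simp add: distrib_left)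
  qed
  have "\<bar>f (distr M borel X) - f (distr M borel Y)\<bar> \<le> K * N"
  proof (rule field_le_epsilon)
    fix e :: real assume e: "0 < e"
    define \<epsilon> where "\<epsilon> = e / (4 * K + 1)"
    have "0 < \<epsilon>" "4 * K * \<epsilon> \<le> e" using e K by (auto simp: \<epsilon>_def field_simps)
    then show "\<bar>f (distr M borel X) - f (distr M borel Y)\<bar> \<le> K * N + e"
      using main[of \<epsilon>] by simp
  qed
  then show ?thesis by (simp add: N_def)
qed

text \<open>The mean value inequality is used in the space variable with the law fixed, and along
  laws with the point fixed. The dependence on the law is measured by the L^2 distance of a given
  pair on \<open>M\<close>, which is the quantity that two solutions supply.\<close>

lemma C11_b_Lip_imp_lipschitz:
  fixes V :: "real^'n \<Rightarrow> (real^'n) measure \<Rightarrow> real^'n" and L :: "'l measure" and M :: "'w measure"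
  assumes L: "carries_P2 L TYPE(real^'n)" and V: "C11_b_Lip L V" and M: "prob_space M"
  obtains K where "0 < K"
    "\<And>x y X Y. X \<in> L2_rv M \<Longrightarrow> Y \<in> L2_rv M \<Longrightarrow>
      norm (V x (distr M borel X) - V y (distr M borel Y)) \<le> K * (norm (x - y) + L2_rv_norm M (\<lambda>\<omega>. X \<omega> - Y \<omega>))"
proof -
  interpret M: prob_space M by (rule M)
  have Lp: "prob_space L" using L by (simp add: carries_P2_def)
  interpret L: prob_space L by (rule Lp)
  from V obtain DX :: "real^'n \<Rightarrow> (real^'n) measure \<Rightarrow> real^'n^'n"
    and DM :: "real^'n \<Rightarrow> (real^'n) measure \<Rightarrow> real^'n \<Rightarrow> real^'n^'n" and K
    where *: "K > 0"
      "\<forall>x. \<forall>\<mu>\<in>P2. ((\<lambda>y. V y \<mu>) has_derivative (\<lambda>h. DX x \<mu> *v h)) (at x)"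
      "\<forall>x. \<forall>v\<in>L2_rv L. \<forall>i. has_lions_derivative L (\<lambda>\<mu>. V x \<mu> $ i) (\<lambda>y. DM x (distr L borel v) y $ i) v"
      "\<forall>x v. \<forall>\<mu>\<in>P2. mat_norm (DX x \<mu>) + mat_norm (DM x \<mu> v) \<le> K"
    unfolding C11_b_Lip_def by (elim exE conjE) (rule that, assumption+)
  have K: "K > 0"
    and DX: "\<And>x \<mu>. \<mu> \<in> P2 \<Longrightarrow> ((\<lambda>y. V y \<mu>) has_derivative (\<lambda>h. DX x \<mu> *v h)) (at x)"
    and DM: "\<And>x v i. v \<in> L2_rv L \<Longrightarrow> has_lions_derivative L (\<lambda>\<mu>. V x \<mu> $ i) (\<lambda>y. DM x (distr L borel v) y $ i) v"
    and b: "\<And>x v \<mu>. \<mu> \<in> P2 \<Longrightarrow> mat_norm (DX x \<mu>) + mat_norm (DM x \<mu> v) \<le> K"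
    using * by blast+
  have space_lip: "norm (V x \<mu> - V y \<mu>) \<le> K * norm (x - y)" if \<mu>: "\<mu> \<in> P2" for x y \<mu>
  proof (rule differentiable_bound[of UNIV "\<lambda>y. V y \<mu>" "\<lambda>x h. DX x \<mu> *v h"])
    show "onorm (\<lambda>h. DX z \<mu> *v h) \<le> K" for z
      using b[OF \<mu>, of z 0] mat_norm_nonneg[of "DM z \<mu> 0"] by (simp add: mat_norm_def)
  qed (use DX[OF \<mu>] in auto)
  have law_lip: "\<bar>V x (distr M borel X) $ i - V x (distr M borel Y) $ i\<bar> \<le> K * L2_rv_norm M (\<lambda>\<omega>. X \<omega> - Y \<omega>)"
    if "X \<in> L2_rv M" "Y \<in> L2_rv M" for x X Y i
  proof (rule law_lipschitz_transfer[OF L M _ _ that])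
    show "\<bar>V x (distr L borel w) $ i - V x (distr L borel v) $ i\<bar> \<le> K * L2_rv_norm L (\<lambda>\<omega>. w \<omega> - v \<omega>)"
      if vw: "v \<in> L2_rv L" "w \<in> L2_rv L" for v w
    proof (rule lions_lipschitz_on_carrier[OF Lp vw, where f = "\<lambda>\<mu>. V x \<mu> $ i" and g = "\<lambda>u y. DM x (distr L borel u) y $ i"])
      show "norm (DM x (distr L borel u) y $ i) \<le> K" if u: "u \<in> L2_rv L" for u y
        using norm_row_le_mat_norm[of "DM x (distr L borel u) y" i] b[OF L.distr_in_P2[OF u], of x y]
          mat_norm_nonneg[of "DX x (distr L borel u)"] by linarith
    qed (rule DM)
  qed (use K in auto)
  show ?thesis
  \<comment> \<open>Lions derivatives are taken component by component; summing the component bounds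
    costs the dimension as a factor.\<close>
  proof (rule that[of "K * (1 + real CARD('n))"])
    show "0 < K * (1 + real CARD('n))" using K by (intro mult_pos_pos) auto
    fix x y and X Y :: "'w \<Rightarrow> real^'n"
    assume XY: "X \<in> L2_rv M" "Y \<in> L2_rv M"
    define N where "N = L2_rv_norm M (\<lambda>\<omega>. X \<omega> - Y \<omega>)"
    have N: "0 \<le> N" by (simp add: N_def L2_rv_norm_nonneg)
    have "norm (V y (distr M borel X) - V y (distr M borel Y)) \<le>
       (\<Sum>i\<in>UNIV. \<bar>(V y (distr M borel X) - V y (distr M borel Y)) $ i\<bar>)" by (rule norm_le_l1_cart)
    also have "\<dots> \<le> (\<Sum>i\<in>(UNIV::'n set). K * N)"
      unfolding N_def by (intro sum_mono) (use law_lip[OF XY] in simp)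
    finally have 1: "norm (V y (distr M borel X) - V y (distr M borel Y)) \<le> real CARD('n) * (K * N)" by simp
    have 2: "norm (V x (distr M borel X) - V y (distr M borel X)) \<le> K * norm (x - y)"
      by (rule space_lip[OF M.distr_in_P2[OF XY(1)]])
    have "norm (V x (distr M borel X) - V y (distr M borel Y)) \<le> K * norm (x - y) + real CARD('n) * (K * N)"
      using 1 2 norm_triangle_ineq[of "V x (distr M borel X) - V y (distr M borel X)" "V y (distr M borel X) - V y (distr M borel Y)"]
      by simp
    also have "\<dots> \<le> K * (1 + real CARD('n)) * (norm (x - y) + N)"
      using K N by (simp add: algebra_simps)
    finally show "norm (V x (distr M borel X) - V y (distr M borel Y)) \<le>
        K * (1 + real CARD('n)) * (norm (x - y) + L2_rv_norm M (\<lambda>\<omega>. X \<omega> - Y \<omega>))" by (simp add: N_def)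
  qed
qed

section \<open>The filtration of Brownian motion\<close>

lemma borel_measurable_vec_nth:
  fixes f :: "'a \<Rightarrow> real^'n"
  assumes "f \<in> borel_measurable N"
  shows "(\<lambda>x. f x $ k) \<in> borel_measurable N"
  by (rule measurable_compose[OF assms])
     (intro borel_measurable_continuous_onI continuous_intros)

text \<open>A finite-dimensional cylinder over times in \<open>[0, s]\<close> is determined by the increments
  over the sorted times, hence it is independent of the next increment.\<close>

lemma brownian_cylinder_indep:
  fixes W :: "real \<Rightarrow> 'w \<Rightarrow> real^'m"
  assumes bm: "brownian_motion N W" and st: "0 \<le> s" "s < t"
    and U: "finite U" "U \<subseteq> {0..s}" and A: "\<And>u. A u \<in> sets borel" and C: "C \<in> sets borel"
  shows "measure N ({\<omega>\<in>space N. \<forall>u\<in>U. W u \<omega> \<in> A u} \<inter> ((\<lambda>\<omega>. W t \<omega> - W s \<omega>) -` C \<inter> space N)) =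
    measure N {\<omega>\<in>space N. \<forall>u\<in>U. W u \<omega> \<in> A u} * measure N ((\<lambda>\<omega>. W t \<omega> - W s \<omega>) -` C \<inter> space N)"
proof -
  interpret N: prob_space N using bm by (simp add: brownian_motion_def)
  define xs where "xs = sorted_list_of_set (insert s U)"
  define n where "n = length xs"
  have xs: "set xs = insert s U" "sorted xs" using U(1)
    by (simp_all only: xs_def set_sorted_list_of_set finite_insert sorted_sorted_list_of_set)
  have n0: "0 < n" using xs(1) unfolding n_def by (cases xs) auto
  have xs_le: "0 \<le> xs ! j" "xs ! j \<le> s" if "j < n" for j
    using nth_mem[of j xs] that U(2) st(1) unfolding xs(1) n_def by auto
  have last: "xs ! (n - 1) = s"
  proof -
    obtain i where i: "i < n" "xs ! i = s" using xs(1) by (metis in_set_conv_nth insertI1 n_def)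
    then have "s \<le> xs ! (n - 1)" using sorted_nth_mono[OF xs(2), of i "n - 1"] n0 by (simp add: n_def)
    then show ?thesis using xs_le(2)[of "n - 1"] n0 by simp
  qed
  \<comment> \<open>The grid begins at time 0, where \<open>W\<close> vanishes, so that partial sums
    of increments recover the values. Since s was added to the sorted times, index n is s and index
    n + 1 is t.\<close>
  define \<tau> where "\<tau> j = (case j of 0 \<Rightarrow> 0 | Suc i \<Rightarrow> if i < n then xs ! i else t)" for j
  have \<tau>0: "\<tau> 0 = 0" and \<tau>n: "\<tau> n = s" and \<tau>Sn: "\<tau> (Suc n) = t"
    using last n0 by (auto simp: \<tau>_def split: nat.split)
  have \<tau>_mono: "\<tau> j \<le> \<tau> (Suc j)" for j
  proof (cases j)
    case 0
    then show ?thesis using xs_le[of 0] n0 by (simp add: \<tau>_def)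
  next
    case (Suc i)
    consider "Suc i < n" | "i < n" "\<not> Suc i < n" | "\<not> i < n" by linarith
    then show ?thesis
      using Suc xs_le(2)[of i] st(2) sorted_nth_mono[OF xs(2), of i "Suc i"]
      by cases (auto simp: \<tau>_def n_def)
  qed
  define \<Delta> where "\<Delta> j \<omega> = W (\<tau> (Suc j)) \<omega> - W (\<tau> j) \<omega>" for j \<omega>
  have ind: "N.indep_vars (\<lambda>_. borel) \<Delta> {..<Suc n}"
    using bm \<tau>_mono \<tau>0 unfolding brownian_motion_def \<Delta>_def[abs_def] by auto
  have W\<tau>: "W (\<tau> m) \<omega> = (\<Sum>j<m. \<Delta> j \<omega>)" if "\<omega> \<in> space N" for m \<omega>
  proof (induction m)
    case 0
    then show ?case using bm that by (simp add: \<tau>0 brownian_motion_def)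
  next
    case (Suc m)
    then show ?case by (simp add: \<Delta>_def)
  qed
  note ind2 = N.indep_var_restrict[OF ind, of "{..<n}" "{n}"]
  \<comment> \<open>The cylinder condition in terms of increments: the value at the m-th grid time
    is the sum of the first m increments. Only increments with index below n occur, while
    \<open>G\<close> below concerns the n-th.\<close>
  define E where "E = {f \<in> space (Pi\<^sub>M {..<n} (\<lambda>_. borel :: (real^'m) measure)).
     \<forall>m\<in>{m. 1 \<le> m \<and> m \<le> n \<and> \<tau> m \<in> U}. (\<Sum>j<m. f j) \<in> A (\<tau> m)}"
  have E: "E \<in> sets (Pi\<^sub>M {..<n} (\<lambda>_. borel))"
  proof -
    have "finite {m. 1 \<le> m \<and> m \<le> n \<and> \<tau> m \<in> U}" by (rule finite_subset[of _ "{..n}"]) auto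
    moreover have "{f \<in> space (Pi\<^sub>M {..<n} (\<lambda>_. borel :: (real^'m) measure)). (\<Sum>j<m. f j) \<in> A (\<tau> m)}
        \<in> sets (Pi\<^sub>M {..<n} (\<lambda>_. borel))" if "m \<le> n" for m
    proof -
      have "(\<lambda>f. \<Sum>j<m. f j) \<in> borel_measurable (Pi\<^sub>M {..<n} (\<lambda>_. borel :: (real^'m) measure))"
        using that by (intro borel_measurable_sum measurable_component_singleton) auto
      from measurable_sets[OF this A, of "\<tau> m"] show ?thesis by (simp add: vimage_def Int_def conj_commute)
    qed
    ultimately show ?thesis unfolding E_def by (intro sets.sets_Collect_finite_All) auto
  qed
  define G where "G = {f \<in> space (Pi\<^sub>M {n} (\<lambda>_. borel :: (real^'m) measure)). f n \<in> C}"
  have G: "G \<in> sets (Pi\<^sub>M {n} (\<lambda>_. borel))"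
  proof -
    have "(\<lambda>f. f n) \<in> borel_measurable (Pi\<^sub>M {n} (\<lambda>_. borel :: (real^'m) measure))"
      by (intro measurable_component_singleton) auto
    from measurable_sets[OF this C] show ?thesis by (simp add: G_def vimage_def Int_def conj_commute)
  qed
  have pE: "(\<lambda>\<omega>. restrict (\<lambda>i. \<Delta> i \<omega>) {..<n}) -` E \<inter> space N = {\<omega>\<in>space N. \<forall>u\<in>U. W u \<omega> \<in> A u}"
  proof -
    have "(restrict (\<lambda>i. \<Delta> i \<omega>) {..<n} \<in> E) = (\<forall>u\<in>U. W u \<omega> \<in> A u)" if \<omega>: "\<omega> \<in> space N" for \<omega>
    proof -
      have "(restrict (\<lambda>i. \<Delta> i \<omega>) {..<n} \<in> E) = (\<forall>m\<in>{m. 1 \<le> m \<and> m \<le> n \<and> \<tau> m \<in> U}. W (\<tau> m) \<omega> \<in> A (\<tau> m))"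
        unfolding E_def using W\<tau>[OF \<omega>] by (auto simp: space_PiM)
      also have "\<dots> = (\<forall>u\<in>U. W u \<omega> \<in> A u)"
      proof
        assume *: "\<forall>m\<in>{m. 1 \<le> m \<and> m \<le> n \<and> \<tau> m \<in> U}. W (\<tau> m) \<omega> \<in> A (\<tau> m)"
        show "\<forall>u\<in>U. W u \<omega> \<in> A u"
        proof
          fix u assume u: "u \<in> U"
          then have "u \<in> set xs" using xs(1) by simp
          then obtain i where "i < n" "xs ! i = u" by (metis in_set_conv_nth n_def)
          then have "\<tau> (Suc i) = u" "Suc i \<le> n" by (auto simp: \<tau>_def)
          then show "W u \<omega> \<in> A u" using *[rule_format, of "Suc i"] u by simp
        qed
      qed auto
      finally show ?thesis .
    qed
    then show ?thesis by auto
  qed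
  have pG: "(\<lambda>\<omega>. restrict (\<lambda>i. \<Delta> i \<omega>) {n}) -` G \<inter> space N = (\<lambda>\<omega>. W t \<omega> - W s \<omega>) -` C \<inter> space N"
    by (auto simp: G_def space_PiM \<Delta>_def \<tau>n \<tau>Sn)
  have "measure N ((\<lambda>\<omega>. (restrict (\<lambda>i. \<Delta> i \<omega>) {..<n}, restrict (\<lambda>i. \<Delta> i \<omega>) {n})) -` (E \<times> G) \<inter> space N) =
     measure N ((\<lambda>\<omega>. restrict (\<lambda>i. \<Delta> i \<omega>) {..<n}) -` E \<inter> space N) * measure N ((\<lambda>\<omega>. restrict (\<lambda>i. \<Delta> i \<omega>) {n}) -` G \<inter> space N)"
    by (rule N.indep_varD[OF ind2 E G]) auto
  moreover have "(\<lambda>\<omega>. (restrict (\<lambda>i. \<Delta> i \<omega>) {..<n}, restrict (\<lambda>i. \<Delta> i \<omega>) {n})) -` (E \<times> G) \<inter> space N =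
     ((\<lambda>\<omega>. restrict (\<lambda>i. \<Delta> i \<omega>) {..<n}) -` E \<inter> space N) \<inter> ((\<lambda>\<omega>. restrict (\<lambda>i. \<Delta> i \<omega>) {n}) -` G \<inter> space N)" by auto
  ultimately show ?thesis unfolding pE pG by simp
qed

text \<open>Finite-dimensional cylinders over times up to s, together with the null sets, form an
  intersection-stable family that is independent of the later increment and contains the generators
  of the filtration. Independence then extends to the generated sigma-algebras. The moments come
  from the normal density and do not change under completion.\<close>

lemma wiener_space_brownian_filtration:
  fixes M :: "(real \<Rightarrow> real^'m) measure"
  assumes "wiener_space M"
  shows "brownian_filtration M (wiener_filtration M) (\<lambda>t \<omega>. \<omega> t $ k)"
proof -
  from assms obtain N :: "(real \<Rightarrow> real^'m) measure" where bm: "brownian_motion N (\<lambda>t \<omega>. \<omega> t)" and M: "M = completion N"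
    unfolding wiener_space_def by blast
  interpret N: prob_space N using bm by (simp add: brownian_motion_def)
  interpret M: prob_space M unfolding M by (rule N.prob_space_completion)
  have spM: "space M = space N" by (simp add: M)
  have WN: "(\<lambda>\<omega>. \<omega> t) \<in> borel_measurable N" if "0 \<le> t" for t
    using bm that by (auto simp: brownian_motion_def)
  have WM: "(\<lambda>\<omega>. \<omega> t) \<in> borel_measurable M" if "0 \<le> t" for t
    using WN[OF that] by (simp add: M measurable_completion)
  define G where "G t = {(\<lambda>\<omega>. \<omega> s) -` A \<inter> space M | s A. 0 \<le> s \<and> s \<le> t \<and> A \<in> sets borel} \<union> null_sets M" for t
  have Gsub: "G t \<subseteq> sets M" for t using WM by (auto simp: G_def intro: measurable_sets)
  then have Gpow: "G t \<subseteq> Pow (space M)" for t using sets.sets_into_space by blast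
  have F: "wiener_filtration M t = sigma (space M) (G t)" for t
    by (simp add: wiener_filtration_def G_def)
  have spF: "space (wiener_filtration M t) = space M" for t
    using Gpow unfolding F by (simp add: space_measure_of)
  have setsF: "sets (wiener_filtration M t) = sigma_sets (space M) (G t)" for t
    using Gpow unfolding F by (simp add: sets_measure_of)
  have incN: "(\<lambda>\<omega>. \<omega> t - \<omega> s) \<in> borel_measurable N" if "0 \<le> s" "0 \<le> t" for s t :: real
    using WN that by auto
  have incM: "(\<lambda>\<omega>. \<omega> t - \<omega> s) \<in> borel_measurable M" if "0 \<le> s" "0 \<le> t" for s t :: real
    using WM that by auto
  have indep: "M.indep_set (sets (wiener_filtration M s)) {(\<lambda>\<omega>. \<omega> t - \<omega> s) -` C \<inter> space M | C. C \<in> sets borel}"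
    if st: "0 \<le> s" "s < t" for s t
  proof -
    define Cyl where "Cyl = {{\<omega>\<in>space M. \<forall>u\<in>U. \<omega> u \<in> A u} | U A. finite U \<and> U \<subseteq> {0..s} \<and> (\<forall>u. A u \<in> sets (borel :: (real^'m) measure))}"
    have cylN: "{\<omega>\<in>space N. \<forall>u\<in>U. \<omega> u \<in> A u} \<in> sets N"
      if "finite U" "U \<subseteq> {0..s}" "\<And>u. A u \<in> sets (borel :: (real^'m) measure)" for U A
    proof (rule sets.sets_Collect_finite_All[OF _ that(1)])
      fix u assume "u \<in> U"
      then have "0 \<le> u" using that by auto
      from measurable_sets[OF WN[OF this] that(3)[of u]]
      show "{\<omega> \<in> space N. \<omega> u \<in> A u} \<in> sets N" by (simp add: vimage_def Int_def conj_commute)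
    qed
    have cylM: "Cyl \<subseteq> sets M"
      unfolding Cyl_def using cylN by (auto simp: M)
    define D where "D = {(\<lambda>\<omega>. \<omega> t - \<omega> s) -` C \<inter> space M | C. C \<in> sets (borel :: (real^'m) measure)}"
    have t: "0 \<le> t" using st by simp
    have DM: "D \<subseteq> sets M" unfolding D_def using incM[OF st(1) t] by (auto intro: measurable_sets)
    \<comment> \<open>The augmentation is treated on the level of generators: null sets satisfy the
      product formula trivially, and cylinders are measurable before completion.\<close>
    have "M.indep_set (Cyl \<union> null_sets M) D"
    proof (rule M.indep_setI)
      show "Cyl \<union> null_sets M \<subseteq> sets M" using cylM by auto
      show "D \<subseteq> sets M" by (rule DM)
      fix a b assume a: "a \<in> Cyl \<union> null_sets M" and b: "b \<in> D"
      from a show "M.prob (a \<inter> b) = M.prob a * M.prob b"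
      proof
        assume a: "a \<in> null_sets M"
        then have "a \<inter> b \<in> null_sets M" using b DM by (intro null_set_Int2) auto
        then show ?thesis using a by (simp add: null_sets_def measure_def)
      next
        assume "a \<in> Cyl"
        then obtain U A where U: "finite U" "U \<subseteq> {0..s}" "\<And>u. A u \<in> sets (borel :: (real^'m) measure)"
          and a: "a = {\<omega>\<in>space N. \<forall>u\<in>U. \<omega> u \<in> A u}" by (auto simp: Cyl_def spM)
        obtain C where C: "C \<in> sets borel" and b: "b = (\<lambda>\<omega>. \<omega> t - \<omega> s) -` C \<inter> space N"
          using b by (auto simp: D_def spM)
        have aN: "a \<in> sets N" unfolding a by (rule cylN[OF U])
        have bN: "b \<in> sets N" unfolding b by (rule measurable_sets[OF incN[OF st(1) t] C])
        have "measure N (a \<inter> b) = measure N a * measure N b"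
          unfolding a b by (rule brownian_cylinder_indep[OF bm st U C])
        then show ?thesis using aN bN by (simp add: M)
      qed
    qed
    moreover have "Int_stable (Cyl \<union> null_sets M)"
    proof (rule Int_stableI)
      fix a b assume ab: "a \<in> Cyl \<union> null_sets M" "b \<in> Cyl \<union> null_sets M"
      show "a \<inter> b \<in> Cyl \<union> null_sets M"
      proof (cases "a \<in> null_sets M \<or> b \<in> null_sets M")
        case True
        then have "a \<inter> b \<in> null_sets M"
          using ab cylM null_set_Int1[of a M b] null_set_Int2[of b M a] by (auto simp: Int_commute)
        then show ?thesis by simp
      next
        case False
        then have "a \<in> Cyl" "b \<in> Cyl" using ab by auto
        then obtain U A U' A' where U: "finite U" "U \<subseteq> {0..s}" "\<forall>u. A u \<in> sets (borel :: (real^'m) measure)" "a = {\<omega>\<in>space M. \<forall>u\<in>U. \<omega> u \<in> A u}"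
          and U': "finite U'" "U' \<subseteq> {0..s}" "\<forall>u. A' u \<in> sets (borel :: (real^'m) measure)" "b = {\<omega>\<in>space M. \<forall>u\<in>U'. \<omega> u \<in> A' u}"
          unfolding Cyl_def by (elim CollectE exE conjE) (rule that)
        \<comment> \<open>Two cylinders may involve different times; a time that is absent from one
          of them gets the condition \<open>UNIV\<close> there.\<close>
        define A'' where "A'' u = (if u \<in> U then A u else UNIV) \<inter> (if u \<in> U' then A' u else UNIV)" for u
        have "a \<inter> b = {\<omega>\<in>space M. \<forall>u\<in>U \<union> U'. \<omega> u \<in> A'' u}"
          unfolding U(4) U'(4) A''_def by auto
        moreover have "\<forall>u. A'' u \<in> sets borel" using U(3) U'(3) by (auto simp: A''_def)
        ultimately have "a \<inter> b \<in> Cyl"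
          unfolding Cyl_def by (intro CollectI exI[of _ "U \<union> U'"] exI[of _ A'']) (use U(1,2) U'(1,2) in simp)
        then show ?thesis by simp
      qed
    qed
    moreover have "Int_stable D"
    proof (rule Int_stableI)
      fix a b assume "a \<in> D" "b \<in> D"
      then obtain C C' where C: "C \<in> sets borel" "C' \<in> sets borel" "a = (\<lambda>\<omega>. \<omega> t - \<omega> s) -` C \<inter> space M"
        "b = (\<lambda>\<omega>. \<omega> t - \<omega> s) -` C' \<inter> space M" by (auto simp: D_def)
      then have "a \<inter> b = (\<lambda>\<omega>. \<omega> t - \<omega> s) -` (C \<inter> C') \<inter> space M" by auto
      then show "a \<inter> b \<in> D" using C unfolding D_def by blast
    qed
    ultimately have *: "M.indep_set (sigma_sets (space M) (Cyl \<union> null_sets M)) (sigma_sets (space M) D)"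
      by (rule M.indep_set_sigma_sets)
    have "G s \<subseteq> Cyl \<union> null_sets M"
    proof
      fix a assume "a \<in> G s"
      then show "a \<in> Cyl \<union> null_sets M"
        unfolding G_def
      proof
        assume "a \<in> {(\<lambda>\<omega>. \<omega> u) -` A \<inter> space M | u A. 0 \<le> u \<and> u \<le> s \<and> A \<in> sets borel}"
        then obtain u A where u: "0 \<le> u" "u \<le> s" "A \<in> sets borel" "a = (\<lambda>\<omega>. \<omega> u) -` A \<inter> space M" by blast
        have "a = {\<omega>\<in>space M. \<forall>v\<in>{u}. \<omega> v \<in> A}" using u by auto
        then show ?thesis unfolding Cyl_def
          by (intro UnI1 CollectI exI[of _ "{u}"] exI[of _ "\<lambda>_. A"]) (use u in simp)
      qed simp
    qed
    then have "sets (wiener_filtration M s) \<subseteq> sigma_sets (space M) (Cyl \<union> null_sets M)"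
      unfolding setsF by (rule sigma_sets_mono')
    moreover have "D \<subseteq> sigma_sets (space M) D" by auto
    ultimately show ?thesis using * unfolding M.indep_sets2_eq D_def[symmetric] by blast
  qed
  have comp: "distributed N lborel (\<lambda>\<omega>. (\<omega> t - \<omega> s) $ k) (\<lambda>y. ennreal (normal_density 0 (sqrt (t - s)) y))"
    if "0 \<le> s" "s < t" for s t
    using bm that unfolding brownian_motion_def by blast
  have compN: "(\<lambda>\<omega>. \<omega> t $ k - \<omega> s $ k) \<in> borel_measurable N" if "0 \<le> s" "0 \<le> t" for s t :: real
    using borel_measurable_vec_nth[OF incN[OF that], of k] by simp
  show ?thesis
  proof (unfold_locales)
    show "space (wiener_filtration M t) = space M" for t by (rule spF)
    show "sets (wiener_filtration M t) \<subseteq> sets M" for t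
      unfolding setsF by (rule sets.sigma_sets_subset[OF Gsub])
    show "sets (wiener_filtration M s) \<subseteq> sets (wiener_filtration M t)" if "0 \<le> s" "s \<le> t" for s t
      unfolding setsF G_def
      by (intro sigma_sets_mono' Un_mono subset_refl Collect_mono ex_mono impI allI) (use that in auto)
    show "(\<lambda>\<omega>. \<omega> t $ k) \<in> borel_measurable (wiener_filtration M t)" if t: "0 \<le> t" for t
    proof -
      have "(\<lambda>\<omega>. \<omega> t) \<in> borel_measurable (wiener_filtration M t)"
      proof (rule measurableI)
        fix A :: "(real^'m) set" assume "A \<in> sets borel"
        then show "(\<lambda>\<omega>. \<omega> t) -` A \<inter> space (wiener_filtration M t) \<in> sets (wiener_filtration M t)"
          unfolding spF setsF using t by (intro sigma_sets.Basic) (auto simp: G_def)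
      qed simp
      then show ?thesis by (rule borel_measurable_vec_nth)
    qed
    show "M.indep_var borel X borel (\<lambda>\<omega>. \<omega> t $ k - \<omega> s $ k)"
      if st: "0 \<le> s" "s < t" and X: "X \<in> borel_measurable (wiener_filtration M s)" for s t and X :: "_ \<Rightarrow> real"
    proof -
      have "0 \<le> t" using st by simp
      have XM: "X \<in> borel_measurable M"
        using X sets.sigma_sets_subset[OF Gsub, of s] unfolding measurable_def spF setsF by auto
      have BM: "(\<lambda>\<omega>. \<omega> t $ k - \<omega> s $ k) \<in> borel_measurable M"
        using compN[OF st(1) \<open>0 \<le> t\<close>] by (simp add: M measurable_completion)
      let ?X = "{X -` A \<inter> space M |A. A \<in> sets borel}"
      let ?B = "{(\<lambda>\<omega>. \<omega> t $ k - \<omega> s $ k) -` A \<inter> space M |A. A \<in> sets borel}"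
      have hX: "?X \<subseteq> sets (wiener_filtration M s)" using measurable_sets[OF X] spF by auto
      \<comment> \<open>Events of one component are events of the vector increment, by pulling back
        along the projection.\<close>
      have hB: "?B \<subseteq> {(\<lambda>\<omega>. \<omega> t - \<omega> s) -` C \<inter> space M | C. C \<in> sets borel}"
      proof
        fix a assume "a \<in> ?B"
        then obtain A where A: "A \<in> sets borel" "a = (\<lambda>\<omega>. \<omega> t $ k - \<omega> s $ k) -` A \<inter> space M" by blast
        have "(\<lambda>x::real^'m. x $ k) -` A \<in> sets borel"
          using measurable_sets[OF borel_measurable_vec_nth[OF measurable_ident] A(1), of k] by simp
        moreover have "a = (\<lambda>\<omega>. \<omega> t - \<omega> s) -` ((\<lambda>x. x $ k) -` A) \<inter> space M" using A by auto
        ultimately show "a \<in> {(\<lambda>\<omega>. \<omega> t - \<omega> s) -` C \<inter> space M | C. C \<in> sets borel}" by blast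
      qed
      have "M.indep_set ?X ?B"
      proof (rule M.indep_setI)
        note i = indep[OF st, unfolded M.indep_sets2_eq]
        show "?X \<subseteq> sets M" by (rule order_trans[OF hX conjunct1[OF i]])
        show "?B \<subseteq> sets M" by (rule order_trans[OF hB conjunct1[OF conjunct2[OF i]]])
        fix a b assume "a \<in> ?X" "b \<in> ?B"
        then show "M.prob (a \<inter> b) = M.prob a * M.prob b"
          using M.indep_setD[OF indep[OF st]] subsetD[OF hX] subsetD[OF hB] by presburger
      qed
      moreover have "Int_stable {f -` A \<inter> space M |A. A \<in> sets borel}" for f :: "(real \<Rightarrow> real^'m) \<Rightarrow> real"
      proof (rule Int_stableI)
        fix a b assume "a \<in> {f -` A \<inter> space M |A. A \<in> sets borel}" "b \<in> {f -` A \<inter> space M |A. A \<in> sets borel}"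
        then obtain A A' where A: "A \<in> sets borel" "A' \<in> sets borel" and ab: "a = f -` A \<inter> space M" "b = f -` A' \<inter> space M"
          by (elim CollectE exE conjE) (rule that)
        have "a \<inter> b = f -` (A \<inter> A') \<inter> space M" unfolding ab by auto
        moreover have "A \<inter> A' \<in> sets borel" using A by simp
        ultimately show "a \<inter> b \<in> {f -` A \<inter> space M |A. A \<in> sets borel}"
          by (intro CollectI exI conjI)
      qed
      ultimately show ?thesis
        unfolding M.indep_var_eq by (intro conjI M.indep_set_sigma_sets XM BM)
    qed
    fix s t :: real assume st: "0 \<le> s" "s < t"
    then have t: "0 \<le> t" and \<sigma>: "0 < sqrt (t - s)" by auto
    note D = comp[OF st]
    have [measurable]: "(\<lambda>\<omega>. \<omega> t $ k - \<omega> s $ k) \<in> borel_measurable N" by (rule compN[OF st(1) t])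
    have "integrable lborel (\<lambda>y. normal_density 0 (sqrt (t - s)) y * y\<^sup>2)"
      using integrable_normal_moment[OF \<sigma>, of 0 2] by simp
    then have i: "integrable N (\<lambda>\<omega>. (\<omega> t $ k - \<omega> s $ k)\<^sup>2)"
      using distributed_integrable[OF D, of "\<lambda>y. y\<^sup>2"] by simp
    then show "integrable M (\<lambda>\<omega>. (\<omega> t $ k - \<omega> s $ k)\<^sup>2)"
      unfolding M by (subst integrable_completion) auto
    have e: "(\<integral>\<omega>. \<omega> t $ k - \<omega> s $ k \<partial>N) = 0"
      using N.normal_distributed_expectation[OF \<sigma> D] by simp
    then show "(\<integral>\<omega>. \<omega> t $ k - \<omega> s $ k \<partial>M) = 0"
      unfolding M by (subst integral_completion) auto
    have "(\<integral>\<omega>. (\<omega> t $ k - \<omega> s $ k)\<^sup>2 \<partial>N) = t - s"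
      using N.normal_distributed_variance[OF \<sigma> D] e st by simp
    then show "(\<integral>\<omega>. (\<omega> t $ k - \<omega> s $ k)\<^sup>2 \<partial>M) = t - s"
      unfolding M by (subst integral_completion) auto
  qed
qed

section \<open>Two solutions of the McKean-Vlasov equation\<close>

text \<open>The rationals of the open interval are dense in the closed one. This reduces statements
  about all times of a step to countably many measurable conditions.\<close>

lemma continuous_le_if_le_on_Rats:
  fixes f :: "real \<Rightarrow> real"
  assumes "a < b" and f: "continuous_on {a..b} f" and le: "\<And>t. t \<in> {a..b} \<inter> \<rat> \<Longrightarrow> f t \<le> c"
    and t: "t \<in> {a..b}"
  shows "f t \<le> c"
proof -
  have cl: "closure ({a<..<b} \<inter> \<rat>) = {a..b}"
    using closure_open_Int_superset[of "{a<..<b}" \<rat>] \<open>a < b\<close> by (simp add: Rats_closure_real)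
  show ?thesis
    by (rule continuous_le_on_closure[of "{a<..<b} \<inter> \<rat>"]) (use cl f t le in auto)
qed

text \<open>The integral of the squared deviation of \<open>f\<close> from its mean \<open>m\<close>
  over the interval is nonnegative.\<close>

lemma integral_Cauchy_Schwarz_interval:
  fixes f :: "real \<Rightarrow> real"
  assumes "a \<le> b" and f: "continuous_on {a..b} f"
  shows "(integral {a..b} f)\<^sup>2 \<le> (b - a) * integral {a..b} (\<lambda>r. (f r)\<^sup>2)"
proof (cases "a = b")
  case False
  then have ab: "0 < b - a" using assms by simp
  define m where "m = integral {a..b} f / (b - a)"
  have i: "f integrable_on {a..b}" "(\<lambda>r. (f r)\<^sup>2) integrable_on {a..b}"
    by (intro integrable_continuous_interval continuous_intros f)+
  have "0 \<le> integral {a..b} (\<lambda>r. (f r - m)\<^sup>2)"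
    by (intro Henstock_Kurzweil_Integration.integral_nonneg integrable_continuous_interval continuous_intros f) auto
  also have "(\<lambda>r. (f r - m)\<^sup>2) = (\<lambda>r. (f r)\<^sup>2 + ((- 2 * m) * f r + m\<^sup>2))"
    by (simp add: fun_eq_iff power2_diff algebra_simps)
  also have "integral {a..b} \<dots> = integral {a..b} (\<lambda>r. (f r)\<^sup>2) + (integral {a..b} (\<lambda>r. (- 2 * m) * f r) + integral {a..b} (\<lambda>r. m\<^sup>2))"
    by (subst Henstock_Kurzweil_Integration.integral_add,
        (intro integrable_continuous_interval continuous_intros f)+,
        subst Henstock_Kurzweil_Integration.integral_add,
        (intro integrable_continuous_interval continuous_intros f)+, simp)
  also have "\<dots> = integral {a..b} (\<lambda>r. (f r)\<^sup>2) - (integral {a..b} f)\<^sup>2 / (b - a)"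
  proof -
    have "integral {a..b} f = m * (b - a)" using ab by (simp add: m_def)
    then show ?thesis using ab by (simp add: power2_eq_square)
  qed
  finally have "(integral {a..b} f)\<^sup>2 / (b - a) \<le> integral {a..b} (\<lambda>r. (f r)\<^sup>2)" by simp
  then show ?thesis using ab by (simp add: divide_le_eq mult.commute)
qed simp

text \<open>The process is the pointwise limit of its samples at times rounded up to multiples of
  1/(n+1). A sampled process uses countably many times and is jointly measurable; rounding up stays
  on the nonnegative axis, where paths are continuous.\<close>

lemma measurable_continuous_process:
  fixes D :: "real \<Rightarrow> 'w \<Rightarrow> 'a::{metric_space, second_countable_topology}"
  assumes D: "\<And>t. 0 \<le> t \<Longrightarrow> D t \<in> borel_measurable M"
    and cont: "\<And>\<omega>. \<omega> \<in> space M \<Longrightarrow> continuous_on {0..} (\<lambda>t. D t \<omega>)"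
  shows "(\<lambda>(\<omega>, r). D (max 0 r) \<omega>) \<in> borel_measurable (M \<Otimes>\<^sub>M lborel)"
proof -
  define \<rho> where "\<rho> n r = real (nat \<lceil>real (Suc n) * max 0 r\<rceil>) / real (Suc n)" for n and r :: real
  have lim: "(\<lambda>n. \<rho> n r) \<longlonglongrightarrow> max 0 r" for r
  proof (rule tendsto_sandwich[OF always_eventually always_eventually tendsto_const])
    show "\<forall>n. max 0 r \<le> \<rho> n r"
    proof
      fix n
      have "real (Suc n) * max 0 r \<le> real (nat \<lceil>real (Suc n) * max 0 r\<rceil>)" by linarith
      then show "max 0 r \<le> \<rho> n r" by (simp add: \<rho>_def le_divide_eq mult.commute)
    qed
    show "\<forall>n. \<rho> n r \<le> max 0 r + 1 / real (Suc n)"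
    proof
      fix n
      have "0 \<le> real (Suc n) * max 0 r" by simp
      then have "real (nat \<lceil>real (Suc n) * max 0 r\<rceil>) \<le> real (Suc n) * max 0 r + 1" by linarith
      then have "\<rho> n r \<le> (real (Suc n) * max 0 r + 1) / real (Suc n)"
        unfolding \<rho>_def by (intro divide_right_mono) auto
      also have "\<dots> = max 0 r + 1 / real (Suc n)" by (simp add: add_divide_distrib)
      finally show "\<rho> n r \<le> max 0 r + 1 / real (Suc n)" .
    qed
    have "(\<lambda>n. max 0 r + 1 / real (Suc n)) \<longlonglongrightarrow> max 0 r + 0"
      by (intro tendsto_add tendsto_const LIMSEQ_inverse_real_of_nat[unfolded inverse_eq_divide])
    then show "(\<lambda>n. max 0 r + 1 / real (Suc n)) \<longlonglongrightarrow> max 0 r" by simp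
  qed
  show ?thesis
  proof (rule borel_measurable_LIMSEQ_metric)
    fix n
    show "(\<lambda>(\<omega>, r). D (\<rho> n r) \<omega>) \<in> borel_measurable (M \<Otimes>\<^sub>M lborel)"
      unfolding \<rho>_def case_prod_beta
    proof (rule measurable_compose_countable[where f = "\<lambda>j p. D (real j / real (Suc n)) (fst p)"
          and g = "\<lambda>p. nat \<lceil>real (Suc n) * max 0 (snd p)\<rceil>"])
      show "(\<lambda>p. D (real j / real (Suc n)) (fst p)) \<in> borel_measurable (M \<Otimes>\<^sub>M lborel)" for j :: nat
        by (rule measurable_compose[OF measurable_fst D]) simp
      show "(\<lambda>p. nat \<lceil>real (Suc n) * max 0 (snd p)\<rceil>) \<in> measurable (M \<Otimes>\<^sub>M lborel) (count_space UNIV)"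
        by measurable
    qed
  next
    fix p :: "'w \<times> real" assume "p \<in> space (M \<Otimes>\<^sub>M lborel)"
    then have \<omega>: "fst p \<in> space M" by (auto simp: space_pair_measure)
    have "(\<lambda>n. D (\<rho> n (snd p)) (fst p)) \<longlonglongrightarrow> D (max 0 (snd p)) (fst p)"
    proof (rule continuous_on_tendsto_compose[OF cont[OF \<omega>] lim])
      have "0 \<le> \<rho> n r" for n r unfolding \<rho>_def by (intro divide_nonneg_nonneg of_nat_0_le_iff)
      then show "\<forall>\<^sub>F n in sequentially. \<rho> n (snd p) \<in> {0..}" by simp
    qed simp
    then show "(\<lambda>n. case p of (\<omega>, r) \<Rightarrow> D (\<rho> n r) \<omega>) \<longlonglongrightarrow> (case p of (\<omega>, r) \<Rightarrow> D (max 0 r) \<omega>)"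
      by (simp add: case_prod_beta)
  qed
qed

context brownian_filtration
begin

text \<open>All simple integrals vanish at time 0, so the constant sequence E[(I 0)^2] tends to 0.
  The statement is almost sure because the integral is characterised only in mean square.\<close>

lemma ito_at_zero:
  assumes I: "is_ito_integral M F B H I"
  shows "AE \<omega> in M. I 0 \<omega> = 0"
proof -
  from I obtain n \<tau> \<xi> where d: "\<And>j::nat. simple_data F (n j) (\<tau> j) (\<xi> j)"
    and lim: "\<And>t. 0 \<le> t \<Longrightarrow> (\<lambda>j. \<integral>\<^sup>+\<omega>. ennreal ((I t \<omega> - simple_integral B (n j) (\<tau> j) (\<xi> j) t \<omega>)\<^sup>2) \<partial>M)
            \<longlonglongrightarrow> 0"
    unfolding is_ito_integral_def by blast
  have "(\<lambda>j::nat. \<integral>\<^sup>+\<omega>. ennreal ((I 0 \<omega>)\<^sup>2) \<partial>M) \<longlonglongrightarrow> 0"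
    using lim[of 0] simple_integral_zero[OF d] by simp
  then have "(\<integral>\<^sup>+\<omega>. ennreal ((I 0 \<omega>)\<^sup>2) \<partial>M) = 0"
    by (simp add: LIMSEQ_const_iff)
  moreover have "I 0 \<in> borel_measurable M" by (rule ito_measurable[OF I]) simp
  ultimately have "AE \<omega> in M. ennreal ((I 0 \<omega>)\<^sup>2) = 0"
    by (subst (asm) nn_integral_0_iff_AE) auto
  then show ?thesis by eventually_elim simp
qed

end

section \<open>Moments and mean square continuity of a solution\<close>

lemma mckean_vlasov_solution_measurable:
  assumes M: "wiener_space M" and sol: "mckean_vlasov_solution M V0 V x X" and t: "0 \<le> t"
  shows "X t \<in> borel_measurable M"
proof -
  interpret brownian_filtration M "wiener_filtration M" "\<lambda>t \<omega>. \<omega> t $ k" for k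
    by (rule wiener_space_brownian_filtration[OF M])
  show ?thesis
    by (rule measurable_F_M[OF t]) (use sol t in \<open>auto simp: mckean_vlasov_solution_def\<close>)
qed

text \<open>The supremum over rational times is measurable, lies below the supremum in the
  definition of a solution, and by path continuity still dominates every time of the
  interval.\<close>

lemma mckean_vlasov_solution_dominated:
  assumes M: "wiener_space M" and sol: "mckean_vlasov_solution M V0 V x X" and T: "0 < T"
  obtains g where "integrable M g" "AE \<omega> in M. \<forall>t\<in>{0..T}. (norm (X t \<omega>))\<^sup>2 \<le> g \<omega>"
proof -
  define G where "G \<omega> = (SUP t\<in>{0..T} \<inter> \<rat>. ennreal ((norm (X t \<omega>))\<^sup>2))" for \<omega>
  note X = mckean_vlasov_solution_measurable[OF M sol]
  have G[measurable]: "G \<in> borel_measurable M"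
    unfolding G_def[abs_def]
  proof (rule borel_measurable_SUP)
    show "countable ({0..T} \<inter> \<rat>)" by (intro countable_Int2 countable_rat)
    fix t assume "t \<in> {0..T} \<inter> \<rat>"
    then have [measurable]: "X t \<in> borel_measurable M" using X by auto
    show "(\<lambda>\<omega>. ennreal ((norm (X t \<omega>))\<^sup>2)) \<in> borel_measurable M" by measurable
  qed
  have "(\<integral>\<^sup>+\<omega>. G \<omega> \<partial>M) \<le> (\<integral>\<^sup>+\<omega>. (SUP t\<in>{0..T}. ennreal ((norm (X t \<omega>))\<^sup>2)) \<partial>M)"
    unfolding G_def by (intro nn_integral_mono SUP_subset_mono) auto
  also have "\<dots> < \<infinity>" using sol T by (simp add: mckean_vlasov_solution_def)
  finally have fin: "(\<integral>\<^sup>+\<omega>. G \<omega> \<partial>M) < \<infinity>" .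
  then have AEf: "AE \<omega> in M. G \<omega> \<noteq> \<infinity>" by (intro nn_integral_noteq_infinite G) auto
  show ?thesis
  proof (rule that[of "\<lambda>\<omega>. enn2real (G \<omega>)"])
    have "(\<integral>\<^sup>+\<omega>. ennreal (enn2real (G \<omega>)) \<partial>M) = (\<integral>\<^sup>+\<omega>. G \<omega> \<partial>M)"
      by (rule nn_integral_cong_AE) (use AEf in \<open>eventually_elim, simp add: top.not_eq_extremum\<close>)
    then show "integrable M (\<lambda>\<omega>. enn2real (G \<omega>))"
      using fin by (intro integrableI_nonneg) auto
    show "AE \<omega> in M. \<forall>t\<in>{0..T}. (norm (X t \<omega>))\<^sup>2 \<le> enn2real (G \<omega>)"
      using AEf AE_space
    proof eventually_elim
      case (elim \<omega>)
      have c: "continuous_on {0..} (\<lambda>t. X t \<omega>)" using sol elim by (simp add: mckean_vlasov_solution_def)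
      show ?case
      proof
        fix t assume t: "t \<in> {0..T}"
        show "(norm (X t \<omega>))\<^sup>2 \<le> enn2real (G \<omega>)"
        proof (rule continuous_le_if_le_on_Rats[OF T _ _ t])
          show "continuous_on {0..T} (\<lambda>t. (norm (X t \<omega>))\<^sup>2)"
            by (intro continuous_intros continuous_on_subset[OF c]) auto
          fix t assume "t \<in> {0..T} \<inter> \<rat>"
          then have "ennreal ((norm (X t \<omega>))\<^sup>2) \<le> G \<omega>" unfolding G_def by (rule SUP_upper)
          also have "\<dots> = ennreal (enn2real (G \<omega>))" using elim by (simp add: top.not_eq_extremum)
          finally show "(norm (X t \<omega>))\<^sup>2 \<le> enn2real (G \<omega>)" by (subst (asm) ennreal_le_iff) auto
        qed
      qed
    qed
  qed
qed

lemma mckean_vlasov_solution_L2: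
  assumes M: "wiener_space M" and sol: "mckean_vlasov_solution M V0 V x X" and t: "0 \<le> t"
  shows "X t \<in> L2_rv M"
proof -
  obtain g where g: "integrable M g" "AE \<omega> in M. \<forall>t\<in>{0..t + 1}. (norm (X t \<omega>))\<^sup>2 \<le> g \<omega>"
    by (rule mckean_vlasov_solution_dominated[OF M sol, of "t + 1"]) (use t in auto)
  note [measurable] = mckean_vlasov_solution_measurable[OF M sol t]
  have "integrable M (\<lambda>\<omega>. (norm (X t \<omega>))\<^sup>2)"
  proof (rule Bochner_Integration.integrable_bound[OF g(1)])
    show "AE \<omega> in M. norm ((norm (X t \<omega>))\<^sup>2) \<le> norm (g \<omega>)"
      using g(2)
    proof eventually_elim
      case (elim \<omega>)
      then have "(norm (X t \<omega>))\<^sup>2 \<le> g \<omega>" using t by auto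
      then show ?case by simp
    qed
  qed simp
  then show ?thesis by (simp add: L2_rv_def)
qed

text \<open>Path continuity and dominated convergence; four times the common bound of the squared
  norms dominates the squared difference.\<close>

lemma mckean_vlasov_solution_L2_continuous:
  assumes M: "wiener_space M" and sol: "mckean_vlasov_solution M V0 V x X"
    and r: "\<And>n. 0 \<le> r n" "r \<longlonglongrightarrow> s" and s: "0 \<le> s"
  shows "(\<lambda>n. L2_rv_norm M (\<lambda>\<omega>. X (r n) \<omega> - X s \<omega>)) \<longlonglongrightarrow> 0"
proof -
  have "bounded (range r)" using r(2) by (rule convergent_imp_bounded)
  then obtain b where b: "\<And>n. \<bar>r n\<bar> \<le> b" unfolding bounded_iff by auto
  define T where "T = max b s + 1"
  have rT: "r n \<in> {0..T}" for n using b[of n] r(1)[of n] by (auto simp: T_def)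
  have sT: "s \<in> {0..T}" using s by (auto simp: T_def)
  have T: "0 < T" using s by (auto simp: T_def)
  obtain g where g: "integrable M g" "AE \<omega> in M. \<forall>t\<in>{0..T}. (norm (X t \<omega>))\<^sup>2 \<le> g \<omega>"
    by (rule mckean_vlasov_solution_dominated[OF M sol T])
  note X[measurable] = mckean_vlasov_solution_measurable[OF M sol]
  have [measurable]: "X (r n) \<in> borel_measurable M" "X s \<in> borel_measurable M" for n
    using X r s by auto
  have "(\<lambda>n. \<integral>\<omega>. (norm (X (r n) \<omega> - X s \<omega>))\<^sup>2 \<partial>M) \<longlonglongrightarrow> (\<integral>\<omega>. 0 \<partial>M)"
  proof (rule integral_dominated_convergence[where w = "\<lambda>\<omega>. 4 * g \<omega>"])
    show "integrable M (\<lambda>\<omega>. 4 * g \<omega>)" using g(1) by simp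
    show "AE \<omega> in M. (\<lambda>n. (norm (X (r n) \<omega> - X s \<omega>))\<^sup>2) \<longlonglongrightarrow> 0"
    proof (rule AE_I2)
      fix \<omega> assume "\<omega> \<in> space M"
      then have c: "continuous_on {0..} (\<lambda>t. X t \<omega>)" using sol by (simp add: mckean_vlasov_solution_def)
      have "(\<lambda>n. X (r n) \<omega>) \<longlonglongrightarrow> X s \<omega>"
        by (rule continuous_on_tendsto_compose[OF c r(2)]) (use r s in auto)
      then have "(\<lambda>n. (norm (X (r n) \<omega> - X s \<omega>))\<^sup>2) \<longlonglongrightarrow> (norm (X s \<omega> - X s \<omega>))\<^sup>2"
        by (intro tendsto_intros)
      then show "(\<lambda>n. (norm (X (r n) \<omega> - X s \<omega>))\<^sup>2) \<longlonglongrightarrow> 0" by simp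
    qed
    fix n
    show "AE \<omega> in M. norm ((norm (X (r n) \<omega> - X s \<omega>))\<^sup>2) \<le> 4 * g \<omega>"
      using g(2)
    proof eventually_elim
      case (elim \<omega>)
      then have "(norm (X (r n) \<omega>))\<^sup>2 \<le> g \<omega>" "(norm (X s \<omega>))\<^sup>2 \<le> g \<omega>" using rT sT by auto
      then show ?case using norm_add_square_le[of "X (r n) \<omega>" "- X s \<omega>"] by simp
    qed
  qed auto
  then have "(\<lambda>n. sqrt (\<integral>\<omega>. (norm (X (r n) \<omega> - X s \<omega>))\<^sup>2 \<partial>M)) \<longlonglongrightarrow> sqrt 0"
    by (intro tendsto_real_sqrt) simp
  then show ?thesis by (simp add: L2_rv_norm_def)
qed

text \<open>Along a solution the Lipschitz bound involves the path and the L^2 distance between two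
  times, and both are continuous in time. Drift integrals can thus be handled as integrals of
  continuous functions.\<close>

lemma mckean_vlasov_coefficient_continuous:
  fixes W :: "real^'n \<Rightarrow> (real^'n) measure \<Rightarrow> real^'n"
  assumes M: "wiener_space M" and sol: "mckean_vlasov_solution M V0 V x X"
    and lip: "\<And>x y X Y. X \<in> L2_rv M \<Longrightarrow> Y \<in> L2_rv M \<Longrightarrow>
      norm (W x (distr M borel X) - W y (distr M borel Y)) \<le> K * (norm (x - y) + L2_rv_norm M (\<lambda>\<omega>. X \<omega> - Y \<omega>))"
    and \<omega>: "\<omega> \<in> space M"
  shows "continuous_on {0..} (\<lambda>t. W (X t \<omega>) (distr M borel (X t)))"
proof (rule continuous_on_sequentiallyI)
  fix r s assume r: "\<forall>n. r n \<in> {0::real..}" and s: "s \<in> {0::real..}" and lim: "r \<longlonglongrightarrow> s"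
  have c: "continuous_on {0..} (\<lambda>t. X t \<omega>)" using sol \<omega> by (simp add: mckean_vlasov_solution_def)
  have "(\<lambda>n. X (r n) \<omega>) \<longlonglongrightarrow> X s \<omega>"
    by (rule continuous_on_tendsto_compose[OF c lim]) (use r s in auto)
  moreover have "(\<lambda>n. L2_rv_norm M (\<lambda>\<omega>. X (r n) \<omega> - X s \<omega>)) \<longlonglongrightarrow> 0"
    by (rule mckean_vlasov_solution_L2_continuous[OF M sol _ lim]) (use r s in auto)
  ultimately have z: "(\<lambda>n. K * (norm (X (r n) \<omega> - X s \<omega>) + L2_rv_norm M (\<lambda>\<omega>. X (r n) \<omega> - X s \<omega>))) \<longlonglongrightarrow>
     K * (norm (X s \<omega> - X s \<omega>) + 0)"
    by (intro tendsto_intros)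
  have "(\<lambda>n. W (X (r n) \<omega>) (distr M borel (X (r n))) - W (X s \<omega>) (distr M borel (X s))) \<longlonglongrightarrow> 0"
  proof (rule Lim_null_comparison[OF always_eventually])
    show "\<forall>n. norm (W (X (r n) \<omega>) (distr M borel (X (r n))) - W (X s \<omega>) (distr M borel (X s))) \<le>
      K * (norm (X (r n) \<omega> - X s \<omega>) + L2_rv_norm M (\<lambda>\<omega>. X (r n) \<omega> - X s \<omega>))"
      by (intro allI lip mckean_vlasov_solution_L2[OF M sol]) (use r s in auto)
  qed (use z in simp)
  then show "(\<lambda>n. W (X (r n) \<omega>) (distr M borel (X (r n)))) \<longlonglongrightarrow> W (X s \<omega>) (distr M borel (X s))"
    by (simp add: LIM_zero_iff)
qed

lemma sum_square_le_card_mult_sum_squares: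
  fixes f :: "'i \<Rightarrow> real"
  shows "(\<Sum>i\<in>I. f i)\<^sup>2 \<le> real (card I) * (\<Sum>i\<in>I. (f i)\<^sup>2)"
  using Cauchy_Schwarz_ineq_sum[of "\<lambda>_. 1" f I] by simp

lemma (in prob_space) second_moment_Markov:
  fixes f :: "'a \<Rightarrow> real"
  assumes [measurable]: "f \<in> borel_measurable M" and f: "integrable M (\<lambda>\<omega>. (f \<omega>)\<^sup>2)" and c: "0 < c"
  shows "prob {\<omega>\<in>space M. \<bar>f \<omega>\<bar> > c} \<le> (\<integral>\<omega>. (f \<omega>)\<^sup>2 \<partial>M) / c\<^sup>2"
proof -
  let ?A = "{\<omega>\<in>space M. \<bar>f \<omega>\<bar> > c}"
  have [measurable]: "?A \<in> sets M" by measurable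
  have "c\<^sup>2 * prob ?A = (\<integral>\<omega>. c\<^sup>2 * indicator ?A \<omega> \<partial>M)" by simp
  also have "\<dots> \<le> (\<integral>\<omega>. (f \<omega>)\<^sup>2 \<partial>M)"
  proof (rule integral_mono[OF _ f])
    show "integrable M (\<lambda>\<omega>. c\<^sup>2 * indicator ?A \<omega>)"
      by (intro integrable_mult_right integrable_real_indicator) (auto simp: emeasure_eq_measure)
    show "c\<^sup>2 * indicator ?A \<omega> \<le> (f \<omega>)\<^sup>2" for \<omega>
      using c by (auto simp: indicator_def abs_le_square_iff[symmetric])
  qed
  finally show ?thesis using c by (simp add: field_simps)
qed

text \<open>Both solutions are driven by the same Brownian motion, so their difference is small when
  the starting points are close. \<open>K\<close> is a common Lipschitz constant for all
  coefficients.\<close>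

locale mckean_vlasov_pair =
  fixes M :: "(real \<Rightarrow> real^'m) measure"
    and V0 :: "real^'n \<Rightarrow> (real^'n) measure \<Rightarrow> real^'n"
    and V :: "'m \<Rightarrow> real^'n \<Rightarrow> (real^'n) measure \<Rightarrow> real^'n"
    and K :: real
    and x y :: "real^'n" and X Y :: "real \<Rightarrow> (real \<Rightarrow> real^'m) \<Rightarrow> real^'n"
  assumes M: "wiener_space M" and K: "0 < K"
    and lip0: "\<And>x y X Y. X \<in> L2_rv M \<Longrightarrow> Y \<in> L2_rv M \<Longrightarrow>
      norm (V0 x (distr M borel X) - V0 y (distr M borel Y)) \<le> K * (norm (x - y) + L2_rv_norm M (\<lambda>\<omega>. X \<omega> - Y \<omega>))"
    and lip: "\<And>k x y X Y. X \<in> L2_rv M \<Longrightarrow> Y \<in> L2_rv M \<Longrightarrow>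
      norm (V k x (distr M borel X) - V k y (distr M borel Y)) \<le> K * (norm (x - y) + L2_rv_norm M (\<lambda>\<omega>. X \<omega> - Y \<omega>))"
    and X: "mckean_vlasov_solution M V0 V x X" and Y: "mckean_vlasov_solution M V0 V y Y"
begin

sublocale prob_space M
  using wiener_space_brownian_filtration[OF M] by (rule brownian_filtration.axioms(1))

sublocale bf: brownian_filtration M "wiener_filtration M" "\<lambda>t \<omega>. \<omega> t $ k" for k :: 'm
  by (rule wiener_space_brownian_filtration[OF M])

section \<open>The difference process and its mean square\<close>

definition D :: "real \<Rightarrow> (real \<Rightarrow> real^'m) \<Rightarrow> real^'n" where
  "D t \<omega> = Y t \<omega> - X t \<omega>"

definition u :: "real \<Rightarrow> real" where
  "u t = (\<integral>\<omega>. (norm (D t \<omega>))\<^sup>2 \<partial>M)"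

lemma D_L2: "0 \<le> t \<Longrightarrow> D t \<in> L2_rv M"
  unfolding D_def[abs_def]
  by (rule L2_rv_diff[OF mckean_vlasov_solution_L2[OF M Y] mckean_vlasov_solution_L2[OF M X]])

lemma D_measurable: "0 \<le> t \<Longrightarrow> D t \<in> borel_measurable M"
  using L2_rvD(1)[OF D_L2] .

lemma D_square_integrable: "0 \<le> t \<Longrightarrow> integrable M (\<lambda>\<omega>. (norm (D t \<omega>))\<^sup>2)"
  using L2_rvD(2)[OF D_L2] .

lemma D_continuous: "\<omega> \<in> space M \<Longrightarrow> continuous_on {0..} (\<lambda>t. D t \<omega>)"
  using X Y unfolding D_def by (intro continuous_intros) (auto simp: mckean_vlasov_solution_def)

lemma u_nonneg: "0 \<le> u t"
  by (simp add: u_def)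

text \<open>Finiteness has to be known beforehand, since the growth estimate absorbs half of a
  supremum of \<open>u\<close> into the other side.\<close>

lemma u_bounded:
  assumes "0 < T"
  obtains C where "\<And>t. t \<in> {0..T} \<Longrightarrow> u t \<le> C"
proof -
  obtain g where g: "integrable M g" "AE \<omega> in M. \<forall>t\<in>{0..T}. (norm (X t \<omega>))\<^sup>2 \<le> g \<omega>"
    by (rule mckean_vlasov_solution_dominated[OF M X assms])
  obtain g' where g': "integrable M g'" "AE \<omega> in M. \<forall>t\<in>{0..T}. (norm (Y t \<omega>))\<^sup>2 \<le> g' \<omega>"
    by (rule mckean_vlasov_solution_dominated[OF M Y assms])
  have "u t \<le> (\<integral>\<omega>. 2 * g' \<omega> + 2 * g \<omega> \<partial>M)" if t: "t \<in> {0..T}" for t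
    unfolding u_def
  proof (rule integral_mono_AE)
    show "integrable M (\<lambda>\<omega>. (norm (D t \<omega>))\<^sup>2)" using D_square_integrable t by simp
    show "integrable M (\<lambda>\<omega>. 2 * g' \<omega> + 2 * g \<omega>)" using g g' by simp
    show "AE \<omega> in M. (norm (D t \<omega>))\<^sup>2 \<le> 2 * g' \<omega> + 2 * g \<omega>"
      using g(2) g'(2)
    proof eventually_elim
      case (elim \<omega>)
      then have "(norm (X t \<omega>))\<^sup>2 \<le> g \<omega>" "(norm (Y t \<omega>))\<^sup>2 \<le> g' \<omega>" using t by auto
      then show ?case using norm_add_square_le[of "Y t \<omega>" "- X t \<omega>"] by (simp add: D_def)
    qed
  qed
  then show ?thesis by (rule that)
qed

lemma L2_rv_norm_difference: "L2_rv_norm M (\<lambda>\<omega>. Y r \<omega> - X r \<omega>) = sqrt (u r)"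
  by (simp add: L2_rv_norm_def u_def D_def)

text \<open>The contribution of the laws is the deterministic number sqrt (u r), which is replaced
  by one bound for the whole time step; only the path difference stays random.\<close>

lemma coefficient_difference:
  assumes r: "0 \<le> r" and U: "u r \<le> U"
  shows "norm (V0 (Y r \<omega>) (distr M borel (Y r)) - V0 (X r \<omega>) (distr M borel (X r))) \<le> K * (norm (D r \<omega>) + sqrt U)"
    and "norm (V k (Y r \<omega>) (distr M borel (Y r)) - V k (X r \<omega>) (distr M borel (X r))) \<le> K * (norm (D r \<omega>) + sqrt U)"
proof -
  note L2 = mckean_vlasov_solution_L2[OF M Y r] mckean_vlasov_solution_L2[OF M X r]
  have "K * (norm (Y r \<omega> - X r \<omega>) + L2_rv_norm M (\<lambda>\<omega>. Y r \<omega> - X r \<omega>)) \<le> K * (norm (D r \<omega>) + sqrt U)"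
    unfolding L2_rv_norm_difference using K U by (intro mult_left_mono add_mono) (auto simp: D_def)
  then show "norm (V0 (Y r \<omega>) (distr M borel (Y r)) - V0 (X r \<omega>) (distr M borel (X r))) \<le> K * (norm (D r \<omega>) + sqrt U)"
    and "norm (V k (Y r \<omega>) (distr M borel (Y r)) - V k (X r \<omega>) (distr M borel (X r))) \<le> K * (norm (D r \<omega>) + sqrt U)"
    using lip0[OF L2, of "Y r \<omega>" "X r \<omega>"] lip[OF L2, of k "Y r \<omega>" "X r \<omega>"] by linarith+
qed

lemma square_bound: "(K * (norm (D r \<omega>) + sqrt U))\<^sup>2 \<le> 2 * K\<^sup>2 * ((norm (D r \<omega>))\<^sup>2 + U)" if "0 \<le> U"
proof -
  have "(norm (D r \<omega>) + sqrt U)\<^sup>2 \<le> 2 * (norm (D r \<omega>))\<^sup>2 + 2 * (sqrt U)\<^sup>2"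
    using zero_le_power2[of "norm (D r \<omega>) - sqrt U"] by (simp add: power2_sum power2_diff)
  then have "K\<^sup>2 * (norm (D r \<omega>) + sqrt U)\<^sup>2 \<le> K\<^sup>2 * (2 * (norm (D r \<omega>))\<^sup>2 + 2 * U)"
    using that by (intro mult_left_mono) auto
  also have "\<dots> = 2 * K\<^sup>2 * ((norm (D r \<omega>))\<^sup>2 + U)" by (simp add: algebra_simps)
  finally show ?thesis unfolding power_mult_distrib .
qed

lemma D_joint_measurable:
  assumes "0 \<le> s"
  shows "(\<lambda>(\<omega>, r). ennreal ((norm (D r \<omega>))\<^sup>2) * indicator {s..e} r) \<in> borel_measurable (M \<Otimes>\<^sub>M lborel)"
proof -
  have [measurable]: "(\<lambda>p. D (max 0 (snd p)) (fst p)) \<in> borel_measurable (M \<Otimes>\<^sub>M lborel)"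
    using measurable_continuous_process[of D M, OF D_measurable D_continuous] by (simp add: case_prod_beta)
  have "(\<lambda>(\<omega>, r). ennreal ((norm (D r \<omega>))\<^sup>2) * indicator {s..e} r) =
      (\<lambda>p. ennreal ((norm (D (max 0 (snd p)) (fst p)))\<^sup>2) * indicator {s..e} (snd p))"
    using assms by (auto simp: fun_eq_iff indicator_def max_def)
  then show ?thesis by simp
qed

text \<open>After exchanging the integrals the inner expectation at time r is
  \<open>u r\<close>.\<close>

lemma D_time_integral:
  assumes s: "0 \<le> s" "s \<le> e" and U: "\<And>r. r \<in> {s..e} \<Longrightarrow> u r \<le> U"
  shows "(\<integral>\<^sup>+\<omega>. (\<integral>\<^sup>+r. ennreal ((norm (D r \<omega>))\<^sup>2) * indicator {s..e} r \<partial>lborel) \<partial>M) \<le> ennreal ((e - s) * U)"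
proof -
  interpret P: pair_sigma_finite M lborel
    by (intro pair_sigma_finite.intro prob_space_imp_sigma_finite[OF prob_space_axioms] sigma_finite_lborel)
  have "(\<integral>\<^sup>+\<omega>. (\<integral>\<^sup>+r. ennreal ((norm (D r \<omega>))\<^sup>2) * indicator {s..e} r \<partial>lborel) \<partial>M) =
     (\<integral>\<^sup>+r. (\<integral>\<^sup>+\<omega>. ennreal ((norm (D r \<omega>))\<^sup>2) * indicator {s..e} r \<partial>M) \<partial>lborel)"
    using P.Fubini[OF D_joint_measurable[OF s(1), of e]] by simp
  also have "\<dots> \<le> (\<integral>\<^sup>+r. ennreal U * indicator {s..e} r \<partial>lborel)"
  proof (rule nn_integral_mono)
    fix r
    show "(\<integral>\<^sup>+\<omega>. ennreal ((norm (D r \<omega>))\<^sup>2) * indicator {s..e} r \<partial>M) \<le> ennreal U * indicator {s..e} r"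
    proof (cases "r \<in> {s..e}")
      case True
      then have r: "0 \<le> r" using s by simp
      have "(\<integral>\<^sup>+\<omega>. ennreal ((norm (D r \<omega>))\<^sup>2) \<partial>M) = ennreal (u r)"
        unfolding u_def by (rule nn_integral_eq_integral) (use D_square_integrable[OF r] in auto)
      then show ?thesis using True U by (simp add: ennreal_leI)
    qed simp
  qed
  also have "\<dots> = ennreal ((e - s) * U)"
  proof -
    have "0 \<le> U" using U[of s] u_nonneg[of s] s by simp
    then show ?thesis using s by (simp add: nn_integral_cmult ennreal_mult mult.commute)
  qed
  finally show ?thesis .
qed

text \<open>A gauge integral along the path, the form in which the pathwise drift estimate produces
  it; \<open>ennreal_q\<close> links it to the Lebesgue integral used for measurability and
  expectation.\<close>

definition q :: "real \<Rightarrow> real \<Rightarrow> (real \<Rightarrow> real^'m) \<Rightarrow> real" where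
  "q s e \<omega> = integral {s..e} (\<lambda>r. (norm (D r \<omega>))\<^sup>2)"

lemma ennreal_q:
  assumes s: "0 \<le> s" and \<omega>: "\<omega> \<in> space M"
  shows "ennreal (q s e \<omega>) = (\<integral>\<^sup>+r. ennreal ((norm (D r \<omega>))\<^sup>2) * indicator {s..e} r \<partial>lborel)" "0 \<le> q s e \<omega>"
proof -
  have c: "continuous_on {s..e} (\<lambda>r. (norm (D r \<omega>))\<^sup>2)"
    by (intro continuous_intros continuous_on_subset[OF D_continuous[OF \<omega>]]) (use s in auto)
  note i = borel_integrable_atLeastAtMost'[OF c]
  have "(\<integral>\<^sup>+r. ennreal ((norm (D r \<omega>))\<^sup>2) * indicator {s..e} r \<partial>lborel) =
     (\<integral>\<^sup>+r. ennreal (indicator {s..e} r *\<^sub>R (norm (D r \<omega>))\<^sup>2) \<partial>lborel)"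
    by (intro nn_integral_cong) (auto simp: indicator_def)
  also have "\<dots> = ennreal (\<integral>r. indicator {s..e} r *\<^sub>R (norm (D r \<omega>))\<^sup>2 \<partial>lborel)"
    by (rule nn_integral_eq_integral) (use i in \<open>auto simp: set_integrable_def\<close>)
  also have "(\<integral>r. indicator {s..e} r *\<^sub>R (norm (D r \<omega>))\<^sup>2 \<partial>lborel) = q s e \<omega>"
    using set_borel_integral_eq_integral(2)[OF i] by (simp add: q_def set_lebesgue_integral_def)
  finally show "ennreal (q s e \<omega>) = (\<integral>\<^sup>+r. ennreal ((norm (D r \<omega>))\<^sup>2) * indicator {s..e} r \<partial>lborel)" by simp
  show "0 \<le> q s e \<omega>"
    unfolding q_def by (intro Henstock_Kurzweil_Integration.integral_nonneg integrable_continuous_interval c) auto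
qed

lemma q_measurable:
  assumes "0 \<le> s"
  shows "q s e \<in> borel_measurable M"
proof -
  have "(\<lambda>\<omega>. enn2real (\<integral>\<^sup>+r. ennreal ((norm (D r \<omega>))\<^sup>2) * indicator {s..e} r \<partial>lborel)) \<in> borel_measurable M"
    using lborel.borel_measurable_nn_integral[OF D_joint_measurable[OF assms, of e]] by simp
  moreover have "q s e \<omega> = enn2real (\<integral>\<^sup>+r. ennreal ((norm (D r \<omega>))\<^sup>2) * indicator {s..e} r \<partial>lborel)" if "\<omega> \<in> space M" for \<omega>
    using ennreal_q[OF assms that, of e] by (metis enn2real_ennreal)
  ultimately show ?thesis by (subst measurable_cong) auto
qed

lemma q_expectation:
  assumes s: "0 \<le> s" "s \<le> e" and U: "\<And>r. r \<in> {s..e} \<Longrightarrow> u r \<le> U"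
  shows "integrable M (q s e)" "(\<integral>\<omega>. q s e \<omega> \<partial>M) \<le> (e - s) * U"
proof -
  note [measurable] = q_measurable[OF s(1)]
  have U0: "0 \<le> (e - s) * U" using U[of s] u_nonneg[of s] s by simp
  have "(\<integral>\<^sup>+\<omega>. ennreal (q s e \<omega>) \<partial>M) = (\<integral>\<^sup>+\<omega>. (\<integral>\<^sup>+r. ennreal ((norm (D r \<omega>))\<^sup>2) * indicator {s..e} r \<partial>lborel) \<partial>M)"
    by (intro nn_integral_cong ennreal_q s)
  also have "\<dots> \<le> ennreal ((e - s) * U)" by (rule D_time_integral[OF s U])
  finally have le: "(\<integral>\<^sup>+\<omega>. ennreal (q s e \<omega>) \<partial>M) \<le> ennreal ((e - s) * U)" .
  have nn: "AE \<omega> in M. 0 \<le> q s e \<omega>" using ennreal_q(2)[OF s(1)] by (intro AE_I2)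
  show i: "integrable M (q s e)"
    by (rule integrableI_nonneg) (use nn le in \<open>auto intro: le_less_trans\<close>)
  show "(\<integral>\<omega>. q s e \<omega> \<partial>M) \<le> (e - s) * U"
    using le nn_integral_eq_integral[OF i nn] U0 by simp
qed

end

section \<open>Increments over one time step\<close>

context mckean_vlasov_pair
begin

text \<open>Pathwise, the drift difference is at most \<beta>. Enlarging the interval of integration
  to the whole step and applying Cauchy-Schwarz gives a bound free of t, so the drift needs no
  maximal inequality.\<close>

lemma drift_increment_bound:
  assumes st: "0 \<le> s" "s \<le> t" "t \<le> e" and \<omega>: "\<omega> \<in> space M" and U: "\<And>r. r \<in> {s..e} \<Longrightarrow> u r \<le> U"
  defines "b \<equiv> \<lambda>W r. V0 (W r \<omega>) (distr M borel (W r))"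
  shows "norm ((LINT r:{0..t}|lborel. b Y r) - (LINT r:{0..s}|lborel. b Y r)
      - ((LINT r:{0..t}|lborel. b X r) - (LINT r:{0..s}|lborel. b X r)))
    \<le> sqrt (2 * K\<^sup>2 * (e - s) * (q s e \<omega> + (e - s) * U))"
proof -
  have U0: "0 \<le> U" using U[of s] u_nonneg[of s] st by simp
  have cX: "continuous_on {0..} (b X)" and cY: "continuous_on {0..} (b Y)"
    unfolding b_def
    by (rule mckean_vlasov_coefficient_continuous[OF M _ lip0 \<omega>], rule X Y, assumption+)+
  have split: "(LINT r:{0..t}|lborel. f r) - (LINT r:{0..s}|lborel. f r) = integral {s..t} f"
    if f: "continuous_on {0..} f" for f :: "real \<Rightarrow> real^'n"
  proof -
    have c: "continuous_on {0..a} f" for a by (rule continuous_on_subset[OF f]) auto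
    have "integral {0..s} f + integral {s..t} f = integral {0..t} f"
      by (rule Henstock_Kurzweil_Integration.integral_combine) (use st c in \<open>auto intro: integrable_continuous_interval\<close>)
    then show ?thesis
      using set_borel_integral_eq_integral(2)[OF borel_integrable_atLeastAtMost'[OF c]] by (simp add: algebra_simps)
  qed
  have cst: "continuous_on {s..t} (b X)" "continuous_on {s..t} (b Y)"
    by (rule continuous_on_subset[OF cX] continuous_on_subset[OF cY], use st in force)+
  have cD: "continuous_on {s..e} (\<lambda>r. D r \<omega>)"
    by (rule continuous_on_subset[OF D_continuous[OF \<omega>]]) (use st in auto)
  define \<beta> where "\<beta> r = K * (norm (D r \<omega>) + sqrt U)" for r
  have c\<beta>: "continuous_on {s..e} \<beta>" unfolding \<beta>_def by (intro continuous_intros cD)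
  have \<beta>0: "0 \<le> \<beta> r" for r using K U0 by (simp add: \<beta>_def)
  have c\<beta>t: "continuous_on {s..t} \<beta>" by (rule continuous_on_subset[OF c\<beta>]) (use st in auto)
  have "norm (integral {s..t} (\<lambda>r. b Y r - b X r)) \<le> integral {s..t} \<beta>"
  proof (rule integral_norm_bound_integral)
    show "(\<lambda>r. b Y r - b X r) integrable_on {s..t}" "\<beta> integrable_on {s..t}"
      by (intro integrable_continuous_interval continuous_intros cst c\<beta>t)+
    fix r assume r: "r \<in> {s..t}"
    show "norm (b Y r - b X r) \<le> \<beta> r"
      unfolding b_def \<beta>_def by (rule coefficient_difference(1)) (use U r st in auto)
  qed
  also have "\<dots> \<le> integral {s..e} \<beta>"
    by (rule integral_subset_le) (use st \<beta>0 c\<beta> c\<beta>t in \<open>auto intro: integrable_continuous_interval\<close>)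
  also have "\<dots> \<le> sqrt (2 * K\<^sup>2 * (e - s) * (q s e \<omega> + (e - s) * U))"
  proof (rule real_le_rsqrt)
    have "s \<le> e" using st by simp
    have "(integral {s..e} \<beta>)\<^sup>2 \<le> (e - s) * integral {s..e} (\<lambda>r. (\<beta> r)\<^sup>2)"
      by (rule integral_Cauchy_Schwarz_interval[OF \<open>s \<le> e\<close> c\<beta>])
    also have "\<dots> \<le> (e - s) * integral {s..e} (\<lambda>r. 2 * K\<^sup>2 * ((norm (D r \<omega>))\<^sup>2 + U))"
      by (intro mult_left_mono integral_le integrable_continuous_interval continuous_intros c\<beta> cD)
         (use \<open>s \<le> e\<close> square_bound[OF U0] in \<open>auto simp: \<beta>_def\<close>)
    also have "integral {s..e} (\<lambda>r. 2 * K\<^sup>2 * ((norm (D r \<omega>))\<^sup>2 + U)) = 2 * K\<^sup>2 * (q s e \<omega> + (e - s) * U)"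
      unfolding q_def Henstock_Kurzweil_Integration.integral_mult_right
      by (subst Henstock_Kurzweil_Integration.integral_add,
          (intro integrable_continuous_interval continuous_intros cD)+) (use \<open>s \<le> e\<close> in simp)
    finally show "(integral {s..e} \<beta>)\<^sup>2 \<le> 2 * K\<^sup>2 * (e - s) * (q s e \<omega> + (e - s) * U)"
      by (simp add: ac_simps)
  qed
  finally have "norm (integral {s..t} (\<lambda>r. b Y r - b X r)) \<le> sqrt (2 * K\<^sup>2 * (e - s) * (q s e \<omega> + (e - s) * U))" .
  moreover have "integral {s..t} (\<lambda>r. b Y r - b X r) = integral {s..t} (b Y) - integral {s..t} (b X)"
    by (intro Henstock_Kurzweil_Integration.integral_diff integrable_continuous_interval cst)
  ultimately show ?thesis using split[OF cX] split[OF cY] by simp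
qed

text \<open>The constant 16 is 4 from \<open>ito_increment_bound\<close>, times 2 from
  \<open>square_bound\<close>, times 2 because the path and the law each contribute at most (t - s)
  U.\<close>

lemma ito_difference_bound:
  assumes I: "is_ito_integral M (wiener_filtration M) (\<lambda>t \<omega>. \<omega> t $ k) (\<lambda>t \<omega>. V k (X t \<omega>) (distr M borel (X t)) $ i) I"
    and I': "is_ito_integral M (wiener_filtration M) (\<lambda>t \<omega>. \<omega> t $ k) (\<lambda>t \<omega>. V k (Y t \<omega>) (distr M borel (Y t)) $ i) I'"
    and st: "0 \<le> s" "s \<le> t" "t \<le> e" and U: "\<And>r. r \<in> {s..e} \<Longrightarrow> u r \<le> U"
  shows "(\<integral>\<omega>. (I' t \<omega> - I' s \<omega> - (I t \<omega> - I s \<omega>))\<^sup>2 \<partial>M) \<le> 16 * K\<^sup>2 * (e - s) * U"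
proof -
  have U0: "0 \<le> U" using U[of s] u_nonneg[of s] st by simp
  have t: "0 \<le> t" using st by simp
  note [measurable] = bf.ito_measurable[OF I st(1)] bf.ito_measurable[OF I t] bf.ito_measurable[OF I' st(1)] bf.ito_measurable[OF I' t]
  have int: "integrable M (\<lambda>\<omega>. (I' t \<omega> - I' s \<omega> - (I t \<omega> - I s \<omega>))\<^sup>2)"
    by (intro bf.integrable_square_diff borel_measurable_diff bf.ito_square_integrable[OF I] bf.ito_square_integrable[OF I']
          bf.ito_measurable[OF I] bf.ito_measurable[OF I'] st(1) t)
  have [measurable]: "(\<lambda>(\<omega>, r). ennreal ((norm (D r \<omega>))\<^sup>2) * indicator {s..t} r) \<in> borel_measurable (M \<Otimes>\<^sub>M lborel)"
    by (rule D_joint_measurable[OF st(1)])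
  have "ennreal (\<integral>\<omega>. (I' t \<omega> - I' s \<omega> - (I t \<omega> - I s \<omega>))\<^sup>2 \<partial>M) =
     (\<integral>\<^sup>+\<omega>. ennreal ((I' t \<omega> - I' s \<omega> - (I t \<omega> - I s \<omega>))\<^sup>2) \<partial>M)"
    by (rule nn_integral_eq_integral[symmetric, OF int]) auto
  also have "\<dots> \<le> 4 * (\<integral>\<^sup>+\<omega>. (\<integral>\<^sup>+r. ennreal ((V k (Y r \<omega>) (distr M borel (Y r)) $ i - V k (X r \<omega>) (distr M borel (X r)) $ i)\<^sup>2) * indicator {s..t} r \<partial>lborel) \<partial>M)"
    by (rule bf.ito_increment_bound[OF I' I st(1,2)])
  also have "\<dots> \<le> 4 * (\<integral>\<^sup>+\<omega>. (\<integral>\<^sup>+r. ennreal (2 * K\<^sup>2) * (ennreal ((norm (D r \<omega>))\<^sup>2) * indicator {s..t} r + ennreal U * indicator {s..t} r) \<partial>lborel) \<partial>M)"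
  proof (intro mult_left_mono nn_integral_mono)
    fix \<omega> r
    show "ennreal ((V k (Y r \<omega>) (distr M borel (Y r)) $ i - V k (X r \<omega>) (distr M borel (X r)) $ i)\<^sup>2) * indicator {s..t} r \<le>
       ennreal (2 * K\<^sup>2) * (ennreal ((norm (D r \<omega>))\<^sup>2) * indicator {s..t} r + ennreal U * indicator {s..t} r)"
    proof (cases "r \<in> {s..t}")
      case True
      have "\<bar>V k (Y r \<omega>) (distr M borel (Y r)) $ i - V k (X r \<omega>) (distr M borel (X r)) $ i\<bar> \<le>
         norm (V k (Y r \<omega>) (distr M borel (Y r)) - V k (X r \<omega>) (distr M borel (X r)))"
        using component_le_norm_cart[of "V k (Y r \<omega>) (distr M borel (Y r)) - V k (X r \<omega>) (distr M borel (X r))" i] by simp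
      also have "\<dots> \<le> K * (norm (D r \<omega>) + sqrt U)"
        by (rule coefficient_difference(2)) (use True st U in auto)
      finally have "\<bar>V k (Y r \<omega>) (distr M borel (Y r)) $ i - V k (X r \<omega>) (distr M borel (X r)) $ i\<bar>\<^sup>2 \<le> (K * (norm (D r \<omega>) + sqrt U))\<^sup>2"
        by (intro power_mono) auto
      also have "\<dots> \<le> 2 * K\<^sup>2 * ((norm (D r \<omega>))\<^sup>2 + U)" by (rule square_bound[OF U0])
      finally have "ennreal ((V k (Y r \<omega>) (distr M borel (Y r)) $ i - V k (X r \<omega>) (distr M borel (X r)) $ i)\<^sup>2) \<le> ennreal (2 * K\<^sup>2 * ((norm (D r \<omega>))\<^sup>2 + U))"
        by (intro ennreal_leI) simp
      also have "\<dots> = ennreal (2 * K\<^sup>2) * (ennreal ((norm (D r \<omega>))\<^sup>2) + ennreal U)"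
        using U0 by (simp add: ennreal_mult ennreal_plus)
      finally show ?thesis using True by simp
    qed simp
  qed simp
  also have "(\<integral>\<^sup>+\<omega>. (\<integral>\<^sup>+r. ennreal (2 * K\<^sup>2) * (ennreal ((norm (D r \<omega>))\<^sup>2) * indicator {s..t} r + ennreal U * indicator {s..t} r) \<partial>lborel) \<partial>M)
    = (\<integral>\<^sup>+\<omega>. ennreal (2 * K\<^sup>2) * ((\<integral>\<^sup>+r. ennreal ((norm (D r \<omega>))\<^sup>2) * indicator {s..t} r \<partial>lborel) + ennreal ((t - s) * U)) \<partial>M)"
  proof (rule nn_integral_cong)
    fix \<omega> assume \<omega>: "\<omega> \<in> space M"
    have [measurable]: "(\<lambda>r. ennreal ((norm (D r \<omega>))\<^sup>2) * indicator {s..t} r) \<in> borel_measurable lborel"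
      using measurable_Pair2[OF D_joint_measurable[OF st(1), of t] \<omega>] by simp
    have "(\<integral>\<^sup>+r. ennreal U * indicator {s..t} r \<partial>lborel) = ennreal ((t - s) * U)"
      using st U0 by (simp add: nn_integral_cmult ennreal_mult mult.commute)
    then show "(\<integral>\<^sup>+r. ennreal (2 * K\<^sup>2) * (ennreal ((norm (D r \<omega>))\<^sup>2) * indicator {s..t} r + ennreal U * indicator {s..t} r) \<partial>lborel)
      = ennreal (2 * K\<^sup>2) * ((\<integral>\<^sup>+r. ennreal ((norm (D r \<omega>))\<^sup>2) * indicator {s..t} r \<partial>lborel) + ennreal ((t - s) * U))"
      by (subst nn_integral_cmult, measurable, subst nn_integral_add) auto
  qed
  also have "\<dots> = ennreal (2 * K\<^sup>2) * ((\<integral>\<^sup>+\<omega>. (\<integral>\<^sup>+r. ennreal ((norm (D r \<omega>))\<^sup>2) * indicator {s..t} r \<partial>lborel) \<partial>M) + ennreal ((t - s) * U))"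
    using lborel.borel_measurable_nn_integral[OF D_joint_measurable[OF st(1), of t]]
    by (subst nn_integral_cmult, simp, subst nn_integral_add) (auto simp: emeasure_space_1)
  finally have "ennreal (\<integral>\<omega>. (I' t \<omega> - I' s \<omega> - (I t \<omega> - I s \<omega>))\<^sup>2 \<partial>M) \<le> 4 * (ennreal (2 * K\<^sup>2) *
      ((\<integral>\<^sup>+\<omega>. (\<integral>\<^sup>+r. ennreal ((norm (D r \<omega>))\<^sup>2) * indicator {s..t} r \<partial>lborel) \<partial>M) + ennreal ((t - s) * U)))" .
  also have "\<dots> \<le> 4 * (ennreal (2 * K\<^sup>2) * (ennreal ((t - s) * U) + ennreal ((t - s) * U)))"
    by (intro mult_left_mono add_right_mono D_time_integral) (use st U in auto)
  also have "\<dots> = ennreal (16 * K\<^sup>2 * (t - s) * U)"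
  proof -
    have nn: "0 \<le> (t - s) * U" using st U0 by simp
    have "4 * (ennreal (2 * K\<^sup>2) * (ennreal ((t - s) * U) + ennreal ((t - s) * U))) =
        ennreal 4 * (ennreal (2 * K\<^sup>2) * ennreal ((t - s) * U + (t - s) * U))"
      by (simp only: ennreal_plus[OF nn nn] ennreal_numeral)
    also have "\<dots> = ennreal (4 * (2 * K\<^sup>2 * ((t - s) * U + (t - s) * U)))"
      using nn by (simp only: ennreal_mult[symmetric] zero_le_mult_iff add_nonneg_nonneg zero_le_power2 zero_le_numeral simp_thms)
    finally show ?thesis by (simp add: algebra_simps)
  qed
  finally have "(\<integral>\<omega>. (I' t \<omega> - I' s \<omega> - (I t \<omega> - I s \<omega>))\<^sup>2 \<partial>M) \<le> 16 * K\<^sup>2 * (t - s) * U"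
    by (subst (asm) ennreal_le_iff) (use st U0 in auto)
  also have "\<dots> \<le> 16 * K\<^sup>2 * (e - s) * U" using st U0 by (intro mult_right_mono mult_left_mono) auto
  finally show ?thesis .
qed

text \<open>Separates the term controlled pathwise from those that require a maximal inequality:
  \<open>J\<close> bounds the drift increments for all times of the step at once, while each
  \<open>Z k i\<close> is a real martingale after s, in the weak orthogonality form, with value 0 at
  s.\<close>

lemma increment_decomposition:
  assumes se: "0 \<le> s" "s \<le> e" and U: "\<And>r. r \<in> {s..e} \<Longrightarrow> u r \<le> U"
  obtains J :: "(real \<Rightarrow> real^'m) \<Rightarrow> real" and Z :: "'m \<Rightarrow> 'n \<Rightarrow> real \<Rightarrow> (real \<Rightarrow> real^'m) \<Rightarrow> real" where
    "J \<in> borel_measurable M" "integrable M (\<lambda>\<omega>. (J \<omega>)\<^sup>2)" "(\<integral>\<omega>. (J \<omega>)\<^sup>2 \<partial>M) \<le> 4 * K\<^sup>2 * (e - s)\<^sup>2 * U"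
    "\<And>k i t. s \<le> t \<Longrightarrow> Z k i t \<in> borel_measurable (wiener_filtration M t)"
    "\<And>k i t. s \<le> t \<Longrightarrow> integrable M (\<lambda>\<omega>. (Z k i t \<omega>)\<^sup>2)"
    "\<And>k i t t' W. s \<le> t \<Longrightarrow> t \<le> t' \<Longrightarrow> W \<in> borel_measurable (wiener_filtration M t) \<Longrightarrow> integrable M (\<lambda>\<omega>. (W \<omega>)\<^sup>2) \<Longrightarrow>
       (\<integral>\<omega>. W \<omega> * (Z k i t' \<omega> - Z k i t \<omega>) \<partial>M) = 0"
    "\<And>k i t. t \<in> {s..e} \<Longrightarrow> (\<integral>\<omega>. (Z k i t \<omega>)\<^sup>2 \<partial>M) \<le> 16 * K\<^sup>2 * (e - s) * U"
    "AE \<omega> in M. \<forall>t\<in>{s..e}. norm (D t \<omega>) \<le> norm (D s \<omega>) + J \<omega> + (\<Sum>k\<in>UNIV. \<Sum>i\<in>UNIV. \<bar>Z k i t \<omega>\<bar>)"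
proof -
  have U0: "0 \<le> U" using U[of s] u_nonneg[of s] se by simp
  from X obtain I :: "'m \<Rightarrow> real \<Rightarrow> (real \<Rightarrow> real^'m) \<Rightarrow> real^'n" where
    I: "\<And>k i. is_ito_integral M (wiener_filtration M) (\<lambda>t \<omega>. \<omega> t $ k)
           (\<lambda>t \<omega>. V k (X t \<omega>) (distr M borel (X t)) $ i) (\<lambda>t \<omega>. I k t \<omega> $ i)"
    and eqX: "AE \<omega> in M. \<forall>t\<ge>0. X t \<omega> = x + (LINT r:{0..t}|lborel. V0 (X r \<omega>) (distr M borel (X r))) + (\<Sum>k\<in>UNIV. I k t \<omega>)"
    unfolding mckean_vlasov_solution_def by blast
  from Y obtain I' :: "'m \<Rightarrow> real \<Rightarrow> (real \<Rightarrow> real^'m) \<Rightarrow> real^'n" where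
    I': "\<And>k i. is_ito_integral M (wiener_filtration M) (\<lambda>t \<omega>. \<omega> t $ k)
           (\<lambda>t \<omega>. V k (Y t \<omega>) (distr M borel (Y t)) $ i) (\<lambda>t \<omega>. I' k t \<omega> $ i)"
    and eqY: "AE \<omega> in M. \<forall>t\<ge>0. Y t \<omega> = y + (LINT r:{0..t}|lborel. V0 (Y r \<omega>) (distr M borel (Y r))) + (\<Sum>k\<in>UNIV. I' k t \<omega>)"
    unfolding mckean_vlasov_solution_def by blast
  define Z where "Z k i t \<omega> = I' k t \<omega> $ i - I' k s \<omega> $ i - (I k t \<omega> $ i - I k s \<omega> $ i)" for k i t \<omega>
  \<comment> \<open>The absolute value only matters outside \<open>space M\<close>, where
    \<open>q\<close> need not be nonnegative.\<close>
  define J where "J \<omega> = sqrt (2 * K\<^sup>2 * (e - s) * \<bar>q s e \<omega> + (e - s) * U\<bar>)" for \<omega>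
  have IF: "(\<lambda>\<omega>. I k t \<omega> $ i) \<in> borel_measurable (wiener_filtration M t)" "(\<lambda>\<omega>. I' k t \<omega> $ i) \<in> borel_measurable (wiener_filtration M t)"
    if "0 \<le> t" for k i t
    using I I' that by (auto simp: is_ito_integral_def)
  have IM: "(\<lambda>\<omega>. I k t \<omega> $ i) \<in> borel_measurable M" "(\<lambda>\<omega>. I' k t \<omega> $ i) \<in> borel_measurable M"
    if "0 \<le> t" for k i t
    using bf.ito_measurable[OF I that] bf.ito_measurable[OF I' that] by auto
  have Isq: "integrable M (\<lambda>\<omega>. (I k t \<omega> $ i)\<^sup>2)" "integrable M (\<lambda>\<omega>. (I' k t \<omega> $ i)\<^sup>2)" if "0 \<le> t" for k i t
    using bf.ito_square_integrable[OF I that] bf.ito_square_integrable[OF I' that] by auto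
  have J2: "(J \<omega>)\<^sup>2 = 2 * K\<^sup>2 * (e - s) * (q s e \<omega> + (e - s) * U)" if "\<omega> \<in> space M" for \<omega>
    using ennreal_q(2)[OF se(1) that, of e] se U0 by (simp add: J_def)
  note qi = q_expectation[OF se U]
  show ?thesis
  proof (rule that[of J Z])
    show "J \<in> borel_measurable M"
      unfolding J_def[abs_def] using q_measurable[OF se(1), of e] by measurable
    have J2i: "integrable M (\<lambda>\<omega>. 2 * K\<^sup>2 * (e - s) * (q s e \<omega> + (e - s) * U))" using qi(1) by simp
    then show "integrable M (\<lambda>\<omega>. (J \<omega>)\<^sup>2)" by (subst Bochner_Integration.integrable_cong[OF refl J2]) auto
    have "(\<integral>\<omega>. (J \<omega>)\<^sup>2 \<partial>M) = (\<integral>\<omega>. 2 * K\<^sup>2 * (e - s) * (q s e \<omega> + (e - s) * U) \<partial>M)"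
      by (rule Bochner_Integration.integral_cong[OF refl J2])
    also have "\<dots> = 2 * K\<^sup>2 * (e - s) * ((\<integral>\<omega>. q s e \<omega> \<partial>M) + (e - s) * U)" using qi(1) by (simp add: prob_space)
    also have "\<dots> \<le> 2 * K\<^sup>2 * (e - s) * ((e - s) * U + (e - s) * U)"
      using qi(2) se by (intro mult_left_mono add_right_mono) auto
    also have "\<dots> = 4 * K\<^sup>2 * (e - s)\<^sup>2 * U" by (simp add: power2_eq_square algebra_simps)
    finally show "(\<integral>\<omega>. (J \<omega>)\<^sup>2 \<partial>M) \<le> 4 * K\<^sup>2 * (e - s)\<^sup>2 * U" .
    show "Z k i t \<in> borel_measurable (wiener_filtration M t)" if "s \<le> t" for k i t
      unfolding Z_def[abs_def] using that se
      by (intro borel_measurable_diff IF bf.measurable_F_mono[OF se(1) that IF(1)] bf.measurable_F_mono[OF se(1) that IF(2)]) auto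
    show "integrable M (\<lambda>\<omega>. (Z k i t \<omega>)\<^sup>2)" if "s \<le> t" for k i t
      unfolding Z_def using that se
      by (intro bf.integrable_square_diff borel_measurable_diff IM Isq) auto
    show "(\<integral>\<omega>. W \<omega> * (Z k i t' \<omega> - Z k i t \<omega>) \<partial>M) = 0"
      if t: "s \<le> t" "t \<le> t'" and W: "W \<in> borel_measurable (wiener_filtration M t)" "integrable M (\<lambda>\<omega>. (W \<omega>)\<^sup>2)"
      for k i t t' W
    proof -
      have t0: "0 \<le> t" "0 \<le> t'" using t se by auto
      have WM: "W \<in> borel_measurable M" by (rule bf.measurable_F_M[OF t0(1) W(1)])
      have "(\<integral>\<omega>. W \<omega> * (Z k i t' \<omega> - Z k i t \<omega>) \<partial>M) =
         (\<integral>\<omega>. W \<omega> * (I' k t' \<omega> $ i - I' k t \<omega> $ i) - W \<omega> * (I k t' \<omega> $ i - I k t \<omega> $ i) \<partial>M)"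
        by (simp add: Z_def algebra_simps)
      also have "\<dots> = (\<integral>\<omega>. W \<omega> * (I' k t' \<omega> $ i - I' k t \<omega> $ i) \<partial>M) - (\<integral>\<omega>. W \<omega> * (I k t' \<omega> $ i - I k t \<omega> $ i) \<partial>M)"
        by (intro Bochner_Integration.integral_diff bf.integrable_mult_of_squares WM W(2) borel_measurable_diff
             bf.integrable_square_diff IM Isq t0)
      also have "\<dots> = 0" using bf.ito_orthogonal[OF I t0(1) t(2) W] bf.ito_orthogonal[OF I' t0(1) t(2) W] by simp
      finally show ?thesis .
    qed
    show "(\<integral>\<omega>. (Z k i t \<omega>)\<^sup>2 \<partial>M) \<le> 16 * K\<^sup>2 * (e - s) * U" if "t \<in> {s..e}" for k i t
      unfolding Z_def by (rule ito_difference_bound[OF I I' se(1)]) (use that U in auto)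
    show "AE \<omega> in M. \<forall>t\<in>{s..e}. norm (D t \<omega>) \<le> norm (D s \<omega>) + J \<omega> + (\<Sum>k\<in>UNIV. \<Sum>i\<in>UNIV. \<bar>Z k i t \<omega>\<bar>)"
      using eqX eqY AE_space
    proof eventually_elim
      case (elim \<omega>)
      show ?case
      proof
        fix t assume t: "t \<in> {s..e}"
        then have t0: "0 \<le> t" using se by simp
        let ?b = "\<lambda>W a. LINT r:{0..a}|lborel. V0 (W r \<omega>) (distr M borel (W r))"
        let ?A = "?b Y t - ?b Y s - (?b X t - ?b X s)"
        let ?S = "\<Sum>k\<in>UNIV. I' k t \<omega> - I' k s \<omega> - (I k t \<omega> - I k s \<omega>)"
        have alg: "y + a + i - (x + a' + i') = y + b + j - (x + b' + j') + (a - b - (a' - b')) + (i - j - (i' - j'))"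
          for a b a' b' i j i' j' :: "real^'n" by (simp add: algebra_simps)
        have S: "?S = (\<Sum>k\<in>UNIV. I' k t \<omega>) - (\<Sum>k\<in>UNIV. I' k s \<omega>) - ((\<Sum>k\<in>UNIV. I k t \<omega>) - (\<Sum>k\<in>UNIV. I k s \<omega>))"
          by (simp only: sum_subtractf)
        have "D t \<omega> = D s \<omega> + ?A + ?S"
          unfolding S D_def elim(1)[rule_format, OF t0] elim(2)[rule_format, OF t0]
            elim(1)[rule_format, OF se(1)] elim(2)[rule_format, OF se(1)]
          by (rule alg)
        moreover have "norm (D s \<omega> + ?A + ?S) \<le> norm (D s \<omega>) + norm ?A + norm ?S"
          by (rule order_trans[OF norm_triangle_ineq add_right_mono[OF norm_triangle_ineq]])
        ultimately have "norm (D t \<omega>) \<le> norm (D s \<omega>) + norm ?A + norm ?S" by (simp only:)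
        moreover have "norm ?A \<le> J \<omega>"
        proof -
          have "norm ?A \<le> sqrt (2 * K\<^sup>2 * (e - s) * (q s e \<omega> + (e - s) * U))"
            by (rule drift_increment_bound[OF se(1)]) (use t elim U in auto)
          also have "\<dots> \<le> J \<omega>" unfolding J_def using se by (intro real_sqrt_le_mono mult_left_mono) auto
          finally show ?thesis .
        qed
        moreover have "norm ?S \<le> (\<Sum>k\<in>UNIV. \<Sum>i\<in>UNIV. \<bar>Z k i t \<omega>\<bar>)"
        proof -
          have "norm ?S \<le> (\<Sum>k\<in>UNIV. norm (I' k t \<omega> - I' k s \<omega> - (I k t \<omega> - I k s \<omega>)))" by (rule norm_sum)
          also have "\<dots> \<le> (\<Sum>k\<in>UNIV. \<Sum>i\<in>UNIV. \<bar>(I' k t \<omega> - I' k s \<omega> - (I k t \<omega> - I k s \<omega>)) $ i\<bar>)"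
            by (intro sum_mono norm_le_l1_cart)
          finally show ?thesis by (simp add: Z_def)
        qed
        ultimately show "norm (D t \<omega>) \<le> norm (D s \<omega>) + J \<omega> + (\<Sum>k\<in>UNIV. \<Sum>i\<in>UNIV. \<bar>Z k i t \<omega>\<bar>)" by linarith
      qed
    qed
  qed
qed

end

section \<open>Growth over steps of fixed length\<close>

lemma square_sum_three:
  fixes a b c :: real
  shows "(a + b + c)\<^sup>2 \<le> 3 * a\<^sup>2 + 3 * b\<^sup>2 + 3 * c\<^sup>2"
proof -
  have "0 \<le> (a - b)\<^sup>2 + (b - c)\<^sup>2 + (a - c)\<^sup>2" by simp
  then show ?thesis by (simp add: power2_eq_square algebra_simps)
qed

text \<open>The condition \<open>small\<close> says that drift and martingale terms together
  contribute at most half of the supremum of \<open>u\<close> over a step of length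
  \<open>h\<close>; \<open>h <= 1\<close> allows h^2 to be replaced by h. Neither constant depends
  on the starting points.\<close>

locale mckean_vlasov_growth = mckean_vlasov_pair M V0 V K x y X Y
  for M :: "(real \<Rightarrow> real^'m) measure"
    and V0 :: "real^'n \<Rightarrow> (real^'n) measure \<Rightarrow> real^'n"
    and V :: "'m \<Rightarrow> real^'n \<Rightarrow> (real^'n) measure \<Rightarrow> real^'n"
    and K :: real
    and x y :: "real^'n" and X Y :: "real \<Rightarrow> (real \<Rightarrow> real^'m) \<Rightarrow> real^'n" +
  fixes p h :: real
  assumes p_def: "p = 3 + 3 * real CARD('m) * real CARD('n)"
    and h: "0 < h" "h \<le> 1"
    and small: "p * (4 * K\<^sup>2 + 16 * real CARD('m) * real CARD('n) * K\<^sup>2) * h \<le> 1 / 2"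
begin

text \<open>The supremum \<open>U\<close> of \<open>u\<close> over a short step reappears on the right with factor \<open>1/2\<close> and is
  absorbed; \<open>p\<close> is the constant of \<open>(a + b + c)\<^sup>2 \<le> 3 (a\<^sup>2 + b\<^sup>2 + c\<^sup>2)\<close> when \<open>c\<close> is itself a sum
  over \<open>'m\<close> and \<open>'n\<close>.\<close>

lemma u_growth:
  assumes s: "0 \<le> s" and t: "t \<in> {s..s + h}"
  shows "u t \<le> 2 * p * u s"
proof -
  let ?mn = "real CARD('m) * real CARD('n)"
  obtain C where C: "\<And>t. t \<in> {0..s + h} \<Longrightarrow> u t \<le> C"
    by (rule u_bounded[of "s + h"]) (use s h in auto)
  define U where "U = (SUP t\<in>{s..s + h}. u t)"
  have bdd: "bdd_above (u ` {s..s + h})" using C s by (intro bdd_aboveI2[where M = C]) auto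
  have U: "u r \<le> U" if "r \<in> {s..s + h}" for r unfolding U_def by (rule cSUP_upper[OF that bdd])
  have U0: "0 \<le> U" using U[of s] u_nonneg[of s] h by simp
  have se: "s \<le> s + h" using h by simp
  obtain J and Z :: "'m \<Rightarrow> 'n \<Rightarrow> real \<Rightarrow> (real \<Rightarrow> real^'m) \<Rightarrow> real" where
    J[measurable]: "J \<in> borel_measurable M" and J2: "integrable M (\<lambda>\<omega>. (J \<omega>)\<^sup>2)" "(\<integral>\<omega>. (J \<omega>)\<^sup>2 \<partial>M) \<le> 4 * K\<^sup>2 * (s + h - s)\<^sup>2 * U"
    and Zi: "\<And>k i t. s \<le> t \<Longrightarrow> integrable M (\<lambda>\<omega>. (Z k i t \<omega>)\<^sup>2)"
    and Z2: "\<And>k i t. t \<in> {s..s + h} \<Longrightarrow> (\<integral>\<omega>. (Z k i t \<omega>)\<^sup>2 \<partial>M) \<le> 16 * K\<^sup>2 * (s + h - s) * U"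
    and D: "AE \<omega> in M. \<forall>t\<in>{s..s + h}. norm (D t \<omega>) \<le> norm (D s \<omega>) + J \<omega> + (\<Sum>k\<in>UNIV. \<Sum>i\<in>UNIV. \<bar>Z k i t \<omega>\<bar>)"
    by (rule increment_decomposition[OF s se U]) (assumption | rule that)+
  have bound: "u t \<le> p * u s + U / 2" if t: "t \<in> {s..s + h}" for t
  proof -
    have t0: "0 \<le> t" "s \<le> t" using t s by auto
    have p3: "3 \<le> p" "3 * ?mn \<le> p" by (auto simp: p_def)
    have p0: "0 \<le> p" using p3 by simp
    let ?R = "\<lambda>\<omega>. p * (norm (D s \<omega>))\<^sup>2 + p * (J \<omega>)\<^sup>2 + p * (\<Sum>k\<in>UNIV. \<Sum>i\<in>UNIV. (Z k i t \<omega>)\<^sup>2)"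
    have Ri: "integrable M (\<lambda>\<omega>. p * (norm (D s \<omega>))\<^sup>2)" "integrable M (\<lambda>\<omega>. p * (J \<omega>)\<^sup>2)"
      "integrable M (\<lambda>\<omega>. p * (\<Sum>k\<in>UNIV. \<Sum>i\<in>UNIV. (Z k i t \<omega>)\<^sup>2))"
      using D_square_integrable[OF s] J2(1) Zi[OF t0(2)] by auto
    have "u t \<le> (\<integral>\<omega>. ?R \<omega> \<partial>M)"
      unfolding u_def
    proof (rule integral_mono_AE[OF D_square_integrable[OF t0(1)]])
      show "integrable M ?R" by (intro Bochner_Integration.integrable_add Ri)
      show "AE \<omega> in M. (norm (D t \<omega>))\<^sup>2 \<le> ?R \<omega>"
        using D
      proof eventually_elim
        case (elim \<omega>)
        let ?S = "\<Sum>k\<in>UNIV. \<Sum>i\<in>UNIV. \<bar>Z k i t \<omega>\<bar>"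
        have S2: "?S\<^sup>2 \<le> ?mn * (\<Sum>k\<in>UNIV. \<Sum>i\<in>UNIV. (Z k i t \<omega>)\<^sup>2)"
          using sum_square_le_card_mult_sum_squares[of "\<lambda>(k, i). \<bar>Z k i t \<omega>\<bar>" "UNIV \<times> UNIV"]
          by (simp add: sum.cartesian_product case_prod_beta card_cartesian_product)
        have "(norm (D t \<omega>))\<^sup>2 \<le> (norm (D s \<omega>) + J \<omega> + ?S)\<^sup>2"
          by (rule power_mono) (use elim t in auto)
        also have "\<dots> \<le> 3 * (norm (D s \<omega>))\<^sup>2 + 3 * (J \<omega>)\<^sup>2 + 3 * ?S\<^sup>2" by (rule square_sum_three)
        also have "\<dots> \<le> p * (norm (D s \<omega>))\<^sup>2 + p * (J \<omega>)\<^sup>2 + (3 * ?mn) * (\<Sum>k\<in>UNIV. \<Sum>i\<in>UNIV. (Z k i t \<omega>)\<^sup>2)"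
          using p3 S2 by (intro add_mono mult_right_mono) auto
        also have "\<dots> \<le> ?R \<omega>"
          using p3 by (intro add_mono mult_right_mono sum_nonneg) auto
        finally show ?case .
      qed
    qed
    also have "\<dots> = p * u s + p * (\<integral>\<omega>. (J \<omega>)\<^sup>2 \<partial>M) + p * (\<Sum>k\<in>UNIV. \<Sum>i\<in>UNIV. (\<integral>\<omega>. (Z k i t \<omega>)\<^sup>2 \<partial>M))"
    proof -
      have "(\<integral>\<omega>. ?R \<omega> \<partial>M) = (\<integral>\<omega>. p * (norm (D s \<omega>))\<^sup>2 \<partial>M) + (\<integral>\<omega>. p * (J \<omega>)\<^sup>2 \<partial>M) +
          (\<integral>\<omega>. p * (\<Sum>k\<in>UNIV. \<Sum>i\<in>UNIV. (Z k i t \<omega>)\<^sup>2) \<partial>M)"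
        by (subst Bochner_Integration.integral_add[OF Bochner_Integration.integrable_add[OF Ri(1,2)] Ri(3)],
            subst Bochner_Integration.integral_add[OF Ri(1,2)]) simp
      also have "(\<integral>\<omega>. (\<Sum>k\<in>UNIV. \<Sum>i\<in>UNIV. (Z k i t \<omega>)\<^sup>2) \<partial>M) = (\<Sum>k\<in>UNIV. \<Sum>i\<in>UNIV. (\<integral>\<omega>. (Z k i t \<omega>)\<^sup>2 \<partial>M))"
        by (subst Bochner_Integration.integral_sum, intro Bochner_Integration.integrable_sum Zi t0,
            intro sum.cong refl Bochner_Integration.integral_sum Zi t0)
      then have "(\<integral>\<omega>. p * (\<Sum>k\<in>UNIV. \<Sum>i\<in>UNIV. (Z k i t \<omega>)\<^sup>2) \<partial>M) = p * (\<Sum>k\<in>UNIV. \<Sum>i\<in>UNIV. (\<integral>\<omega>. (Z k i t \<omega>)\<^sup>2 \<partial>M))"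
        by simp
      finally show ?thesis by (simp add: u_def)
    qed
    also have "\<dots> \<le> p * u s + p * (4 * K\<^sup>2 * h * U) + p * (\<Sum>k\<in>(UNIV::'m set). \<Sum>i\<in>(UNIV::'n set). 16 * K\<^sup>2 * h * U)"
    proof (intro add_mono mult_left_mono sum_mono order_refl p0)
      \<comment> \<open>The drift contributes order h^2 and the martingale part order h; they are
        brought to the same order.\<close>
      have "h\<^sup>2 \<le> h" using h by (simp add: power2_eq_square mult_left_le)
      then have "4 * K\<^sup>2 * h\<^sup>2 * U \<le> 4 * K\<^sup>2 * h * U" using U0 by (intro mult_right_mono mult_left_mono) auto
      then show "(\<integral>\<omega>. (J \<omega>)\<^sup>2 \<partial>M) \<le> 4 * K\<^sup>2 * h * U" using J2(2) by simp
      show "(\<integral>\<omega>. (Z k i t \<omega>)\<^sup>2 \<partial>M) \<le> 16 * K\<^sup>2 * h * U" for k i using Z2[OF t, of k i] by simp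
    qed
    also have "\<dots> = p * u s + (p * (4 * K\<^sup>2 + 16 * real CARD('m) * real CARD('n) * K\<^sup>2) * h) * U"
      by (simp add: algebra_simps)
    also have "\<dots> \<le> p * u s + (1 / 2) * U" using small U0 by (intro add_left_mono mult_right_mono)
    finally show ?thesis by simp
  qed
  \<comment> \<open>The bound holds for every t of the step, hence for the supremum, and
    \<open>U\<close> is finite, so half of it may be subtracted.\<close>
  have "U \<le> p * u s + U / 2"
    unfolding U_def[symmetric] by (subst U_def, rule cSUP_least) (use bound h in auto)
  then have "U \<le> 2 * p * u s" by simp
  then show ?thesis using U[OF t] by simp
qed

text \<open>If the norm exceeds c somewhere, then the starting value or \<open>J\<close> exceeds
  c/3, or some \<open>Z k i\<close> exceeds c/(3mn), where mn is the number of pairs (k, i).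
  Chebyshev's inequality treats the first two and the maximal inequality the last. With U = 2 p u(s)
  the constants are 9, 9*4*2 and 9*16*2; the cube of mn is its square from the level times the
  number of events.\<close>

lemma D_maximal:
  assumes s: "0 \<le> s" and T: "countable T" "T \<subseteq> {s..s + h}" and c: "0 < c"
  shows "prob {\<omega>\<in>space M. \<exists>t\<in>T. norm (D t \<omega>) > c} \<le>
    (9 + 72 * p * K\<^sup>2 + 288 * p * K\<^sup>2 * (real CARD('m) * real CARD('n)) ^ 3) * u s / c\<^sup>2"
proof -
  let ?mn = "real CARD('m) * real CARD('n)"
  define U where "U = 2 * p * u s"
  have U: "u r \<le> U" if "r \<in> {s..s + h}" for r unfolding U_def by (rule u_growth[OF s that])
  have U0: "0 \<le> U" using U[of s] u_nonneg[of s] h by simp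
  have se: "s \<le> s + h" using h by simp
  have mn: "0 < ?mn" by simp
  obtain J and Z :: "'m \<Rightarrow> 'n \<Rightarrow> real \<Rightarrow> (real \<Rightarrow> real^'m) \<Rightarrow> real" where
    J[measurable]: "J \<in> borel_measurable M" and J2: "integrable M (\<lambda>\<omega>. (J \<omega>)\<^sup>2)" "(\<integral>\<omega>. (J \<omega>)\<^sup>2 \<partial>M) \<le> 4 * K\<^sup>2 * (s + h - s)\<^sup>2 * U"
    and Zm: "\<And>k i t. s \<le> t \<Longrightarrow> Z k i t \<in> borel_measurable (wiener_filtration M t)"
    and Zi: "\<And>k i t. s \<le> t \<Longrightarrow> integrable M (\<lambda>\<omega>. (Z k i t \<omega>)\<^sup>2)"
    and Zo: "\<And>k i t t' W. s \<le> t \<Longrightarrow> t \<le> t' \<Longrightarrow> W \<in> borel_measurable (wiener_filtration M t) \<Longrightarrow> integrable M (\<lambda>\<omega>. (W \<omega>)\<^sup>2) \<Longrightarrow>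
       (\<integral>\<omega>. W \<omega> * (Z k i t' \<omega> - Z k i t \<omega>) \<partial>M) = 0"
    and Z2: "\<And>k i t. t \<in> {s..s + h} \<Longrightarrow> (\<integral>\<omega>. (Z k i t \<omega>)\<^sup>2 \<partial>M) \<le> 16 * K\<^sup>2 * (s + h - s) * U"
    and D: "AE \<omega> in M. \<forall>t\<in>{s..s + h}. norm (D t \<omega>) \<le> norm (D s \<omega>) + J \<omega> + (\<Sum>k\<in>UNIV. \<Sum>i\<in>UNIV. \<bar>Z k i t \<omega>\<bar>)"
    by (rule increment_decomposition[OF s se U]) (assumption | rule that)+
  define c' where "c' = c / (3 * ?mn)"
  have c': "0 < c'" using c mn by (simp add: c'_def)
  define A where "A = {\<omega>\<in>space M. \<bar>norm (D s \<omega>)\<bar> > c / 3}"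
  define B where "B = {\<omega>\<in>space M. \<bar>J \<omega>\<bar> > c / 3}"
  define E where "E k i = {\<omega>\<in>space M. \<exists>t\<in>T. \<bar>Z k i t \<omega>\<bar> > c'}" for k i
  note [measurable] = D_measurable[OF s]
  have AM[measurable]: "A \<in> sets M" unfolding A_def by measurable
  have BM[measurable]: "B \<in> sets M" unfolding B_def by measurable
  have EM[measurable]: "E k i \<in> sets M" and Eb: "c'\<^sup>2 * prob (E k i) \<le> 16 * K\<^sup>2 * h * U" for k i
  proof -
    have mi: "E k i \<in> sets M" "c'\<^sup>2 * prob (E k i) \<le> (\<integral>\<omega>. (Z k i (s + h) \<omega>)\<^sup>2 \<partial>M)"
      unfolding E_def
      by (rule bf.maximal_inequality[of s "Z k i" "s + h" T c', OF Zm Zi Zo s se T c']; assumption)+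
    then show "E k i \<in> sets M" by simp
    show "c'\<^sup>2 * prob (E k i) \<le> 16 * K\<^sup>2 * h * U" using mi(2) Z2[of "s + h" k i] h by simp
  qed
  have "prob {\<omega>\<in>space M. \<exists>t\<in>T. norm (D t \<omega>) > c} \<le> prob (A \<union> B \<union> (\<Union>k. \<Union>i. E k i))"
  proof (rule finite_measure_mono_AE)
    show "AE \<omega> in M. \<omega> \<in> {\<omega>\<in>space M. \<exists>t\<in>T. norm (D t \<omega>) > c} \<longrightarrow> \<omega> \<in> A \<union> B \<union> (\<Union>k. \<Union>i. E k i)"
      using D
    proof eventually_elim
      case (elim \<omega>)
      show ?case
      proof (intro impI, rule ccontr)
        assume "\<omega> \<in> {\<omega>\<in>space M. \<exists>t\<in>T. norm (D t \<omega>) > c}"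
        then obtain t where \<omega>: "\<omega> \<in> space M" and t: "t \<in> T" "norm (D t \<omega>) > c" by auto
        assume "\<omega> \<notin> A \<union> B \<union> (\<Union>k. \<Union>i. E k i)"
        then have a: "norm (D s \<omega>) \<le> c / 3" and b: "J \<omega> \<le> c / 3" and e: "\<bar>Z k i t \<omega>\<bar> \<le> c'" for k i
          using \<omega> t(1) by (auto simp: A_def B_def E_def not_less)
        have "(\<Sum>k\<in>UNIV. \<Sum>i\<in>UNIV. \<bar>Z k i t \<omega>\<bar>) \<le> (\<Sum>k\<in>(UNIV::'m set). \<Sum>i\<in>(UNIV::'n set). c')"
          by (intro sum_mono e)
        also have "\<dots> = c / 3" by (simp add: c'_def)
        finally show False using a b t elim T(2) by force
      qed
    qed
  qed auto
  also have "\<dots> \<le> prob A + prob B + prob (\<Union>k. \<Union>i. E k i)" (is "_ \<le> ?bound")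
    using measure_Un_le[OF AM BM] measure_Un_le[of "A \<union> B" M "\<Union>k. \<Union>i. E k i"] by simp
  finally have total: "prob {\<omega>\<in>space M. \<exists>t\<in>T. norm (D t \<omega>) > c} \<le> ?bound" .
  have E1: "prob (\<Union>k. \<Union>i. E k i) \<le> (\<Sum>k\<in>UNIV. \<Sum>i\<in>UNIV. prob (E k i))"
  proof -
    have "prob (\<Union>k. \<Union>i. E k i) \<le> (\<Sum>k\<in>UNIV. prob (\<Union>i. E k i))"
      by (rule finite_measure_subadditive_finite) auto
    also have "\<dots> \<le> (\<Sum>k\<in>UNIV. \<Sum>i\<in>UNIV. prob (E k i))"
      by (intro sum_mono finite_measure_subadditive_finite) auto
    finally show ?thesis .
  qed
  have E2: "(\<Sum>k\<in>UNIV. \<Sum>i\<in>UNIV. prob (E k i)) \<le> (\<Sum>k\<in>(UNIV::'m set). \<Sum>i\<in>(UNIV::'n set). 16 * K\<^sup>2 * h * U / c'\<^sup>2)"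
    using Eb c' by (intro sum_mono) (simp add: le_divide_eq mult.commute)
  have Ab: "prob A \<le> 9 * u s / c\<^sup>2"
  proof -
    have "prob A \<le> u s / (c / 3)\<^sup>2"
      unfolding A_def u_def by (rule second_moment_Markov) (use D_square_integrable[OF s] c in auto)
    then show ?thesis by (simp add: power_divide mult.commute)
  qed
  have Bb: "prob B \<le> 72 * p * K\<^sup>2 * u s / c\<^sup>2"
  proof -
    have "prob B \<le> (\<integral>\<omega>. (J \<omega>)\<^sup>2 \<partial>M) / (c / 3)\<^sup>2"
      unfolding B_def by (rule second_moment_Markov[OF J J2(1)]) (use c in simp)
    also have "\<dots> \<le> (4 * K\<^sup>2 * U) / (c / 3)\<^sup>2"
    proof (rule divide_right_mono)
      have "h\<^sup>2 \<le> 1" using h by (simp add: power_le_one)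
      then have "4 * K\<^sup>2 * h\<^sup>2 * U \<le> 4 * K\<^sup>2 * 1 * U" using U0 by (intro mult_right_mono mult_left_mono) auto
      then show "(\<integral>\<omega>. (J \<omega>)\<^sup>2 \<partial>M) \<le> 4 * K\<^sup>2 * U" using J2(2) by simp
    qed simp
    also have "\<dots> = 72 * p * K\<^sup>2 * u s / c\<^sup>2" by (simp add: U_def power_divide)
    finally show ?thesis .
  qed
  have E3: "(\<Sum>k\<in>(UNIV::'m set). \<Sum>i\<in>(UNIV::'n set). 16 * K\<^sup>2 * h * U / c'\<^sup>2) \<le> 288 * p * K\<^sup>2 * ?mn ^ 3 * u s / c\<^sup>2"
  proof -
    have "16 * K\<^sup>2 * h * U / c'\<^sup>2 \<le> 16 * K\<^sup>2 * 1 * U / c'\<^sup>2"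
      using h U0 by (intro divide_right_mono mult_right_mono mult_left_mono) auto
    then have "?mn * (16 * K\<^sup>2 * h * U / c'\<^sup>2) \<le> ?mn * (16 * K\<^sup>2 * 1 * U / c'\<^sup>2)" by (rule mult_left_mono) simp
    also have "\<dots> = 288 * p * K\<^sup>2 * ?mn ^ 3 * u s / c\<^sup>2"
      using c by (simp add: c'_def U_def power_divide power_mult_distrib power2_eq_square power3_eq_cube field_simps)
    finally show ?thesis by simp
  qed
  have "(9 + 72 * p * K\<^sup>2 + 288 * p * K\<^sup>2 * ?mn ^ 3) * u s / c\<^sup>2 =
      9 * u s / c\<^sup>2 + 72 * p * K\<^sup>2 * u s / c\<^sup>2 + 288 * p * K\<^sup>2 * ?mn ^ 3 * u s / c\<^sup>2"
    by (simp only: distrib_right add_divide_distrib)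
  then show ?thesis using total E1 E2 E3 Ab Bb by linarith
qed

text \<open>The initial value has to be read off from the almost sure integral equation at time 0,
  where the drift integral is over a single point and the stochastic integrals vanish by
  \<open>ito_at_zero\<close>.\<close>

lemma u_zero: "u 0 = (norm (y - x))\<^sup>2"
proof -
  have start: "AE \<omega> in M. W 0 \<omega> = w" if W: "mckean_vlasov_solution M V0 V w W" for w W
  proof -
    from W obtain I :: "'m \<Rightarrow> real \<Rightarrow> (real \<Rightarrow> real^'m) \<Rightarrow> real^'n" where
      I: "\<And>k i. is_ito_integral M (wiener_filtration M) (\<lambda>t \<omega>. \<omega> t $ k)
             (\<lambda>t \<omega>. V k (W t \<omega>) (distr M borel (W t)) $ i) (\<lambda>t \<omega>. I k t \<omega> $ i)"
      and eq: "AE \<omega> in M. \<forall>t\<ge>0. W t \<omega> = w + (LINT r:{0..t}|lborel. V0 (W r \<omega>) (distr M borel (W r))) + (\<Sum>k\<in>UNIV. I k t \<omega>)"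
      unfolding mckean_vlasov_solution_def by blast
    have "AE \<omega> in M. \<forall>k\<in>UNIV. \<forall>i\<in>UNIV. I k 0 \<omega> $ i = 0"
      by (intro AE_finite_allI finite bf.ito_at_zero[OF I])
    with eq show ?thesis
    proof eventually_elim
      case (elim \<omega>)
      have "I k 0 \<omega> = 0" for k using elim(2) by (simp add: vec_eq_iff)
      moreover have "(LINT r:{0..0}|lborel. V0 (W r \<omega>) (distr M borel (W r))) = 0"
      proof -
        have "(LINT r:{0..0}|lborel. V0 (W r \<omega>) (distr M borel (W r))) =
          integral\<^sup>L lborel (\<lambda>r::real. indicator {0} r *\<^sub>R V0 (W 0 \<omega>) (distr M borel (W 0)))"
          unfolding set_lebesgue_integral_def by (intro Bochner_Integration.integral_cong) (auto simp: indicator_def)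
        also have "\<dots> = 0" by simp
        finally show ?thesis .
      qed
      ultimately show ?case using elim(1)[rule_format, of 0] by simp
    qed
  qed
  have "u 0 = (\<integral>\<omega>. (norm (y - x))\<^sup>2 \<partial>M)"
    unfolding u_def
  proof (rule integral_cong_AE)
    show "(\<lambda>\<omega>. (norm (D 0 \<omega>))\<^sup>2) \<in> borel_measurable M" using D_measurable[of 0] by simp
    show "AE \<omega> in M. (norm (D 0 \<omega>))\<^sup>2 = (norm (y - x))\<^sup>2"
      using start[OF X] start[OF Y] by eventually_elim (simp add: D_def)
  qed simp
  then show ?thesis by (simp add: prob_space)
qed

lemma u_grid:
  shows "u (real n * h) \<le> (2 * p) ^ n * (norm (y - x))\<^sup>2"
proof (induction n)
  case 0
  then show ?case by (simp add: u_zero)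
next
  case (Suc n)
  have "u (real (Suc n) * h) \<le> 2 * p * u (real n * h)"
    by (rule u_growth) (use h in \<open>auto simp: algebra_simps\<close>)
  also have "\<dots> \<le> 2 * p * ((2 * p) ^ n * (norm (y - x))\<^sup>2)"
    using Suc by (intro mult_left_mono) (auto simp: p_def)
  finally show ?case by simp
qed

end

section \<open>Growth of the Jacobian\<close>

text \<open>The strict inequality leaves a margin, and the linearisation error along
  \<open>v\<close> is eventually smaller than that margin. Obtaining all large j, and not merely
  infinitely many, is what yields a limit inferior of events later.\<close>

lemma has_derivative_difference_quotient_gt:
  fixes f :: "'a::real_normed_vector \<Rightarrow> 'b::real_normed_vector"
  assumes f: "(f has_derivative f') (at x)" and c: "norm (f' v) > c"
  shows "\<forall>\<^sub>F j in sequentially. norm (f (x + (1 / real (Suc j)) *\<^sub>R v) - f x) > c / real (Suc j)"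
proof -
  \<comment> \<open>Half of the margin; adding 1 to the norm covers the direction 0.\<close>
  define e where "e = (norm (f' v) - c) / (2 * (norm v + 1))"
  have e: "0 < e" using c by (simp add: e_def add_nonneg_pos)
  have ev: "e * norm v < norm (f' v) - c"
  proof -
    have "e * norm v \<le> e * (norm v + 1)" using e by simp
    also have "\<dots> = (norm (f' v) - c) / 2" using add_nonneg_pos[of "norm v" 1] by (simp add: e_def field_simps)
    also have "\<dots> < norm (f' v) - c" using c by simp
    finally show ?thesis .
  qed
  have lin: "bounded_linear f'" using f by (rule has_derivative_bounded_linear)
  from f[unfolded has_derivative_at_alt] e obtain d where d: "0 < d"
    and D: "\<And>z. norm (z - x) < d \<Longrightarrow> norm (f z - f x - f' (z - x)) \<le> e * norm (z - x)" by blast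
  have "(\<lambda>j. (1 / real (Suc j)) * norm v) \<longlonglongrightarrow> 0 * norm v"
    by (intro tendsto_mult tendsto_const LIMSEQ_inverse_real_of_nat[unfolded inverse_eq_divide])
  then have "\<forall>\<^sub>F j in sequentially. (1 / real (Suc j)) * norm v < d"
    using d by (intro order_tendstoD(2)) auto
  then show ?thesis
  proof eventually_elim
    case (elim j)
    let ?a = "1 / real (Suc j)"
    have a: "0 < ?a" by simp
    have "norm (f (x + ?a *\<^sub>R v) - f x - f' (?a *\<^sub>R v)) \<le> e * norm (?a *\<^sub>R v)"
      using D[of "x + ?a *\<^sub>R v"] elim by simp
    moreover have "f' (?a *\<^sub>R v) = ?a *\<^sub>R f' v" by (rule linear_scale[OF bounded_linear.linear[OF lin]])
    ultimately have "norm (f (x + ?a *\<^sub>R v) - f x - ?a *\<^sub>R f' v) \<le> ?a * (e * norm v)" by simp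
    moreover have "norm (?a *\<^sub>R f' v) \<le> norm (f (x + ?a *\<^sub>R v) - f x) + norm (f (x + ?a *\<^sub>R v) - f x - ?a *\<^sub>R f' v)"
      by (metis norm_minus_commute norm_triangle_sub add.commute)
    moreover have "?a * (e * norm v) < ?a * (norm (f' v) - c)" using a ev by (intro mult_strict_left_mono)
    ultimately have "?a * c < norm (f (x + ?a *\<^sub>R v) - f x)" by (simp add: right_diff_distrib)
    then show ?case by simp
  qed
qed

lemma continuous_on_matrix_vector_mult:
  fixes A :: "real \<Rightarrow> real^'n^'n"
  assumes "continuous_on S A"
  shows "continuous_on S (\<lambda>t. A t *v v)"
  unfolding matrix_vector_mult_def by (intro continuous_on_vec_lambda continuous_intros assms)

text \<open>A rational time of step n at which the Jacobian exceeds (2p)^n in direction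
  \<open>v\<close> puts \<omega> into \<open>B n j\<close> for all large j. \<open>D_maximal\<close>
  and \<open>u_grid\<close> bound each \<open>B n j\<close> by a multiple of (2p)^(-n) that does not
  depend on j, and Borel-Cantelli applies to the limit inferior in j.\<close>

lemma jacobian_grid_bound:
  fixes M :: "(real \<Rightarrow> real^'m) measure"
    and V0 :: "real^'n \<Rightarrow> (real^'n) measure \<Rightarrow> real^'n"
    and V :: "'m \<Rightarrow> real^'n \<Rightarrow> (real^'n) measure \<Rightarrow> real^'n"
    and \<Phi> :: "real^'n \<Rightarrow> real \<Rightarrow> (real \<Rightarrow> real^'m) \<Rightarrow> real^'n"
    and J :: "real^'n \<Rightarrow> real \<Rightarrow> (real \<Rightarrow> real^'m) \<Rightarrow> real^'n^'n"
  assumes growth: "\<And>y. mckean_vlasov_growth M V0 V K x y (\<Phi> x) (\<Phi> y) p h"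
    and der: "\<And>t. t \<ge> 0 \<Longrightarrow>
           AE \<omega> in M. \<forall>x. ((\<lambda>y. \<Phi> y t \<omega>) has_derivative (\<lambda>h. J x t \<omega> *v h)) (at x)"
    and cont: "AE \<omega> in M. continuous_on {0..} (\<lambda>t. J x t \<omega>)"
  shows "AE \<omega> in M. \<forall>\<^sub>F n in sequentially. \<forall>t\<in>{real n * h..real n * h + h}. norm (J x t \<omega> *v v) \<le> (2 * p) ^ n"
proof -
  define y where "y j = x + (1 / real (Suc j)) *\<^sub>R v" for j
  define Df where "Df j t \<omega> = \<Phi> (y j) t \<omega> - \<Phi> x t \<omega>" for j t \<omega>
  interpret G: mckean_vlasov_growth M V0 V K x x "\<Phi> x" "\<Phi> x" p h by (rule growth)
  have h: "0 < h" by (rule G.h(1))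
  have p: "3 \<le> p" by (simp add: G.p_def)
  \<comment> \<open>Rational times keep the events measurable and meet only countably many of the
    null sets of \<open>der\<close>.\<close>
  define T where "T n = {real n * h..real n * h + h} \<inter> \<rat>" for n
  have T: "countable (T n)" "T n \<subseteq> {real n * h..real n * h + h}" for n
    by (auto simp: T_def intro: countable_Int2 countable_rat)
  have T0: "0 \<le> t" if "t \<in> T n" for t n using that h by (auto simp: T_def intro: order_trans[rotated])
  define C where "C = 9 + 72 * p * K\<^sup>2 + 288 * p * K\<^sup>2 * (real CARD('m) * real CARD('n)) ^ 3"
  have C0: "0 \<le> C" using p by (auto simp: C_def)
  define B where "B n j = {\<omega>\<in>space M. \<exists>t\<in>T n. norm (Df j t \<omega>) > (2 * p) ^ n / real (Suc j)}" for n j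
  have Bm: "B n j \<in> sets M" for n j
  proof -
    have [measurable]: "Df j t \<in> borel_measurable M" if "t \<in> T n" for t
    proof -
      interpret P: mckean_vlasov_growth M V0 V K x "y j" "\<Phi> x" "\<Phi> (y j)" p h by (rule growth)
      show ?thesis using P.D_measurable[OF T0[OF that]] unfolding P.D_def[abs_def] Df_def[abs_def] .
    qed
    have "B n j = (\<Union>t\<in>T n. {\<omega>\<in>space M. norm (Df j t \<omega>) > (2 * p) ^ n / real (Suc j)})" by (auto simp: B_def)
    also have "\<dots> \<in> sets M" using T by (intro sets.countable_UN') auto
    finally show ?thesis .
  qed
  have Bp: "G.prob (B n j) \<le> C * (norm v)\<^sup>2 * (1 / (2 * p)) ^ n" for n j
  proof -
    interpret P: mckean_vlasov_growth M V0 V K x "y j" "\<Phi> x" "\<Phi> (y j)" p h by (rule growth)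
    let ?a = "real (Suc j)"
    let ?c = "(2 * p) ^ n / ?a"
    have c: "0 < ?c" using p by simp
    have "B n j = {\<omega>\<in>space M. \<exists>t\<in>T n. norm (P.D t \<omega>) > ?c}" by (simp add: B_def Df_def P.D_def)
    then have "G.prob (B n j) \<le> C * P.u (real n * h) / ?c\<^sup>2"
      using P.D_maximal[OF _ T(1)[of n] T(2)[of n] c] h by (simp add: C_def)
    also have "\<dots> \<le> C * ((2 * p) ^ n * (norm (y j - x))\<^sup>2) / ?c\<^sup>2"
      using P.u_grid[of n] C0 by (intro divide_right_mono mult_left_mono) auto
    also have "\<dots> = C * (norm v)\<^sup>2 * (1 / (2 * p)) ^ n"
    proof -
      \<comment> \<open>The squared distance of the starting points and the squared level both carry
        the factor 1/?a^2, so j drops out.\<close>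
      have "norm (y j - x) = norm v / ?a" by (simp add: y_def)
      then have n: "(norm (y j - x))\<^sup>2 = (norm v)\<^sup>2 / ?a\<^sup>2" by (simp only: power_divide)
      define P where "P = (2 * p) ^ n"
      have P: "P > 0" using p by (simp add: P_def)
      have "C * (P * ((norm v)\<^sup>2 / ?a\<^sup>2)) / (P / ?a)\<^sup>2 = C * (norm v)\<^sup>2 * (1 / P)"
        using P by (simp add: power_divide power2_eq_square)
      then show ?thesis unfolding n by (simp add: P_def power_one_over)
    qed
    finally show ?thesis .
  qed
  \<comment> \<open>The limit inferior of \<open>B n j\<close> in j. Each of its increasing pieces
    is contained in a single \<open>B n N\<close>, so the bound for one event suffices.\<close>
  define A where "A n = (\<Union>N. \<Inter>j\<in>{N..}. B n j)" for n
  have Im: "(\<Inter>j\<in>{N..}. B n j) \<in> sets M" for n N by (rule sets.countable_INT') (use Bm in auto)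
  then have Am: "A n \<in> sets M" for n unfolding A_def by (intro sets.countable_UN) auto
  have Ap: "G.prob (A n) \<le> C * (norm v)\<^sup>2 * (1 / (2 * p)) ^ n" for n
  proof -
    have "incseq (\<lambda>N. \<Inter>j\<in>{N..}. B n j)" by (intro monoI INF_superset_mono) auto
    then have "(\<lambda>N. G.prob (\<Inter>j\<in>{N..}. B n j)) \<longlonglongrightarrow> G.prob (A n)"
      unfolding A_def using Im by (intro G.finite_Lim_measure_incseq) auto
    then show ?thesis
    proof (rule LIMSEQ_le_const2)
      have "G.prob (\<Inter>j\<in>{N..}. B n j) \<le> C * (norm v)\<^sup>2 * (1 / (2 * p)) ^ n" for N
        using G.finite_measure_mono[of "\<Inter>j\<in>{N..}. B n j" "B n N"] Bm[of n N] Bp[of n N] by (auto intro: order_trans)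
      then show "\<exists>N0. \<forall>N\<ge>N0. G.prob (\<Inter>j\<in>{N..}. B n j) \<le> C * (norm v)\<^sup>2 * (1 / (2 * p)) ^ n" by blast
    qed
  qed
  have "summable (\<lambda>n. G.prob (A n))"
  proof (rule summable_comparison_test')
    show "summable (\<lambda>n. C * (norm v)\<^sup>2 * (1 / (2 * p)) ^ n)"
      by (intro summable_mult summable_geometric) (use p in simp)
    show "norm (G.prob (A n)) \<le> C * (norm v)\<^sup>2 * (1 / (2 * p)) ^ n" if "0 \<le> n" for n using Ap[of n] by simp
  qed
  then have BC: "AE \<omega> in M. \<forall>\<^sub>F n in sequentially. \<omega> \<in> space M - A n"
    by (intro borel_cantelli_AE1 Am) (auto simp: G.emeasure_eq_measure)
  \<comment> \<open>The exceptional set in \<open>der\<close> may depend on t; one null set serves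
    all rational times, and continuity of the Jacobian in time covers the rest.\<close>
  have "AE \<omega> in M. \<forall>t\<in>{0..} \<inter> \<rat>. \<forall>x. ((\<lambda>y. \<Phi> y t \<omega>) has_derivative (\<lambda>h. J x t \<omega> *v h)) (at x)"
    by (subst AE_ball_countable) (use der in \<open>auto intro: countable_Int2 countable_rat\<close>)
  with BC cont AE_space show ?thesis
  proof eventually_elim
    case (elim \<omega>)
    from elim(1) show ?case
    proof eventually_elim
      case (elim n)
      note \<omega> = \<open>\<omega> \<in> space M - A n\<close>
      have rat: "norm (J x t \<omega> *v v) \<le> (2 * p) ^ n" if t: "t \<in> T n" for t
      proof (rule ccontr)
        assume "\<not> norm (J x t \<omega> *v v) \<le> (2 * p) ^ n"
        then have gt: "norm (J x t \<omega> *v v) > (2 * p) ^ n" by simp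
        have "((\<lambda>y. \<Phi> y t \<omega>) has_derivative (\<lambda>h. J x t \<omega> *v h)) (at x)"
          using \<open>\<forall>t\<in>{0..} \<inter> \<rat>. \<forall>x. ((\<lambda>y. \<Phi> y t \<omega>) has_derivative (\<lambda>h. J x t \<omega> *v h)) (at x)\<close> t T0[OF t] by (auto simp: T_def)
        from has_derivative_difference_quotient_gt[OF this gt]
        obtain N where N: "\<And>j. j \<ge> N \<Longrightarrow> norm (Df j t \<omega>) > (2 * p) ^ n / real (Suc j)"
          unfolding eventually_sequentially Df_def y_def by blast
        have "\<omega> \<in> B n j" if "j \<ge> N" for j using N[OF that] t \<omega> by (auto simp: B_def)
        then have "\<omega> \<in> A n" unfolding A_def by blast
        then show False using \<omega> by simp
      qed
      show ?case
      proof
        fix t assume t: "t \<in> {real n * h..real n * h + h}"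
        show "norm (J x t \<omega> *v v) \<le> (2 * p) ^ n"
        proof (rule continuous_le_if_le_on_Rats[OF _ _ _ t])
          show "continuous_on {real n * h..real n * h + h} (\<lambda>t. norm (J x t \<omega> *v v))"
            by (intro continuous_on_norm continuous_on_matrix_vector_mult
                continuous_on_subset[OF \<open>continuous_on {0..} (\<lambda>t. J x t \<omega>)\<close>]) (use h in \<open>auto intro: order_trans[rotated]\<close>)
        qed (use h rat in \<open>auto simp: T_def\<close>)
      qed
    qed
  qed
qed

text \<open>At time t about t/h steps have passed, and a^(t/h) = exp((ln a / h) t). Since
  \<open>a\<close> is at least 1, replacing the integer number of steps by t/h only increases the
  bound.\<close>

lemma grid_bound_imp_exponent_le:
  fixes f :: "real \<Rightarrow> real"
  assumes f: "\<And>t. 0 \<le> f t" and a: "1 \<le> a" and h: "0 < h"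
    and ev: "\<forall>\<^sub>F n in sequentially. \<forall>t\<in>{real n * h..real n * h + h}. f t \<le> a ^ n"
  shows "Limsup at_top (\<lambda>t. ereal (1 / t) * log_ext (f t)) \<le> ereal (ln a / h)"
  unfolding Limsup_scaled_log_le_iff[OF f]
proof (intro allI impI)
  fix c assume "ereal (ln a / h) < ereal c"
  then have c: "ln a / h < c" by simp
  from ev obtain N where N: "\<And>n t. n \<ge> N \<Longrightarrow> t \<in> {real n * h..real n * h + h} \<Longrightarrow> f t \<le> a ^ n"
    unfolding eventually_sequentially by blast
  have "\<forall>\<^sub>F t in at_top. t > 0 \<and> t \<ge> real N * h"
    by (intro eventually_conj eventually_gt_at_top eventually_ge_at_top)
  then show "\<forall>\<^sub>F t in at_top. f t < exp (c * t)"
  proof eventually_elim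
    case (elim t)
    define n where "n = nat \<lfloor>t / h\<rfloor>"
    have "0 \<le> t / h" using elim h by simp
    then have n: "real n \<le> t / h" "t / h \<le> real n + 1" unfolding n_def by linarith+
    have "real N \<le> t / h" using elim h by (simp add: le_divide_eq)
    then have "N \<le> n" unfolding n_def by (metis le_nat_floor)
    moreover have "t \<in> {real n * h..real n * h + h}" using n h by (simp add: field_simps)
    ultimately have "f t \<le> a ^ n" by (rule N)
    also have "\<dots> = exp (ln a * real n)" using a by (simp add: exp_of_nat_mult mult.commute)
    also have "\<dots> \<le> exp (ln a * (t / h))" using mult_left_mono[OF n(1), of "ln a"] a by simp
    also have "\<dots> < exp (c * t)"
    proof -
      have "(ln a / h) * t < c * t" using c elim by (intro mult_strict_right_mono) auto
      then show ?thesis by simp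
    qed
    finally show ?case .
  qed
qed

theorem theorem3p5:
  fixes L :: "'l measure"
    and M :: "(real \<Rightarrow> real^'m) measure"
    and V0 :: "real^'n \<Rightarrow> (real^'n) measure \<Rightarrow> real^'n"
    and V :: "'m \<Rightarrow> real^'n \<Rightarrow> (real^'n) measure \<Rightarrow> real^'n"
    and \<Phi> :: "real^'n \<Rightarrow> real \<Rightarrow> (real \<Rightarrow> real^'m) \<Rightarrow> real^'n"
    and J :: "real^'n \<Rightarrow> real \<Rightarrow> (real \<Rightarrow> real^'m) \<Rightarrow> real^'n^'n"
  assumes "carries_P2 L TYPE(real^'n)"
    and "C11_b_Lip L V0"
    and "\<And>k. C11_b_Lip L (V k)"
    and "wiener_space M"
    and "\<And>x. mckean_vlasov_solution M V0 V x (\<Phi> x)"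
    and "\<And>t. t \<ge> 0 \<Longrightarrow>
           AE \<omega> in M. \<forall>x. ((\<lambda>y. \<Phi> y t \<omega>) has_derivative (\<lambda>h. J x t \<omega> *v h)) (at x)"
    and "\<And>x. AE \<omega> in M. continuous_on {0..} (\<lambda>t. J x t \<omega>)"
  shows "\<exists>\<kappa>>0. \<forall>x. AE \<omega> in M.
    \<exists>(r::nat) (E :: nat \<Rightarrow> (real^'n) set) (lam :: nat \<Rightarrow> ereal).
      r \<le> CARD('n) \<and>
      (\<forall>i\<le>r. subspace (E i)) \<and>
      E 0 = {0} \<and> (\<forall>i<r. E i \<subset> E (Suc i)) \<and> E r = UNIV \<and>
      (\<forall>i. 1 \<le> i \<and> i < r \<longrightarrow> lam i < lam (Suc i)) \<and>
      lam r \<le> ereal \<kappa> \<and>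
      (\<forall>i. 1 \<le> i \<and> i \<le> r \<longrightarrow>
         (\<forall>v \<in> E i - E (i - 1).
            Limsup at_top (\<lambda>t. ereal (1 / t) * log_ext (norm (J x t \<omega> *v v))) = lam i))"
proof -
  have M: "prob_space M"
    using wiener_space_brownian_filtration[OF assms(4)] by (rule brownian_filtration.axioms(1))
  obtain K0 where K0: "0 < K0"
    "\<And>x y X Y. X \<in> L2_rv M \<Longrightarrow> Y \<in> L2_rv M \<Longrightarrow>
      norm (V0 x (distr M borel X) - V0 y (distr M borel Y)) \<le> K0 * (norm (x - y) + L2_rv_norm M (\<lambda>\<omega>. X \<omega> - Y \<omega>))"
    by (rule C11_b_Lip_imp_lipschitz[OF assms(1,2) M]) blast
  \<comment> \<open>Packaged as a predicate so that constants can be chosen for all components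
    simultaneously.\<close>
  define is_lip where "is_lip k K \<longleftrightarrow> 0 < K \<and> (\<forall>x y X Y. X \<in> L2_rv M \<longrightarrow> Y \<in> L2_rv M \<longrightarrow>
      norm (V k x (distr M borel X) - V k y (distr M borel Y)) \<le> K * (norm (x - y) + L2_rv_norm M (\<lambda>\<omega>. X \<omega> - Y \<omega>)))" for k K
  have "\<exists>K. is_lip k K" for k
  proof -
    obtain K where "0 < K"
      "\<And>x y X Y. X \<in> L2_rv M \<Longrightarrow> Y \<in> L2_rv M \<Longrightarrow>
        norm (V k x (distr M borel X) - V k y (distr M borel Y)) \<le> K * (norm (x - y) + L2_rv_norm M (\<lambda>\<omega>. X \<omega> - Y \<omega>))"
      by (rule C11_b_Lip_imp_lipschitz[OF assms(1,3) M]) blast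
    then have "is_lip k K" unfolding is_lip_def by simp
    then show ?thesis ..
  qed
  then obtain K1 where is_lip: "\<And>k. is_lip k (K1 k)" by metis
  have K1: "0 < K1 k" for k using is_lip[of k] by (simp add: is_lip_def)
  have K1_lip: "norm (V k x (distr M borel X) - V k y (distr M borel Y)) \<le> K1 k * (norm (x - y) + L2_rv_norm M (\<lambda>\<omega>. X \<omega> - Y \<omega>))"
    if "X \<in> L2_rv M" "Y \<in> L2_rv M" for k x y X Y
    using is_lip[of k] that unfolding is_lip_def by simp
  \<comment> \<open>There are finitely many coefficients, so the sum of their constants serves all
    of them.\<close>
  define K where "K = K0 + (\<Sum>k\<in>UNIV. K1 k)"
  have s0: "0 \<le> (\<Sum>k\<in>UNIV. K1 k)" by (intro sum_nonneg less_imp_le K1)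
  have K: "0 < K" "K0 \<le> K" "K1 k \<le> K" for k
  proof -
    have "K1 k \<le> (\<Sum>k\<in>UNIV. K1 k)" by (rule member_le_sum) (auto intro: less_imp_le K1)
    then show "0 < K" "K0 \<le> K" "K1 k \<le> K" using K0(1) s0 by (simp_all add: K_def)
  qed
  define p :: real where "p = 3 + 3 * real CARD('m) * real CARD('n)"
  define Q where "Q = p * (4 * K\<^sup>2 + 16 * real CARD('m) * real CARD('n) * K\<^sup>2)"
  have p: "3 \<le> p" by (simp add: p_def)
  have Q: "0 < Q" unfolding Q_def using p K(1) by (intro mult_pos_pos add_pos_nonneg) auto
  \<comment> \<open>The largest step satisfying both \<open>h <= 1\<close> and the absorption
    condition \<open>Q * h <= 1/2\<close>.\<close>
  define h where "h = min 1 (1 / (2 * Q))"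
  have h: "0 < h" "h \<le> 1" "Q * h \<le> 1 / 2"
  proof -
    show "0 < h" "h \<le> 1" using Q by (auto simp: h_def)
    have "Q * h \<le> Q * (1 / (2 * Q))" using Q by (intro mult_left_mono) (auto simp: h_def)
    then show "Q * h \<le> 1 / 2" using Q by simp
  qed
  have growth: "mckean_vlasov_growth M V0 V K x y (\<Phi> x) (\<Phi> y) p h" for x y
  proof
    have nn: "0 \<le> norm (x - y) + L2_rv_norm M (\<lambda>\<omega>. X \<omega> - Y \<omega>)"
      for x y :: "real^'n" and X Y :: "(real \<Rightarrow> real^'m) \<Rightarrow> real^'n"
      by (simp add: L2_rv_norm_nonneg)
    show "norm (V0 x (distr M borel X) - V0 y (distr M borel Y)) \<le> K * (norm (x - y) + L2_rv_norm M (\<lambda>\<omega>. X \<omega> - Y \<omega>))"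
      if "X \<in> L2_rv M" "Y \<in> L2_rv M" for x y X Y
      by (rule order_trans[OF K0(2)[OF that] mult_right_mono[OF K(2) nn]])
    show "norm (V k x (distr M borel X) - V k y (distr M borel Y)) \<le> K * (norm (x - y) + L2_rv_norm M (\<lambda>\<omega>. X \<omega> - Y \<omega>))"
      if "X \<in> L2_rv M" "Y \<in> L2_rv M" for k x y X Y
      by (rule order_trans[OF K1_lip[OF that] mult_right_mono[OF K(3) nn]])
    show "p = 3 + 3 * real CARD('m) * real CARD('n)" by (rule p_def)
    show "p * (4 * K\<^sup>2 + 16 * real CARD('m) * real CARD('n) * K\<^sup>2) * h \<le> 1 / 2" using h(3) by (simp add: Q_def)
  qed (use assms(4,5) K(1) h in auto)
  \<comment> \<open>The growth rate of (2p)^n over steps of length \<open>h\<close>; it is fixed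
    before x is chosen.\<close>
  define \<kappa> where "\<kappa> = ln (2 * p) / h"
  have "0 < \<kappa>" using p h by (simp add: \<kappa>_def)
  moreover have "AE \<omega> in M.
    \<exists>(r::nat) (E :: nat \<Rightarrow> (real^'n) set) (lam :: nat \<Rightarrow> ereal).
      r \<le> CARD('n) \<and>
      (\<forall>i\<le>r. subspace (E i)) \<and>
      E 0 = {0} \<and> (\<forall>i<r. E i \<subset> E (Suc i)) \<and> E r = UNIV \<and>
      (\<forall>i. 1 \<le> i \<and> i < r \<longrightarrow> lam i < lam (Suc i)) \<and>
      lam r \<le> ereal \<kappa> \<and>
      (\<forall>i. 1 \<le> i \<and> i \<le> r \<longrightarrow>
         (\<forall>v \<in> E i - E (i - 1).
            Limsup at_top (\<lambda>t. ereal (1 / t) * log_ext (norm (J x t \<omega> *v v))) = lam i))" for x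
  proof -
    \<comment> \<open>Only the finitely many basis vectors are handled almost surely, so that a
      single null set serves every direction.\<close>
    have "AE \<omega> in M. \<forall>b\<in>Basis. \<forall>\<^sub>F n in sequentially.
        \<forall>t\<in>{real n * h..real n * h + h}. norm (J x t \<omega> *v b) \<le> (2 * p) ^ n"
      by (intro AE_finite_allI finite_Basis jacobian_grid_bound[OF growth assms(6,7)])
    then show ?thesis
    proof eventually_elim
      case (elim \<omega>)
      define chi where "chi v = Limsup at_top (\<lambda>t. ereal (1 / t) * log_ext (norm (J x t \<omega> *v v)))" for v
      have sub: "subspace {v. chi v \<le> a}" for a unfolding chi_def by (rule lyapunov_subspace)
      have "chi b \<le> ereal \<kappa>" if "b \<in> Basis" for b
        unfolding chi_def \<kappa>_def
        by (rule grid_bound_imp_exponent_le) (use elim that p h in auto)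
      \<comment> \<open>The vectors with exponent at most \<kappa> form a subspace containing the
        basis; this extends the bound to all vectors without further null sets.\<close>
      then have "span Basis \<subseteq> {v. chi v \<le> ereal \<kappa>}" by (intro span_minimal sub) auto
      then have chi_le: "chi v \<le> ereal \<kappa>" for v by (auto simp: span_Basis)
      obtain r :: nat and E and lam :: "nat \<Rightarrow> ereal" where
        r: "1 \<le> r" "r \<le> DIM(real^'n)"
        and E: "\<And>i. subspace (E i)" "E 0 = {0}" "\<And>i. i < r \<Longrightarrow> E i \<subset> E (Suc i)" "E r = UNIV"
        and lam: "\<And>i. 1 \<le> i \<Longrightarrow> i < r \<Longrightarrow> lam i < lam (Suc i)"
        and chi: "\<And>i v. 1 \<le> i \<Longrightarrow> i \<le> r \<Longrightarrow> v \<in> E i - E (i - 1) \<Longrightarrow> chi v = lam i"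
        using sublevel_filtration[OF sub] by metis
      have "lam r \<le> ereal \<kappa>"
      proof -
        \<comment> \<open>The strict inclusion at the top supplies a vector whose exponent is
          exactly \<open>lam r\<close>.\<close>
        have "E (r - 1) \<subset> E r" using E(3)[of "r - 1"] r(1) by simp
        then obtain v where "v \<in> E r - E (r - 1)" by blast
        then show ?thesis using chi[OF r(1) order_refl] chi_le[of v] by simp
      qed
      then show ?case
        using r E lam chi unfolding chi_def
        by (intro exI[of _ r] exI[of _ E] exI[of _ lam]) auto
    qed
  qed
  ultimately show ?thesis by blast
qed

end
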